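(* Let $\mu_1,\mu_2\in\mathbb R$ and let $B^{\mu_1}$, $B^{\mu_2}$ be independent Brownian motions with drifts $\mu_1$, $\mu_2$, both started at $0$. For $w>0$ and $j=1,2$ let ${}^{\mu_j}T_{0,w}=\sup\{s<w:B^{\mu_j}(s)=0\}$, and for $t>0$ let ${}^{\mu_1}T_{0,{}^{\mu_2}T_{0,t}}=\sup\{s<{}^{\mu_2}T_{0,t}:B^{\mu_1}(s)=0\}$. Then for $0<a<t$, $$P\big({}^{\mu_1}T_{0,{}^{\mu_2}T_{0,t}}<a\big)=P({}^{\mu_1}T_{0,t}<a)+\int_a^te^{-\frac{\mu_1^2w}{2}}\frac{\sqrt a}{\pi w\sqrt{w-a}}\left[1-\frac2\pi e^{-\frac{\mu_2^2w}{2}}\int_0^{\arccos\sqrt{w/t}}e^{-\frac{\mu_2^2w}{2}\tan^2\theta}\,d\theta\right]dw .$$ In the case $\mu_1=\mu_2=0$ (writing $T$ for ${}^0T$) this becomes $$P(T_{0,T_{0,t}}<a)=\frac2\pi\arcsin\sqrt{\frac at}+\int_a^t\frac2\pi\arcsin\sqrt{\frac aw}\;\frac{dw}{\pi\sqrt{w(t-w)}} .$$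
   Context: A Brownian motion with drift $\mu$ started at $0$ is $B^\mu(s)=B(s)+\mu s$, $s\ge 0$, with $B$ a standard one-dimensional Brownian motion, $B(0)=0$. Suprema are over $s\ge 0$. ${}^{\mu_1}T_{0,{}^{\mu_2}T_{0,t}}$ is the last zero of $B^{\mu_1}$ before the (independent, random) time at which $B^{\mu_2}$ visits zero for the last time before $t$. *)

theory Defs
  imports "HOL-Probability.Probability"
begin

text \<open>
  A standard one-dimensional Brownian motion on the probability space \<open>M\<close>, with time set
  \<open>{0..}\<close>. Only the values \<open>B s\<close> with \<open>s \<ge> 0\<close> matter. As \<open>M\<close> need not be complete,
  \<open>B(0) = 0\<close> and continuity are required of every path, not just of almost every path.
\<close>

definition standard_brownian_motion :: "'a measure \<Rightarrow> (real \<Rightarrow> 'a \<Rightarrow> real) \<Rightarrow> bool" where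
  "standard_brownian_motion M B \<longleftrightarrow>
     prob_space M \<and>
     (\<forall>s\<ge>0. B s \<in> borel_measurable M) \<and>
     (\<forall>\<omega>\<in>space M. B 0 \<omega> = 0) \<and>
     (\<forall>\<omega>\<in>space M. continuous_on {0..} (\<lambda>s. B s \<omega>)) \<and>
     (\<forall>s t. 0 \<le> s \<longrightarrow> s < t \<longrightarrow>
        distributed M lborel (\<lambda>\<omega>. B t \<omega> - B s \<omega>) (normal_density 0 (sqrt (t - s)))) \<and>
     (\<forall>(n::nat) (\<tau> :: nat \<Rightarrow> real). 0 \<le> \<tau> 0 \<longrightarrow> (\<forall>i<n. \<tau> i \<le> \<tau> (Suc i)) \<longrightarrow>
        prob_space.indep_vars M (\<lambda>_. borel) (\<lambda>i \<omega>. B (\<tau> (Suc i)) \<omega> - B (\<tau> i) \<omega>) {..<n})"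

definition with_drift :: "real \<Rightarrow> (real \<Rightarrow> 'a \<Rightarrow> real) \<Rightarrow> real \<Rightarrow> 'a \<Rightarrow> real" where
  "with_drift \<mu> B s \<omega> = B s \<omega> + \<mu> * s"

text \<open>Independence of the whole processes, as random elements of the product space over \<open>{0..}\<close>.\<close>

definition indep_processes ::
    "'a measure \<Rightarrow> (real \<Rightarrow> 'a \<Rightarrow> real) \<Rightarrow> (real \<Rightarrow> 'a \<Rightarrow> real) \<Rightarrow> bool" where
  "indep_processes M X Y \<longleftrightarrow>
     prob_space.indep_var M
       (\<Pi>\<^sub>M s\<in>{0..}. borel) (\<lambda>\<omega>. \<lambda>s\<in>{0..}. X s \<omega>)
       (\<Pi>\<^sub>M s\<in>{0..}. borel) (\<lambda>\<omega>. \<lambda>s\<in>{0..}. Y s \<omega>)"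

text \<open>
  For \<open>w > 0\<close> and a path started at \<open>0\<close> the set below contains \<open>0\<close> and is bounded by \<open>w\<close>.
  It is empty for \<open>w = 0\<close>; in an iterated last zero this happens only if the inner last zero
  is \<open>0\<close>, an event of probability zero for Brownian motions.
\<close>

definition last_zero :: "(real \<Rightarrow> 'a \<Rightarrow> real) \<Rightarrow> real \<Rightarrow> 'a \<Rightarrow> real" where
  "last_zero X w \<omega> = Sup {s. 0 \<le> s \<and> s < w \<and> X s \<omega> = 0}"

end

theory Submission
  imports Defs "HOL-Real_Asymp.Real_Asymp"
begin

text \<open>
  Let \<open>D\<close> be the first zero of the first process in \<open>[a, t]\<close>, set to \<open>t\<close> if there is none, and let \<open>T\<close>
  be the last zero of the second process before \<open>t\<close>. Almost surely, the last zero of the first process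
  before \<open>T\<close> is less than \<open>a\<close> iff \<open>T \<le> D\<close>. As \<open>D\<close> and \<open>T\<close> are independent, the probability of
  this event is \<open>P(D = t)\<close> plus the integral of \<open>P(T \<le> w)\<close> against the density of \<open>D\<close> on \<open>(a, t)\<close>.
  Both laws follow from the probability that a process with drift has no zero in \<open>[a, t]\<close>.

  That probability comes from the reflection principle, in the form: if \<open>g\<close> is odd up to the density
  of the reflected law, so that its heat-semigroup extension vanishes at \<open>0\<close>, then paths that have
  crossed \<open>0\<close> do not contribute to \<open>E[g(X t); X a > 0]\<close>. This is shown by stopping at the first
  negative value on a finite grid, which needs only the independence of finitely many increments,
  and refining the grid.
\<close>

subsection \<open>First and last zeros of a path\<close>

text \<open>The iterated zero evaluates the first path at a random time taken from the second. The
  comparison with \<open>D\<close> separates the two: \<open>D\<close> is a functional of the first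
  path alone, \<open>T\<close> of the second alone. Both laws come from one computation, since
  \<open>w < D\<close> says that there is no zero in [a, w], and \<open>T \<le> w\<close> says,
  almost surely, that there is none in [w, t). With drift, the weight of the reflected law may be
  unbounded, so the reflection identity is proved for a compactly supported cut-off, which dominated
  convergence then removes. Refining the grid only controls paths that stay nonnegative; strict
  positivity is reached by comparing a start at 0 with starts slightly below 0. The integral over
  \<open>\<theta>\<close> arises by averaging the first-passage density over the Gaussian position
  at time \<open>a\<close>. The terms linear in the position cancel, leaving the density
  \<open>passage_density\<close>, and the substitution
  \<open>w = a * (1 + (tan \<theta>)\<^sup>2)\<close> turns its integral into the one over
  \<open>\<theta>\<close>.\<close>

definition first_zero :: "(real \<Rightarrow> 'a \<Rightarrow> real) \<Rightarrow> real \<Rightarrow> real \<Rightarrow> 'a \<Rightarrow> real" where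
  "first_zero X q t \<omega> = Inf (insert t {s. q \<le> s \<and> s \<le> t \<and> X s \<omega> = 0})"

lemma first_zero_bdd: "bdd_below (insert t {s. q \<le> s \<and> s \<le> t \<and> X s \<omega> = (0::real)})"
  for q t :: real
  by (rule bdd_belowI[of _ "min q t"]) auto

lemma first_zero_le: "first_zero X q t \<omega> \<le> t"
  unfolding first_zero_def by (rule cInf_lower[OF _ first_zero_bdd]) auto

text \<open>Adding \<open>t\<close> to the set makes the equivalence hold up to
  \<open>v = t\<close>. The interval excludes \<open>v\<close>, just as \<open>last_zero\<close>
  looks only at \<open>s < v\<close>; this match is what turns last zeros into comparisons with a
  first zero.\<close>

lemma le_first_zero_iff:
  assumes "v \<le> t"
  shows "v \<le> first_zero X q t \<omega> \<longleftrightarrow> (\<forall>s. q \<le> s \<and> s < v \<longrightarrow> X s \<omega> \<noteq> 0)"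
  unfolding first_zero_def
  by (subst le_cInf_iff[OF _ first_zero_bdd]) (use assms in \<open>force+\<close>)

text \<open>The strict form needs the infimum to be attained, so continuity enters through the
  closedness of the zero set.\<close>

lemma less_first_zero_iff:
  fixes X :: "real \<Rightarrow> 'a \<Rightarrow> real"
  assumes cont: "continuous_on {0..} (\<lambda>s. X s \<omega>)" and "0 \<le> q" "w < t"
  shows "w < first_zero X q t \<omega> \<longleftrightarrow> (\<forall>s\<in>{q..w}. X s \<omega> \<noteq> 0)"
proof
  assume *: "w < first_zero X q t \<omega>"
  show "\<forall>s\<in>{q..w}. X s \<omega> \<noteq> 0"
    using * le_first_zero_iff[OF first_zero_le[of X q t \<omega>], of X q \<omega>] by auto
next
  assume *: "\<forall>s\<in>{q..w}. X s \<omega> \<noteq> 0"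
  let ?Z = "{s. q \<le> s \<and> s \<le> t \<and> X s \<omega> = 0}"
  have "closed {s \<in> {q..t}. X s \<omega> = 0}"
    by (rule continuous_closed_preimage_constant)
       (use \<open>0 \<le> q\<close> in \<open>auto intro: continuous_on_subset[OF cont]\<close>)
  also have "{s \<in> {q..t}. X s \<omega> = 0} = ?Z" by auto
  finally have "closed (insert t ?Z)" by (rule closed_insert)
  then have "first_zero X q t \<omega> \<in> insert t ?Z"
    unfolding first_zero_def by (intro closed_contains_Inf first_zero_bdd) auto
  then show "w < first_zero X q t \<omega>" using * \<open>w < t\<close> by force
qed

lemma last_zero_bounds:
  assumes "X 0 \<omega> = 0" "0 < v"
  shows "0 \<le> last_zero X v \<omega>" "last_zero X v \<omega> \<le> v"
proof -
  have ne: "{s. 0 \<le> s \<and> s < v \<and> X s \<omega> = 0} \<noteq> {}" using assms by auto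
  have bdd: "bdd_above {s. 0 \<le> s \<and> s < v \<and> X s \<omega> = 0}" by (rule bdd_aboveI[of _ v]) auto
  show "0 \<le> last_zero X v \<omega>" unfolding last_zero_def
    by (rule cSup_upper[OF _ bdd]) (use assms in auto)
  show "last_zero X v \<omega> \<le> v" unfolding last_zero_def
    by (rule cSup_least[OF ne]) auto
qed

text \<open>A rational \<open>q\<close> fits between the last zero and \<open>w\<close>. The event
  becomes a countable union in which \<open>v\<close> occurs only in a comparison with a first zero,
  so that \<open>v\<close> may later be a random time.\<close>

lemma last_zero_less_iff:
  assumes "X 0 \<omega> = 0" "0 < v" "v \<le> t"
  shows "last_zero X v \<omega> < w \<longleftrightarrow> (\<exists>q\<in>\<rat>. 0 \<le> q \<and> q < w \<and> v \<le> first_zero X q t \<omega>)"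
proof -
  let ?Z = "{s. 0 \<le> s \<and> s < v \<and> X s \<omega> = 0}"
  have ne: "?Z \<noteq> {}" using assms by auto
  have bdd: "bdd_above ?Z" by (rule bdd_aboveI[of _ v]) auto
  have 0: "0 \<le> last_zero X v \<omega>" using last_zero_bounds(1)[where X = X and \<omega> = \<omega>, OF assms(1,2)] .
  show ?thesis
  proof
    assume "last_zero X v \<omega> < w"
    then obtain q where q: "q \<in> \<rat>" "last_zero X v \<omega> < q" "q < w" using Rats_dense_in_real by blast
    have "X s \<omega> \<noteq> 0" if "q \<le> s" "s < v" for s
    proof
      assume "X s \<omega> = 0"
      then have "s \<le> last_zero X v \<omega>" unfolding last_zero_def
        by (intro cSup_upper bdd) (use that q 0 in auto)
      then show False using that q by auto
    qed
    then show "\<exists>q\<in>\<rat>. 0 \<le> q \<and> q < w \<and> v \<le> first_zero X q t \<omega>"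
      using q 0 by (intro bexI[of _ q]) (auto simp: le_first_zero_iff[OF assms(3)])
  next
    assume "\<exists>q\<in>\<rat>. 0 \<le> q \<and> q < w \<and> v \<le> first_zero X q t \<omega>"
    then obtain q where q: "0 \<le> q" "q < w" "v \<le> first_zero X q t \<omega>" by auto
    have "last_zero X v \<omega> \<le> q" unfolding last_zero_def
      by (rule cSup_least[OF ne]) (use q(3)[unfolded le_first_zero_iff[OF assms(3)]] in \<open>auto intro: leI\<close>)
    then show "last_zero X v \<omega> < w" using q by auto
  qed
qed

text \<open>On a compact interval the modulus of a continuous function without zeros has a positive
  minimum, and such a bound can be tested on countably many points. The point \<open>q\<close> joins
  the rationals because points are approached from the left inside the interval, which is impossible
  at \<open>q\<close>.\<close>

lemma nonvanishing_iff_bounded_away: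
  fixes f :: "real \<Rightarrow> real"
  assumes cont: "continuous_on {0..} f" and "0 \<le> q"
  shows "(\<forall>s\<in>{q..w}. f s \<noteq> 0) \<longleftrightarrow> (\<exists>n::nat. \<forall>r\<in>{q..w} \<inter> insert q \<rat>. 1 / real (Suc n) \<le> \<bar>f r\<bar>)"
proof
  assume *: "\<forall>s\<in>{q..w}. f s \<noteq> 0"
  show "\<exists>n::nat. \<forall>r\<in>{q..w} \<inter> insert q \<rat>. 1 / real (Suc n) \<le> \<bar>f r\<bar>"
  proof (cases "q \<le> w")
    case True
    have "continuous_on {q..w} (\<lambda>s. \<bar>f s\<bar>)"
      by (intro continuous_intros continuous_on_subset[OF cont]) (use \<open>0 \<le> q\<close> in auto)
    then obtain s where s: "s \<in> {q..w}" "\<And>r. r \<in> {q..w} \<Longrightarrow> \<bar>f s\<bar> \<le> \<bar>f r\<bar>"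
      using continuous_attains_inf[of "{q..w}" "\<lambda>s. \<bar>f s\<bar>"] True by auto
    have "0 < \<bar>f s\<bar>" using * s by auto
    then obtain n where "1 / real (Suc n) < \<bar>f s\<bar>" using nat_approx_posE by blast
    then show ?thesis using s by (intro exI[of _ n]) force
  qed auto
next
  assume "\<exists>n::nat. \<forall>r\<in>{q..w} \<inter> insert q \<rat>. 1 / real (Suc n) \<le> \<bar>f r\<bar>"
  then obtain n :: nat where n: "\<And>r. r \<in> {q..w} \<Longrightarrow> r \<in> insert q \<rat> \<Longrightarrow> 1 / real (Suc n) \<le> \<bar>f r\<bar>"
    by blast
  show "\<forall>s\<in>{q..w}. f s \<noteq> 0"
  proof safe
    fix s assume s: "s \<in> {q..w}" "f s = 0"
    obtain d where d: "d > 0" "\<And>x. x \<in> {0..} \<Longrightarrow> dist x s < d \<Longrightarrow> dist (f x) (f s) < 1 / real (Suc n)"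
      using cont[unfolded continuous_on_iff, rule_format, of s "1 / real (Suc n)"] s \<open>0 \<le> q\<close> by auto
    have "\<exists>r \<in> {q..w} \<inter> insert q \<rat>. dist r s < d"
    proof (cases "s = q")
      case False
      then have "max q (s - d) < s" using s d by auto
      then obtain r where "r \<in> \<rat>" "max q (s - d) < r" "r < s" using Rats_dense_in_real by blast
      then show ?thesis using s by (intro bexI[of _ r]) (auto simp: dist_real_def)
    qed (use s d in auto)
    then obtain r where r: "r \<in> {q..w}" "r \<in> insert q \<rat>" "dist r s < d" by blast
    then have "\<bar>f r\<bar> < 1 / real (Suc n)" using d(2)[of r] \<open>0 \<le> q\<close> s by (auto simp: dist_real_def)
    then show False using n[OF r(1,2)] by auto
  qed
qed

text \<open>Measurability is shown over an arbitrary \<open>F\<close>, to serve both for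
  \<open>M\<close> and for the smaller sigma-algebra generated by one process, which independence
  requires.\<close>

lemma nonvanishing_sets:
  fixes X :: "real \<Rightarrow> 'a \<Rightarrow> real"
  assumes meas: "\<And>s. 0 \<le> s \<Longrightarrow> X s \<in> borel_measurable F"
    and cont: "\<And>\<omega>. \<omega> \<in> space F \<Longrightarrow> continuous_on {0..} (\<lambda>s. X s \<omega>)" and "0 \<le> q"
  shows "{\<omega> \<in> space F. \<forall>s\<in>{q..w}. X s \<omega> \<noteq> 0} \<in> sets F"
proof -
  have c: "countable ({q..w} \<inter> insert q \<rat>)"
    by (rule countable_subset[of _ "insert q \<rat>"]) (auto simp: countable_rat)
  have [measurable]: "X r \<in> borel_measurable F" if "r \<in> {q..w} \<inter> insert q \<rat>" for r
    using meas that \<open>0 \<le> q\<close> by auto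
  have "{\<omega> \<in> space F. \<forall>s\<in>{q..w}. X s \<omega> \<noteq> 0} =
      {\<omega> \<in> space F. \<exists>n::nat. \<forall>r\<in>{q..w} \<inter> insert q \<rat>. 1 / real (Suc n) \<le> \<bar>X r \<omega>\<bar>}"
    by (rule Collect_cong) (use nonvanishing_iff_bounded_away[OF cont \<open>0 \<le> q\<close>, where w = w] in blast)
  also have "\<dots> \<in> sets F"
    by (intro sets.sets_Collect_countable_Ex sets.sets_Collect_countable_All' c) measurable
  finally show ?thesis .
qed

lemma first_zero_measurable:
  fixes X :: "real \<Rightarrow> 'a \<Rightarrow> real"
  assumes meas: "\<And>s. 0 \<le> s \<Longrightarrow> X s \<in> borel_measurable F"
    and cont: "\<And>\<omega>. \<omega> \<in> space F \<Longrightarrow> continuous_on {0..} (\<lambda>s. X s \<omega>)" and "0 \<le> q"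
  shows "first_zero X q t \<in> borel_measurable F"
proof (subst borel_measurable_iff_greater, intro allI)
  fix w
  show "{\<omega> \<in> space F. w < first_zero X q t \<omega>} \<in> sets F"
  proof (cases "w < t")
    case True
    then have "{\<omega> \<in> space F. w < first_zero X q t \<omega>} = {\<omega> \<in> space F. \<forall>s\<in>{q..w}. X s \<omega> \<noteq> 0}"
      by (intro Collect_cong conj_cong refl less_first_zero_iff cont \<open>0 \<le> q\<close>)
    then show ?thesis using nonvanishing_sets[OF meas cont \<open>0 \<le> q\<close>] by simp
  next
    case False
    then have "\<not> w < first_zero X q t \<omega>" for \<omega>
      using first_zero_le[of X q t \<omega>] by auto
    then show ?thesis by simp
  qed
qed

lemma last_zero_measurable:
  fixes X :: "real \<Rightarrow> 'a \<Rightarrow> real"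
  assumes meas: "\<And>s. 0 \<le> s \<Longrightarrow> X s \<in> borel_measurable F"
    and cont: "\<And>\<omega>. \<omega> \<in> space F \<Longrightarrow> continuous_on {0..} (\<lambda>s. X s \<omega>)"
    and X0: "\<And>\<omega>. \<omega> \<in> space F \<Longrightarrow> X 0 \<omega> = 0" and "0 < t"
  shows "last_zero X t \<in> borel_measurable F"
proof (subst borel_measurable_iff_less, intro allI)
  fix w
  have "{\<omega> \<in> space F. last_zero X t \<omega> < w} =
      {\<omega> \<in> space F. \<exists>q\<in>{q\<in>\<rat>. 0 \<le> q \<and> q < w}. t \<le> first_zero X q t \<omega>}"
    by (intro Collect_cong conj_cong refl
       trans[OF last_zero_less_iff[where X = X and v = t and t = t, OF X0 \<open>0 < t\<close> order_refl]]) auto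
  also have "\<dots> \<in> sets F"
  proof (intro sets.sets_Collect_countable_Ex')
    show "countable {q\<in>\<rat>. 0 \<le> q \<and> q < w}"
      by (rule countable_subset[of _ "\<rat>"]) (auto simp: countable_rat)
    fix q assume "q \<in> {q\<in>\<rat>. 0 \<le> q \<and> q < w}"
    then have [measurable]: "first_zero X q t \<in> borel_measurable F"
      by (intro first_zero_measurable meas cont) auto
    show "{\<omega> \<in> space F. t \<le> first_zero X q t \<omega>} \<in> sets F" by measurable
  qed
  finally show "{\<omega> \<in> space F. last_zero X t \<omega> < w} \<in> sets F" .
qed

subsection \<open>The Markov property at fixed times\<close>

text \<open>Fubini for the joint law, which is a product measure: one variable is frozen while the
  other is integrated out. It takes the place of conditional expectations, in the Markov property
  and again for the pair of \<open>D\<close> and \<open>T\<close>.\<close>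

lemma (in prob_space) indep_var_lebesgue_integral:
  fixes f :: "'b \<times> 'b \<Rightarrow> real"
  assumes ind: "indep_var N W L Z" and f: "f \<in> borel_measurable (N \<Otimes>\<^sub>M L)"
    and int: "integrable M (\<lambda>\<omega>. f (W \<omega>, Z \<omega>))"
  shows "(\<integral>\<omega>. f (W \<omega>, Z \<omega>) \<partial>M) = (\<integral>\<omega>. (\<integral>\<omega>'. f (W \<omega>, Z \<omega>') \<partial>M) \<partial>M)"
proof -
  have [measurable]: "W \<in> measurable M N" "Z \<in> measurable M L"
    using indep_var_rv1[OF ind] indep_var_rv2[OF ind] by auto
  note [measurable] = f
  have eq: "distr M N W \<Otimes>\<^sub>M distr M L Z = distr M (N \<Otimes>\<^sub>M L) (\<lambda>x. (W x, Z x))"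
    using ind by (simp add: indep_var_distribution_eq)
  interpret W: prob_space "distr M N W" by (rule prob_space_distr) simp
  interpret Z: prob_space "distr M L Z" by (rule prob_space_distr) simp
  interpret P: pair_prob_space "distr M N W" "distr M L Z" ..
  have "integrable (distr M N W \<Otimes>\<^sub>M distr M L Z) f"
    unfolding eq by (subst integrable_distr_eq) (use int in auto)
  from P.integral_fst'[OF this]
  have "(\<integral>\<omega>. f (W \<omega>, Z \<omega>) \<partial>M) = (\<integral>w. (\<integral>z. f (w, z) \<partial>distr M L Z) \<partial>distr M N W)"
    by (simp add: eq integral_distr)
  also have "\<dots> = (\<integral>\<omega>. (\<integral>z. f (W \<omega>, z) \<partial>distr M L Z) \<partial>M)"
    by (rule integral_distr) (auto intro!: borel_measurable_lebesgue_integral)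
  also have "\<dots> = (\<integral>\<omega>. (\<integral>\<omega>'. f (W \<omega>, Z \<omega>') \<partial>M) \<partial>M)"
  proof (rule Bochner_Integration.integral_cong[OF refl])
    fix \<omega> assume "\<omega> \<in> space M"
    then have "W \<omega> \<in> space N" by (rule measurable_space[OF \<open>W \<in> measurable M N\<close>])
    then have "(\<lambda>z. f (W \<omega>, z)) \<in> borel_measurable L" by measurable
    then show "(\<integral>z. f (W \<omega>, z) \<partial>distr M L Z) = (\<integral>\<omega>'. f (W \<omega>, Z \<omega>') \<partial>M)"
      by (intro integral_distr) auto
  qed
  finally show ?thesis .
qed

locale brownian_motion =
  fixes M :: "'a measure" and B :: "real \<Rightarrow> 'a \<Rightarrow> real"
  assumes bm: "standard_brownian_motion M B"
begin

sublocale prob_space M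
  using bm by (simp add: standard_brownian_motion_def)

lemma B_measurable: "0 \<le> s \<Longrightarrow> B s \<in> borel_measurable M"
  using bm by (simp add: standard_brownian_motion_def)

lemma B_0: "\<omega> \<in> space M \<Longrightarrow> B 0 \<omega> = 0"
  using bm by (simp add: standard_brownian_motion_def)

lemma B_continuous: "\<omega> \<in> space M \<Longrightarrow> continuous_on {0..} (\<lambda>s. B s \<omega>)"
  using bm by (simp add: standard_brownian_motion_def)

lemma B_increment:
  "0 \<le> s \<Longrightarrow> s < t \<Longrightarrow>
     distributed M lborel (\<lambda>\<omega>. B t \<omega> - B s \<omega>) (normal_density 0 (sqrt (t - s)))"
  using bm by (simp add: standard_brownian_motion_def)

lemma B_indep:
  "0 \<le> \<tau> 0 \<Longrightarrow> (\<And>i. i < n \<Longrightarrow> \<tau> i \<le> \<tau> (Suc i)) \<Longrightarrow>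
     indep_vars (\<lambda>_. borel) (\<lambda>i \<omega>. B (\<tau> (Suc i)) \<omega> - B (\<tau> i) \<omega>) {..<n}"
  using bm by (simp add: standard_brownian_motion_def)

text \<open>Partial sums of independent increments form the past, and the next increment is the
  future. That increment is wrapped into a function on \<open>{Suc k}\<close> because
  \<open>indep_var\<close> takes two variables of one type.\<close>

lemma past_indep_increment:
  assumes "0 \<le> \<tau> 0" "\<And>i. i < k \<Longrightarrow> \<tau> i \<le> \<tau> (Suc i)" "\<tau> k \<le> u"
  shows "indep_var (PiM {..k} (\<lambda>_. borel)) (\<lambda>\<omega>. \<lambda>i\<in>{..k}. B (\<tau> i) \<omega> - B 0 \<omega>)
           (PiM {Suc k} (\<lambda>_. borel)) (\<lambda>\<omega>. \<lambda>i\<in>{Suc k}. B u \<omega> - B (\<tau> k) \<omega>)"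
proof -
  \<comment> \<open>\<open>\<sigma>\<close> lists the times 0, \<open>\<tau> 0\<close>, ...,
    \<open>\<tau> k\<close>, \<open>u\<close>. With 0 in front, partial sums of increments are the
    values \<open>B (\<tau> i) - B 0\<close>, and increment \<open>Suc k\<close> runs from
    \<open>\<tau> k\<close> to \<open>u\<close>.\<close>
  define \<sigma> where "\<sigma> i = (if i = 0 then 0 else if i \<le> Suc k then \<tau> (i - 1) else u)" for i
  define D where "D i \<omega> = B (\<sigma> (Suc i)) \<omega> - B (\<sigma> i) \<omega>" for i \<omega>
  have "\<sigma> i \<le> \<sigma> (Suc i)" if "i < Suc (Suc k)" for i
    using assms that by (cases i) (auto simp: \<sigma>_def less_Suc_eq)
  then have "indep_vars (\<lambda>_. borel) D {..<Suc (Suc k)}"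
    unfolding D_def[abs_def] by (intro B_indep) (auto simp: \<sigma>_def)
  then have "indep_var (PiM {..k} (\<lambda>_. borel)) (\<lambda>\<omega>. \<lambda>i\<in>{..k}. D i \<omega>)
      (PiM {Suc k} (\<lambda>_. borel)) (\<lambda>\<omega>. \<lambda>i\<in>{Suc k}. D i \<omega>)"
    by (rule indep_var_restrict) auto
  moreover have "(\<lambda>f. \<lambda>i\<in>{..k}. \<Sum>j<Suc i. f j) \<in>
      measurable (PiM {..k} (\<lambda>_. borel :: real measure)) (PiM {..k} (\<lambda>_. borel))"
  proof (rule measurable_restrict)
    fix i assume "i \<in> {..k}"
    then show "(\<lambda>f. \<Sum>j<Suc i. f j) \<in> borel_measurable (PiM {..k} (\<lambda>_. borel :: real measure))"
      by (intro borel_measurable_sum measurable_component_singleton) auto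
  qed
  moreover have "(\<lambda>f. f) \<in> measurable (PiM {Suc k} (\<lambda>_. borel :: real measure)) (PiM {Suc k} (\<lambda>_. borel))"
    by simp
  ultimately have "indep_var (PiM {..k} (\<lambda>_. borel))
      ((\<lambda>f. \<lambda>i\<in>{..k}. \<Sum>j<Suc i. f j) \<circ> (\<lambda>\<omega>. \<lambda>i\<in>{..k}. D i \<omega>))
      (PiM {Suc k} (\<lambda>_. borel)) ((\<lambda>f. f) \<circ> (\<lambda>\<omega>. \<lambda>i\<in>{Suc k}. D i \<omega>))"
    by (rule indep_var_compose)
  moreover have "(\<lambda>f. \<lambda>i\<in>{..k}. \<Sum>j<Suc i. f j) \<circ> (\<lambda>\<omega>. \<lambda>i\<in>{..k}. D i \<omega>) =
      (\<lambda>\<omega>. \<lambda>i\<in>{..k}. B (\<tau> i) \<omega> - B 0 \<omega>)"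
  proof (rule ext, simp only: o_def, rule restrict_ext)
    fix \<omega> i assume i: "i \<in> {..k}"
    then have "(\<Sum>j<Suc i. (\<lambda>i\<in>{..k}. D i \<omega>) j) = (\<Sum>j<Suc i. D j \<omega>)"
      by (intro sum.cong) auto
    also have "\<dots> = B (\<sigma> (Suc i)) \<omega> - B (\<sigma> 0) \<omega>"
      unfolding D_def by (rule sum_lessThan_telescope)
    finally show "(\<Sum>j<Suc i. (\<lambda>i\<in>{..k}. D i \<omega>) j) = B (\<tau> i) \<omega> - B 0 \<omega>"
      using i by (simp add: \<sigma>_def)
  qed
  moreover have "(\<lambda>f. f) \<circ> (\<lambda>\<omega>. \<lambda>i\<in>{Suc k}. D i \<omega>) = (\<lambda>\<omega>. \<lambda>i\<in>{Suc k}. B u \<omega> - B (\<tau> k) \<omega>)"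
    by (auto simp: D_def \<sigma>_def restrict_def fun_eq_iff)
  ultimately show ?thesis by simp
qed

text \<open>The start \<open>c\<close> is a parameter because strict and nonstrict survival are
  compared by moving it slightly.\<close>

definition X :: "real \<Rightarrow> real \<Rightarrow> real \<Rightarrow> 'a \<Rightarrow> real" where
  "X c \<mu> s \<omega> = c + B s \<omega> + \<mu> * s"

lemma X_measurable: "0 \<le> s \<Longrightarrow> X c \<mu> s \<in> borel_measurable M"
  using B_measurable unfolding X_def[abs_def] by simp

lemma X_continuous: "\<omega> \<in> space M \<Longrightarrow> continuous_on {0..} (\<lambda>s. X c \<mu> s \<omega>)"
  using B_continuous unfolding X_def by (intro continuous_intros)

lemma X_distributed:
  assumes "0 < s"
  shows "distributed M lborel (X c \<mu> s) (normal_density (c + \<mu> * s) (sqrt s))"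
proof -
  have "distributed M lborel (\<lambda>\<omega>. B s \<omega> - B 0 \<omega>) (normal_density 0 (sqrt s))"
    using B_increment[of 0 s] assms by simp
  then have "distributed M lborel (\<lambda>\<omega>. (c + \<mu> * s) + 1 * (B s \<omega> - B 0 \<omega>))
      (normal_density (c + \<mu> * s + 1 * 0) (\<bar>1\<bar> * sqrt s))"
    by (rule normal_density_affine) (use assms in auto)
  then show ?thesis
    unfolding distributed_def using X_measurable[of s c \<mu>] assms
    by (auto simp: X_def B_0 add_ac cong: distr_cong)
qed

end

text \<open>The transition semigroup of Brownian motion with drift \<open>\<mu>\<close>, applied to
  \<open>g\<close>. At \<open>s = 0\<close> the degenerate density is 0 and not a point mass, so the
  value there is 0 instead of \<open>g x\<close>; \<open>gauss_op0\<close> repairs this.\<close>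

definition gauss_op :: "(real \<Rightarrow> real) \<Rightarrow> real \<Rightarrow> real \<Rightarrow> real \<Rightarrow> real" where
  "gauss_op g \<mu> s x = (\<integral>y. normal_density (x + \<mu> * s) (sqrt s) y * g y \<partial>lborel)"

lemma gauss_op_measurable [measurable]:
  assumes [measurable]: "g \<in> borel_measurable borel"
  shows "gauss_op g \<mu> s \<in> borel_measurable borel"
proof -
  have "(\<lambda>x. \<integral>y. normal_density (x + \<mu> * s) (sqrt s) y * g y \<partial>lborel) \<in> borel_measurable borel"
    unfolding normal_density_def by measurable
  then show ?thesis by (simp add: gauss_op_def[abs_def])
qed

context brownian_motion
begin

text \<open>Once the path up to \<open>\<tau> k\<close> is frozen, the remaining increment is an
  independent Gaussian variable, and averaging over it gives \<open>gauss_op\<close>. The event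
  \<open>A\<close> sees the path at finitely many times only, which is all that a grid
  requires.\<close>

lemma markov_property:
  fixes \<tau> :: "nat \<Rightarrow> real"
  assumes \<tau>: "0 \<le> \<tau> 0" "\<And>i. i < k \<Longrightarrow> \<tau> i \<le> \<tau> (Suc i)" "\<tau> k < u"
    and [measurable]: "g \<in> borel_measurable borel"
    and int: "integrable M (\<lambda>\<omega>. g (X c \<mu> u \<omega>))"
    and A: "A \<in> sets (PiM {..k} (\<lambda>_. borel))"
  shows "(\<integral>\<omega>. indicator A (\<lambda>i\<in>{..k}. X c \<mu> (\<tau> i) \<omega>) * g (X c \<mu> u \<omega>) \<partial>M) =
    (\<integral>\<omega>. indicator A (\<lambda>i\<in>{..k}. X c \<mu> (\<tau> i) \<omega>) * gauss_op g \<mu> (u - \<tau> k) (X c \<mu> (\<tau> k) \<omega>) \<partial>M)"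
proof -
  let ?N = "PiM {..k} (\<lambda>_. borel :: real measure)"
  define h where "h w = (\<lambda>i\<in>{..k}. c + w i + \<mu> * \<tau> i)" for w :: "nat \<Rightarrow> real"
  define W where "W \<omega> = (\<lambda>i\<in>{..k}. B (\<tau> i) \<omega> - B 0 \<omega>)" for \<omega>
  let ?L = "PiM {Suc k} (\<lambda>_. borel :: real measure)"
  define Z where "Z \<omega> = (\<lambda>i\<in>{Suc k}. B u \<omega> - B (\<tau> k) \<omega>)" for \<omega>
  have pos: "0 \<le> \<tau> i" if "i \<le> k" for i
    using that by (induction i) (use \<tau> in \<open>auto intro: order_trans\<close>)
  have [measurable]: "h \<in> measurable ?N ?N"
    unfolding h_def[abs_def]
    by (rule measurable_restrict) (intro borel_measurable_add measurable_component_singleton borel_measurable_const; simp)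
  have [measurable]: "(\<lambda>w. w k) \<in> borel_measurable ?N"
    by (rule measurable_component_singleton) simp
  have [measurable]: "(\<lambda>z. z (Suc k)) \<in> borel_measurable ?L"
    by (rule measurable_component_singleton) simp
  note [measurable] = A
  define f where "f = (\<lambda>(w, z). indicator A (h w) * g (c + w k + z (Suc k) + \<mu> * u) :: real)"
  have f: "f \<in> borel_measurable (?N \<Otimes>\<^sub>M ?L)"
    unfolding f_def by measurable
  have ind: "indep_var ?N W ?L Z"
    unfolding W_def[abs_def] Z_def[abs_def] by (rule past_indep_increment) (use \<tau> in auto)
  have [measurable]: "W \<in> measurable M ?N" "Z \<in> measurable M ?L"
    using indep_var_rv1[OF ind] indep_var_rv2[OF ind] by auto
  have hW: "h (W \<omega>) = (\<lambda>i\<in>{..k}. X c \<mu> (\<tau> i) \<omega>)" if "\<omega> \<in> space M" for \<omega>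
    using B_0[OF that] by (auto simp: h_def W_def X_def restrict_def)
  have fWZ: "f (W \<omega>, Z \<omega>) = indicator A (\<lambda>i\<in>{..k}. X c \<mu> (\<tau> i) \<omega>) * g (X c \<mu> u \<omega>)" if "\<omega> \<in> space M" for \<omega>
    using B_0[OF that] by (simp add: f_def hW[OF that]) (simp add: W_def Z_def X_def)
  have fW: "(\<integral>\<omega>'. f (W \<omega>, Z \<omega>') \<partial>M) =
      indicator A (\<lambda>i\<in>{..k}. X c \<mu> (\<tau> i) \<omega>) * gauss_op g \<mu> (u - \<tau> k) (X c \<mu> (\<tau> k) \<omega>)"
    if \<omega>: "\<omega> \<in> space M" for \<omega>
  proof -
    let ?x = "X c \<mu> (\<tau> k) \<omega>"
    have "(\<integral>\<omega>'. f (W \<omega>, Z \<omega>') \<partial>M) = indicator A (\<lambda>i\<in>{..k}. X c \<mu> (\<tau> i) \<omega>) *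
        (\<integral>\<omega>'. g (?x + \<mu> * (u - \<tau> k) + (B u \<omega>' - B (\<tau> k) \<omega>')) \<partial>M)"
    proof -
      have "c + W \<omega> k + Z \<omega>' (Suc k) + \<mu> * u = ?x + \<mu> * (u - \<tau> k) + (B u \<omega>' - B (\<tau> k) \<omega>')" for \<omega>'
        using B_0[OF \<omega>] by (simp add: W_def Z_def X_def algebra_simps)
      then show ?thesis
        unfolding f_def by (simp add: hW[OF \<omega>])
    qed
    also have "(\<integral>\<omega>'. g (?x + \<mu> * (u - \<tau> k) + (B u \<omega>' - B (\<tau> k) \<omega>')) \<partial>M) =
        (\<integral>z. normal_density 0 (sqrt (u - \<tau> k)) z * g (?x + \<mu> * (u - \<tau> k) + z) \<partial>lborel)"
      by (rule distributed_integral[OF B_increment, symmetric]) (use pos[of k] \<tau>(3) in auto)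
    also have "(\<integral>z. normal_density 0 (sqrt (u - \<tau> k)) z * g (?x + \<mu> * (u - \<tau> k) + z) \<partial>lborel) =
        gauss_op g \<mu> (u - \<tau> k) ?x"
      unfolding gauss_op_def
      by (subst lborel_integral_real_affine[where c = 1 and t = "?x + \<mu> * (u - \<tau> k)"])
         (auto simp: normal_density_def)
    finally show ?thesis .
  qed
  have "integrable M (\<lambda>\<omega>. f (W \<omega>, Z \<omega>))"
  proof (rule Bochner_Integration.integrable_bound[OF int])
    show "(\<lambda>\<omega>. f (W \<omega>, Z \<omega>)) \<in> borel_measurable M"
      using f by measurable
    show "AE \<omega> in M. norm (f (W \<omega>, Z \<omega>)) \<le> norm (g (X c \<mu> u \<omega>))"
      by (rule AE_I2) (auto simp: fWZ split: split_indicator)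
  qed
  from indep_var_lebesgue_integral[OF ind f this]
  show ?thesis by (simp add: fWZ fW cong: Bochner_Integration.integral_cong)
qed

end

subsection \<open>Stopping on a grid\<close>

definition grid :: "real \<Rightarrow> real \<Rightarrow> nat \<Rightarrow> nat \<Rightarrow> real" where
  "grid a t n k = a + (t - a) * (real k / real (Suc n))"

lemma grid_0 [simp]: "grid a t n 0 = a"
  by (simp add: grid_def)

lemma grid_Suc [simp]: "grid a t n (Suc n) = t"
  by (simp add: grid_def)

lemma grid_mono:
  assumes "a < t"
  shows "k \<le> l \<Longrightarrow> grid a t n k \<le> grid a t n l" "k < l \<Longrightarrow> grid a t n k < grid a t n l"
  using assms by (auto simp: grid_def divide_simps)

lemma grid_bounds:
  assumes "a < t" "k \<le> Suc n"
  shows "grid a t n k \<in> {a..t}"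
  using grid_mono(1)[OF assms(1), of 0 k n] grid_mono(1)[OF assms(1), of k "Suc n" n] assms(2) by auto

lemma grid_approx:
  assumes "a < t" "s \<in> {a..t}" "0 < d"
  shows "\<forall>\<^sub>F n in sequentially. \<exists>k\<le>Suc n. \<bar>grid a t n k - s\<bar> < d"
proof -
  have "(\<lambda>n. (t - a) * inverse (real (Suc n))) \<longlonglongrightarrow> (t - a) * 0"
    by (intro tendsto_mult tendsto_const LIMSEQ_inverse_real_of_nat)
  then have "\<forall>\<^sub>F n in sequentially. (t - a) * inverse (real (Suc n)) < d"
    by (rule order_tendstoD) (use \<open>0 < d\<close> in simp)
  then show ?thesis
  proof eventually_elim
    case (elim n)
    define r where "r = (s - a) / (t - a) * real (Suc n)"
    have r: "0 \<le> r" "r \<le> real (Suc n)" "s = a + (t - a) * (r / real (Suc n))"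
      using assms by (auto simp: r_def divide_simps)
    define k where "k = nat \<lfloor>r\<rfloor>"
    have k: "real k \<le> r" "r < real k + 1" using r by (auto simp: k_def)
    then have "k \<le> Suc n" using r by linarith
    moreover have "\<bar>grid a t n k - s\<bar> = (t - a) * ((r - real k) / real (Suc n))"
    proof -
      have "grid a t n k - s = - ((t - a) * ((r - real k) / real (Suc n)))"
        by (simp add: grid_def r(3) diff_divide_distrib right_diff_distrib del: of_nat_Suc)
      then show ?thesis using k assms by simp
    qed
    moreover have "(t - a) * ((r - real k) / real (Suc n)) \<le> (t - a) * (1 / real (Suc n))"
      using k assms by (intro mult_left_mono divide_right_mono) auto
    ultimately show ?case using elim by (intro exI[of _ k]) (auto simp: divide_inverse)
  qed
qed

definition hits :: "(nat \<Rightarrow> real) \<Rightarrow> nat \<Rightarrow> bool" where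
  "hits f k \<longleftrightarrow> (\<forall>j<k. 0 \<le> f j) \<and> f k < 0"

text \<open>At most one index can be the first negative one, so the sum has at most one nonzero
  term; index 0 is excluded by the assumption.\<close>

lemma sum_hits:
  fixes F :: "nat \<Rightarrow> real"
  assumes "0 < f 0"
  shows "(\<Sum>k=1..N. if hits f k then F k else 0) =
    (if \<exists>k\<le>N. f k < 0 then F (LEAST k. f k < 0) else 0)"
proof (cases "\<exists>k\<le>N. f k < 0")
  case True
  then obtain k where k: "k \<le> N" "f k < 0" by auto
  define m where "m = (LEAST k. f k < 0)"
  have m: "f m < 0" "m \<le> k"
    unfolding m_def by (rule LeastI Least_le, rule k(2))+
  have m': "0 \<le> f j" if "j < m" for j
    using not_less_Least[OF that[unfolded m_def]] by (simp only: not_less)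
  have "hits f j \<longleftrightarrow> j = m" for j
    using m(1) m' by (cases j m rule: linorder_cases) (auto simp: hits_def not_less[symmetric])
  moreover have "m \<noteq> 0"
  proof
    assume "m = 0"
    then show False using assms m(1) by simp
  qed
  ultimately show ?thesis using True m(2) k(1) unfolding m_def[symmetric] by simp
next
  case False
  then show ?thesis by (auto simp: hits_def intro!: sum.neutral)
qed

lemma nonneg_grid_limit:
  fixes f :: "real \<Rightarrow> real"
  assumes at: "a < t" and cont: "continuous_on {a..t} f" and s: "s \<in> {a..t}" "f s < 0" and "0 < d"
  shows "\<forall>\<^sub>F n in sequentially. \<exists>k\<le>Suc n. f (grid a t n k) < 0 \<and> \<bar>grid a t n k - s\<bar> < d"
proof -
  obtain e where e: "e > 0" "\<And>x. x \<in> {a..t} \<Longrightarrow> dist x s < e \<Longrightarrow> dist (f x) (f s) < - f s"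
    using cont[unfolded continuous_on_iff, rule_format, of s "- f s"] s by auto
  have "\<forall>\<^sub>F n in sequentially. \<exists>k\<le>Suc n. \<bar>grid a t n k - s\<bar> < min d e"
    by (rule grid_approx) (use at s \<open>0 < d\<close> e in auto)
  then show ?thesis
  proof eventually_elim
    case (elim n)
    then obtain k where k: "k \<le> Suc n" "\<bar>grid a t n k - s\<bar> < min d e" by auto
    have "dist (f (grid a t n k)) (f s) < - f s"
      by (rule e(2)) (use k grid_bounds[OF at k(1)] in \<open>auto simp: dist_real_def\<close>)
    then show ?case using k by (intro exI[of _ k]) (auto simp: dist_real_def)
  qed
qed

text \<open>The first grid point at which the path is negative tends to the infimum \<open>\<sigma>\<close> of the times
  at which it is negative, where the path vanishes.\<close>

lemma stopped_sum_tendsto_0: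
  fixes f :: "real \<Rightarrow> real" and V :: "real \<Rightarrow> real \<Rightarrow> real"
  assumes at: "a < t" and cont: "continuous_on {a..t} f" and fa: "0 < f a" and ft: "f t \<noteq> 0"
    and V: "\<And>s r y. s \<longlonglongrightarrow> r \<Longrightarrow> 0 < r \<Longrightarrow> y \<longlonglongrightarrow> 0 \<Longrightarrow> (\<lambda>n. V (s n) (y n)) \<longlonglongrightarrow> 0"
  shows "(\<lambda>n. \<Sum>k=1..Suc n. if hits (\<lambda>k. f (grid a t n k)) k
            then V (t - grid a t n k) (f (grid a t n k)) else 0) \<longlonglongrightarrow> 0"
proof (cases "\<exists>s\<in>{a..t}. f s < 0")
  case False
  then have "\<not> hits (\<lambda>k. f (grid a t n k)) k" if "k \<in> {1..Suc n}" for n k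
    using grid_bounds[OF at, of k n] that by (auto simp: hits_def)
  then show ?thesis by simp
next
  case True
  define S where "S = {s\<in>{a..t}. f s < 0}"
  define \<sigma> where "\<sigma> = Inf S"
  have ne: "S \<noteq> {}" and bdd: "bdd_below S" using True by (auto simp: S_def intro: bdd_belowI[of _ a])
  have \<sigma>_le: "\<sigma> \<le> s" if "s \<in> S" for s unfolding \<sigma>_def by (rule cInf_lower[OF that bdd])
  have a\<sigma>: "a \<le> \<sigma>" unfolding \<sigma>_def by (rule cInf_greatest[OF ne]) (auto simp: S_def)
  have \<sigma>t: "\<sigma> \<le> t" using ne \<sigma>_le by (force simp: S_def)
  have near: "\<exists>s\<in>S. s < \<sigma> + d" if "0 < d" for d
    using cInf_lessD[OF ne, of "\<sigma> + d"] that by (auto simp: \<sigma>_def)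
  \<comment> \<open>A negative value at \<open>\<sigma>\<close> would persist to the left of
    \<open>\<sigma>\<close>, and a positive one would keep negative times away from
    \<open>\<sigma>\<close>.\<close>
  have f\<sigma>: "f \<sigma> = 0"
  proof (rule ccontr)
    assume "f \<sigma> \<noteq> 0"
    then obtain d where d: "d > 0" "\<And>x. x \<in> {a..t} \<Longrightarrow> dist x \<sigma> < d \<Longrightarrow> dist (f x) (f \<sigma>) < \<bar>f \<sigma>\<bar>"
      using cont[unfolded continuous_on_iff, rule_format, of \<sigma> "\<bar>f \<sigma>\<bar>"] a\<sigma> \<sigma>t by auto
    show False
    proof (cases "f \<sigma> < 0")
      case True
      then have "a < \<sigma>" using fa a\<sigma> by (cases "a = \<sigma>") auto
      define x where "x = max a (\<sigma> - d / 2)"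
      have x: "x \<in> {a..t}" "x < \<sigma>" "dist x \<sigma> < d"
        using \<open>a < \<sigma>\<close> \<sigma>t d(1) by (auto simp: x_def dist_real_def)
      then have "x \<in> S" using d(2)[of x] True by (auto simp: S_def dist_real_def)
      then show False using \<sigma>_le[of x] x by auto
    next
      case False
      obtain s where "s \<in> S" "s < \<sigma> + d" using near d(1) by blast
      then show False using d(2)[of s] \<sigma>_le[of s] False by (auto simp: S_def dist_real_def)
    qed
  qed
  \<comment> \<open>Here \<open>f t \<noteq> 0\<close> enters: the time left after stopping has a
    positive limit, as \<open>V\<close> requires.\<close>
  have \<sigma>_less: "\<sigma> < t" using f\<sigma> ft \<sigma>t by (cases "\<sigma> = t") auto
  define K where "K n = (LEAST k. f (grid a t n k) < 0)" for n
  define z where "z n = grid a t n (K n)" for n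
  \<comment> \<open>The first negative grid point is not below \<open>\<sigma>\<close>, being in
    \<open>S\<close>, and not above any other negative grid point, one of which lies close to
    \<open>\<sigma>\<close>.\<close>
  have z: "\<forall>\<^sub>F n in sequentially. (\<exists>k\<le>Suc n. f (grid a t n k) < 0) \<and> z n \<in> S \<and> \<bar>z n - \<sigma>\<bar> < d"
    if "0 < d" for d
  proof -
    obtain s where s: "s \<in> S" "s < \<sigma> + d / 2" using near[of "d / 2"] \<open>0 < d\<close> by auto
    have "\<forall>\<^sub>F n in sequentially. \<exists>k\<le>Suc n. f (grid a t n k) < 0 \<and> \<bar>grid a t n k - s\<bar> < d / 2"
      by (rule nonneg_grid_limit[OF at cont]) (use s \<open>0 < d\<close> in \<open>auto simp: S_def\<close>)
    then show ?thesis
    proof eventually_elim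
      case (elim n)
      then obtain k where k: "k \<le> Suc n" "f (grid a t n k) < 0" "\<bar>grid a t n k - s\<bar> < d / 2" by auto
      have K: "f (z n) < 0" "K n \<le> k"
        unfolding z_def K_def by (rule LeastI[of "\<lambda>k. f (grid a t n k) < 0"] Least_le, rule k(2))+
      then have "z n \<in> S" using grid_bounds[OF at, of "K n" n] k by (auto simp: S_def z_def)
      moreover have "z n \<le> grid a t n k" unfolding z_def by (rule grid_mono(1)[OF at K(2)])
      ultimately have "\<bar>z n - \<sigma>\<bar> < d" using k(3) s(2) \<sigma>_le[of "z n"] by linarith
      then show ?case using k(1,2) \<open>z n \<in> S\<close> by blast
    qed
  qed
  have z_lim: "z \<longlonglongrightarrow> \<sigma>"
  proof (rule tendstoI)
    fix d :: real assume "0 < d"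
    show "\<forall>\<^sub>F n in sequentially. dist (z n) \<sigma> < d"
      using z[OF \<open>0 < d\<close>] by eventually_elim (auto simp: dist_real_def)
  qed
  have "(\<lambda>n. f (z n)) \<longlonglongrightarrow> f \<sigma>"
    by (rule continuous_on_tendsto_compose[OF cont z_lim])
       (use a\<sigma> \<sigma>t z[of 1] in \<open>auto simp: S_def elim!: eventually_mono\<close>)
  then have fz: "(\<lambda>n. f (z n)) \<longlonglongrightarrow> 0" using f\<sigma> by simp
  have "(\<lambda>n. V (t - z n) (f (z n))) \<longlonglongrightarrow> 0"
    by (rule V[OF tendsto_diff[OF tendsto_const z_lim] _ fz]) (use \<sigma>_less in simp)
  moreover have "\<forall>\<^sub>F n in sequentially. V (t - z n) (f (z n)) =
      (\<Sum>k=1..Suc n. if hits (\<lambda>k. f (grid a t n k)) k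
            then V (t - grid a t n k) (f (grid a t n k)) else 0)"
    using z[of 1, OF zero_less_one]
  proof eventually_elim
    case (elim n)
    show ?case by (subst sum_hits) (use elim fa in \<open>auto simp: z_def K_def\<close>)
  qed
  ultimately show ?thesis by (rule Lim_transform_eventually)
qed

section \<open>The heat semigroup and the stopping identity\<close>

definition gauss_op0 :: "(real \<Rightarrow> real) \<Rightarrow> real \<Rightarrow> real \<Rightarrow> real \<Rightarrow> real" where
  "gauss_op0 g \<mu> s x = (if s = 0 then g x else gauss_op g \<mu> s x)"

lemma gauss_op0_measurable [measurable]:
  "g \<in> borel_measurable borel \<Longrightarrow> gauss_op0 g \<mu> s \<in> borel_measurable borel"
  by (cases "s = 0") (auto simp: gauss_op0_def[abs_def])

lemma gauss_op_bounded:
  assumes "0 < s" "\<And>y. \<bar>g y\<bar> \<le> C" and [measurable]: "g \<in> borel_measurable borel"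
  shows "\<bar>gauss_op g \<mu> s x\<bar> \<le> C"
proof -
  have int: "integrable lborel (\<lambda>y. normal_density (x + \<mu> * s) (sqrt s) y * C)"
    using assms by (intro integrable_mult_left integrable_normal_density) auto
  have "norm (gauss_op g \<mu> s x) \<le> (\<integral>y. norm (normal_density (x + \<mu> * s) (sqrt s) y * g y) \<partial>lborel)"
    unfolding gauss_op_def by (rule integral_norm_bound)
  also have "\<dots> \<le> (\<integral>y. normal_density (x + \<mu> * s) (sqrt s) y * C \<partial>lborel)"
  proof (rule integral_mono[OF _ int])
    show *: "norm (normal_density (x + \<mu> * s) (sqrt s) y * g y) \<le> normal_density (x + \<mu> * s) (sqrt s) y * C" for y
      by (auto simp: abs_mult intro!: mult_left_mono assms)
    show "integrable lborel (\<lambda>y. norm (normal_density (x + \<mu> * s) (sqrt s) y * g y))"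
      by (rule Bochner_Integration.integrable_bound[OF int]) (auto intro!: AE_I2 order_trans[OF *[simplified] abs_ge_self])
  qed
  also have "\<dots> = C" using assms(1) by (simp add: integral_normal_density)
  finally show ?thesis by simp
qed

text \<open>Dominated convergence, with the bounded support of \<open>g\<close> providing the
  integrable bound: once \<open>s n\<close> exceeds \<open>r / 2\<close>, the densities are at most
  \<open>1 / sqrt (pi * r)\<close>.\<close>

lemma gauss_op_tendsto:
  fixes s y :: "nat \<Rightarrow> real"
  assumes "s \<longlonglongrightarrow> r" "0 < r" "y \<longlonglongrightarrow> x" and bound: "\<And>y. \<bar>g y\<bar> \<le> C"
    and supp: "\<And>y. K < \<bar>y\<bar> \<Longrightarrow> g y = 0" and [measurable]: "g \<in> borel_measurable borel"
  shows "(\<lambda>n. gauss_op g \<mu> (s n) (y n)) \<longlonglongrightarrow> gauss_op g \<mu> r x"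
proof -
  obtain N where N: "\<And>n. n \<ge> N \<Longrightarrow> r / 2 < s n"
    using order_tendstoD(1)[OF assms(1), of "r / 2"] \<open>0 < r\<close> by (auto simp: eventually_sequentially)
  have "(\<lambda>n. gauss_op g \<mu> (s (n + N)) (y (n + N))) \<longlonglongrightarrow> gauss_op g \<mu> r x"
    unfolding gauss_op_def
  proof (rule integral_dominated_convergence[where w = "\<lambda>y. C / sqrt (pi * r) * indicator {-K..K} y"])
    show "integrable lborel (\<lambda>y. C / sqrt (pi * r) * indicator {-K..K} y)"
      by (intro integrable_mult_right integrable_real_indicator) (auto simp: emeasure_lborel_Icc_eq)
    show "AE z in lborel. (\<lambda>n. normal_density (y (n + N) + \<mu> * s (n + N)) (sqrt (s (n + N))) z * g z)
        \<longlonglongrightarrow> normal_density (x + \<mu> * r) (sqrt r) z * g z"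
      unfolding normal_density_def
      by (intro AE_I2 tendsto_intros LIMSEQ_ignore_initial_segment assms) (use \<open>0 < r\<close> in auto)
    fix n
    have sn: "r / 2 < s (n + N)" "0 < s (n + N)" using N[of "n + N"] \<open>0 < r\<close> by auto
    have d: "normal_density m (sqrt (s (n + N))) z \<le> 1 / sqrt (pi * r)" for m z
    proof -
      have "normal_density m (sqrt (s (n + N))) z \<le> 1 / sqrt (2 * pi * s (n + N)) * 1"
        unfolding normal_density_def using sn by (intro mult_mono) auto
      also have "\<dots> \<le> 1 / sqrt (pi * r)"
        using sn \<open>0 < r\<close> by (auto intro!: divide_left_mono real_sqrt_le_mono simp: field_simps)
      finally show ?thesis .
    qed
    show "AE z in lborel. norm (normal_density (y (n + N) + \<mu> * s (n + N)) (sqrt (s (n + N))) z * g z)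
        \<le> C / sqrt (pi * r) * indicator {-K..K} z"
    proof (rule AE_I2)
      fix z
      show "norm (normal_density (y (n + N) + \<mu> * s (n + N)) (sqrt (s (n + N))) z * g z)
        \<le> C / sqrt (pi * r) * indicator {-K..K} z"
      proof (cases "z \<in> {-K..K}")
        case True
        have "\<bar>normal_density (y (n + N) + \<mu> * s (n + N)) (sqrt (s (n + N))) z\<bar> * \<bar>g z\<bar> \<le> 1 / sqrt (pi * r) * C"
          by (rule mult_mono) (use bound d \<open>0 < r\<close> in auto)
        then show ?thesis using True by (simp add: abs_mult)
      next
        case False
        then have "g z = 0" by (intro supp) auto
        then show ?thesis using False by simp
      qed
    qed
  qed measurable
  then show ?thesis by (rule LIMSEQ_offset)
qed

text \<open>Completing the square: an exponential weight shifts the mean of a Gaussian, the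
  one-dimensional Cameron-Martin formula. With \<open>l = - 2 * \<mu>\<close> it reverses the
  drift.\<close>

lemma normal_density_mult_exp:
  assumes "0 < \<sigma>"
  shows "normal_density m \<sigma> y * exp (l * y) =
    exp (l * m + l\<^sup>2 * \<sigma>\<^sup>2 / 2) * normal_density (m + l * \<sigma>\<^sup>2) \<sigma> y"
proof -
  have "- (y - m)\<^sup>2 / (2 * v) + l * y = l * m + l\<^sup>2 * v / 2 + - (y - (m + l * v))\<^sup>2 / (2 * v)"
    if "0 < v" for v
    using that by (simp add: field_simps) (simp add: power2_eq_square algebra_simps)
  from this[of "\<sigma>\<^sup>2"]
  have "- (y - m)\<^sup>2 / (2 * \<sigma>\<^sup>2) + l * y =
      l * m + l\<^sup>2 * \<sigma>\<^sup>2 / 2 + - (y - (m + l * \<sigma>\<^sup>2))\<^sup>2 / (2 * \<sigma>\<^sup>2)"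
    using assms by simp
  then show ?thesis by (simp add: normal_density_def exp_add[symmetric])
qed

context brownian_motion
begin

lemma X_AE_nonzero:
  assumes "0 < s"
  shows "AE \<omega> in M. X c \<mu> s \<omega> \<noteq> 0"
proof -
  have "AE x in lborel. 0 < ennreal (normal_density (c + \<mu> * s) (sqrt s) x) \<longrightarrow> x \<noteq> 0"
    using AE_lborel_singleton[of "0 :: real"] by eventually_elim auto
  then show ?thesis
    using distributed_AE2[OF X_distributed[OF assms, of c \<mu>], of "\<lambda>x. x \<noteq> 0"] by auto
qed

text \<open>At the first negative grid point the Markov property replaces
  \<open>g (X c \<mu> t \<omega>)\<close> by the semigroup applied to \<open>g\<close>. As the grid
  gets finer the stopped position tends to 0, where the semigroup vanishes by \<open>odd\<close>, so
  only paths that are never negative on [a, t] contribute.\<close>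

lemma survival_bounded:
  fixes g :: "real \<Rightarrow> real"
  assumes at: "0 < a" "a < t" and [measurable]: "g \<in> borel_measurable borel"
    and bound: "\<And>y. \<bar>g y\<bar> \<le> C" and supp: "\<And>y. K < \<bar>y\<bar> \<Longrightarrow> g y = 0"
    and odd: "\<And>s. 0 < s \<Longrightarrow> gauss_op g \<mu> s 0 = 0"
  shows "(\<integral>\<omega>. (if 0 < X c \<mu> a \<omega> then g (X c \<mu> t \<omega>) else 0) \<partial>M) =
    (\<integral>\<omega>. (if 0 < X c \<mu> a \<omega> \<and> (\<forall>s\<in>{a..t}. 0 \<le> X c \<mu> s \<omega>) then g (X c \<mu> t \<omega>) else 0) \<partial>M)"
proof -
  let ?X = "X c \<mu>"
  let ?p = "\<lambda>n \<omega> k. ?X (grid a t n k) \<omega>"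
  let ?V = "\<lambda>n k \<omega>. gauss_op0 g \<mu> (t - grid a t n k) (?p n \<omega> k)"
  have C: "0 \<le> C" using bound[of 0] by linarith
  have gr: "0 \<le> grid a t n k" for n k
    using grid_mono(1)[OF at(2), of 0 k n] at by simp
  have [measurable]: "?X a \<in> borel_measurable M" "?X t \<in> borel_measurable M"
    using at by (auto intro!: X_measurable)
  have [measurable]: "?X (grid a t n k) \<in> borel_measurable M" for n k
    by (intro X_measurable gr)
  have [measurable]: "Measurable.pred M (\<lambda>\<omega>. hits (?p n \<omega>) k)" for n k
    unfolding hits_def by measurable
  define P where "P n \<omega> \<longleftrightarrow> (\<forall>k\<le>Suc n. 0 \<le> ?p n \<omega> k)" for n \<omega>
  have [measurable]: "Measurable.pred M (P n)" for n
    unfolding P_def[abs_def] by measurable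
  \<comment> \<open>\<open>R\<close> is the contribution of the paths that are negative somewhere on
    the grid, after the Markov step.\<close>
  define R where "R n \<omega> = (if 0 < ?X a \<omega> then
      (\<Sum>k=1..Suc n. if hits (?p n \<omega>) k then ?V n k \<omega> else 0) else 0)" for n \<omega>
  have V_bound: "\<bar>gauss_op0 g \<mu> s x\<bar> \<le> C" if "0 \<le> s" for s x
    using that gauss_op_bounded[where g = g and s = s and \<mu> = \<mu> and x = x, OF _ bound] bound by (auto simp: gauss_op0_def)
  have int_g: "integrable M (\<lambda>\<omega>. g (?X t \<omega>))"
    by (rule integrable_const_bound[of _ C]) (auto simp: bound)
  have step: "(\<integral>\<omega>. (if 0 < ?X a \<omega> \<and> hits (?p n \<omega>) k then g (?X t \<omega>) else 0) \<partial>M) =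
      (\<integral>\<omega>. (if 0 < ?X a \<omega> \<and> hits (?p n \<omega>) k then ?V n k \<omega> else 0) \<partial>M)"
    if k: "k \<in> {1..Suc n}" for n k
  proof (cases "k = Suc n")
    case True
    \<comment> \<open>At the last grid point no time is left, \<open>gauss_op0\<close> is
      \<open>g\<close> itself and both sides coincide.\<close>
    then show ?thesis by (simp add: gauss_op0_def cong: if_cong)
  next
    case False
    define A where "A = {w \<in> space (PiM {..k} (\<lambda>_. borel :: real measure)). 0 < w 0 \<and> hits w k}"
    have [measurable]: "(\<lambda>w. w j) \<in> borel_measurable (PiM {..k} (\<lambda>_. borel :: real measure))" if "j \<le> k" for j
      by (rule measurable_component_singleton) (use that in simp)
    have A: "A \<in> sets (PiM {..k} (\<lambda>_. borel :: real measure))"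
      unfolding A_def hits_def Ball_def[symmetric] lessThan_iff[symmetric]
      by (intro sets.sets_Collect_conj sets.sets_Collect_finite_All) (measurable; simp)+
    have ind: "(\<lambda>i\<in>{..k}. ?p n \<omega> i) \<in> A \<longleftrightarrow> 0 < ?X a \<omega> \<and> hits (?p n \<omega>) k" for \<omega>
      by (auto simp: A_def hits_def space_PiM)
    have ind': "indicator A (\<lambda>i\<in>{..k}. ?p n \<omega> i) * y =
        (if 0 < ?X a \<omega> \<and> hits (?p n \<omega>) k then y else 0)" for \<omega> and y :: real
      unfolding indicator_def ind by simp
    have "grid a t n k < grid a t n (Suc n)"
      by (rule grid_mono(2)[OF at(2)]) (use False k in auto)
    then have less: "grid a t n k < t" by simp
    have "(\<integral>\<omega>. indicator A (\<lambda>i\<in>{..k}. ?p n \<omega> i) * g (?X t \<omega>) \<partial>M) =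
      (\<integral>\<omega>. indicator A (\<lambda>i\<in>{..k}. ?p n \<omega> i) * gauss_op g \<mu> (t - grid a t n k) (?p n \<omega> k) \<partial>M)"
      by (rule markov_property[where \<tau> = "grid a t n" and k = k and g = g and A = A, OF _ _ less _ int_g A])
         (use at in \<open>auto intro!: grid_mono simp del: of_nat_Suc\<close>)
    also have "gauss_op g \<mu> (t - grid a t n k) = gauss_op0 g \<mu> (t - grid a t n k)"
      using less by (auto simp: gauss_op0_def)
    finally show ?thesis unfolding ind' .
  qed
  have int: "integrable M (\<lambda>\<omega>. (if 0 < ?X a \<omega> \<and> hits (?p n \<omega>) k then g (?X t \<omega>) else 0))" for n k
    by (rule integrable_const_bound[of _ C]) (auto simp: bound C)
  have intV: "integrable M (\<lambda>\<omega>. (if 0 < ?X a \<omega> \<and> hits (?p n \<omega>) k then ?V n k \<omega> else 0))"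
    if "k \<in> {1..Suc n}" for n k
    by (rule integrable_const_bound[of _ C])
       (use grid_bounds[OF at(2), of k n] that in \<open>auto simp: C intro!: V_bound\<close>)
  have R_eq: "R n \<omega> = (\<Sum>k=1..Suc n. if 0 < ?X a \<omega> \<and> hits (?p n \<omega>) k then ?V n k \<omega> else 0)" for n \<omega>
    by (simp add: R_def cong: if_cong)
  have [measurable]: "R n \<in> borel_measurable M" for n
    unfolding R_def[abs_def] by measurable
  \<comment> \<open>The number of summands grows with \<open>n\<close>, but at most one is nonzero,
    so \<open>C\<close> bounds \<open>R\<close> on every grid and dominated convergence
    applies.\<close>
  have R_bound: "\<bar>R n \<omega>\<bar> \<le> C" for n \<omega>
  proof (cases "0 < ?X a \<omega>")
    case True
    define m where "m = (LEAST k. ?p n \<omega> k < 0)"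
    have m: "m \<le> Suc n" if ex: "\<exists>k\<le>Suc n. ?p n \<omega> k < 0"
    proof -
      obtain k where k: "k \<le> Suc n" "?p n \<omega> k < 0" using ex by auto
      have "m \<le> k" unfolding m_def by (rule Least_le, rule k(2))
      then show ?thesis using k(1) by simp
    qed
    have R: "R n \<omega> = (if \<exists>k\<le>Suc n. ?p n \<omega> k < 0 then ?V n m \<omega> else 0)"
      unfolding R_def m_def using True by (simp only: if_True) (rule sum_hits, simp)
    show ?thesis
    proof (cases "\<exists>k\<le>Suc n. ?p n \<omega> k < 0")
      case True
      then have "grid a t n m \<le> t" using grid_bounds[OF at(2) m] by auto
      then show ?thesis unfolding R using C V_bound by simp
    next
      case False
      then show ?thesis unfolding R using C by auto
    qed
  qed (simp add: R_def C)
  have decomp: "(\<integral>\<omega>. (if 0 < ?X a \<omega> then g (?X t \<omega>) else 0) \<partial>M) =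
      (\<integral>\<omega>. (if 0 < ?X a \<omega> \<and> P n \<omega> then g (?X t \<omega>) else 0) \<partial>M) + (\<integral>\<omega>. R n \<omega> \<partial>M)" for n
  proof -
    have P': "P n \<omega> \<longleftrightarrow> \<not> (\<exists>k\<le>Suc n. ?p n \<omega> k < 0)" for \<omega>
      unfolding P_def by (meson not_less)
    have "(if 0 < ?X a \<omega> then g (?X t \<omega>) else 0) = (if 0 < ?X a \<omega> \<and> P n \<omega> then g (?X t \<omega>) else 0) +
        (\<Sum>k=1..Suc n. if 0 < ?X a \<omega> \<and> hits (?p n \<omega>) k then g (?X t \<omega>) else 0)" for \<omega>
    proof (cases "0 < ?X a \<omega>")
      case True
      then show ?thesis using sum_hits[of "?p n \<omega>" "\<lambda>_. g (?X t \<omega>)" "Suc n"]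
        by (auto simp: P' simp del: sum.cl_ivl_Suc)
    qed simp
    then have "(\<integral>\<omega>. (if 0 < ?X a \<omega> then g (?X t \<omega>) else 0) \<partial>M) =
        (\<integral>\<omega>. ((if 0 < ?X a \<omega> \<and> P n \<omega> then g (?X t \<omega>) else 0) +
        (\<Sum>k=1..Suc n. if 0 < ?X a \<omega> \<and> hits (?p n \<omega>) k then g (?X t \<omega>) else 0)) \<partial>M)"
      by simp
    also have "\<dots> = (\<integral>\<omega>. (if 0 < ?X a \<omega> \<and> P n \<omega> then g (?X t \<omega>) else 0) \<partial>M) +
        (\<integral>\<omega>. (\<Sum>k=1..Suc n. if 0 < ?X a \<omega> \<and> hits (?p n \<omega>) k then g (?X t \<omega>) else 0) \<partial>M)"
      by (intro Bochner_Integration.integral_add Bochner_Integration.integrable_sum int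
            integrable_const_bound[of _ C]) (auto simp: bound C)
    also have "(\<integral>\<omega>. (\<Sum>k=1..Suc n. if 0 < ?X a \<omega> \<and> hits (?p n \<omega>) k then g (?X t \<omega>) else 0) \<partial>M) =
        (\<Sum>k=1..Suc n. \<integral>\<omega>. (if 0 < ?X a \<omega> \<and> hits (?p n \<omega>) k then ?V n k \<omega> else 0) \<partial>M)"
      by (subst Bochner_Integration.integral_sum) (auto intro!: int sum.cong step simp del: sum.cl_ivl_Suc)
    also have "\<dots> = (\<integral>\<omega>. R n \<omega> \<partial>M)"
      unfolding R_eq by (subst Bochner_Integration.integral_sum) (auto intro!: intV simp del: sum.cl_ivl_Suc)
    finally show ?thesis .
  qed
  have "AE \<omega> in M. ?X t \<omega> \<noteq> 0"
    by (rule X_AE_nonzero) (use at in auto)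
  moreover have "(\<lambda>n. R n \<omega>) \<longlonglongrightarrow> 0" if "\<omega> \<in> space M" "?X t \<omega> \<noteq> 0" for \<omega>
  proof (cases "0 < ?X a \<omega>")
    case True
    have "continuous_on {a..t} (\<lambda>s. ?X s \<omega>)"
      by (rule continuous_on_subset[OF X_continuous[OF that(1)]]) (use at in auto)
    from stopped_sum_tendsto_0[where V = "gauss_op0 g \<mu>", OF at(2) this True that(2)]
    have "(\<lambda>n. \<Sum>k=1..Suc n. if hits (?p n \<omega>) k then ?V n k \<omega> else 0) \<longlonglongrightarrow> 0"
    proof -
      assume *: "(\<And>s r y. s \<longlonglongrightarrow> r \<Longrightarrow> 0 < r \<Longrightarrow> y \<longlonglongrightarrow> 0 \<Longrightarrow> (\<lambda>n. gauss_op0 g \<mu> (s n) (y n)) \<longlonglongrightarrow> 0) \<Longrightarrow> ?thesis"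
      show ?thesis
      proof (rule *)
        fix s y :: "nat \<Rightarrow> real" and r assume s: "s \<longlonglongrightarrow> r" "0 < r" "y \<longlonglongrightarrow> 0"
        have "(\<lambda>n. gauss_op g \<mu> (s n) (y n)) \<longlonglongrightarrow> 0"
          using gauss_op_tendsto[where g = g and \<mu> = \<mu>, OF s bound supp] odd[OF s(2)] by simp
        moreover have "\<forall>\<^sub>F n in sequentially. gauss_op g \<mu> (s n) (y n) = gauss_op0 g \<mu> (s n) (y n)"
          using order_tendstoD(1)[OF s(1,2)] by eventually_elim (auto simp: gauss_op0_def)
        ultimately show "(\<lambda>n. gauss_op0 g \<mu> (s n) (y n)) \<longlonglongrightarrow> 0"
          by (rule Lim_transform_eventually)
      qed
    qed
    then show ?thesis using True by (simp add: R_def)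
  qed (simp add: R_def)
  ultimately have "AE \<omega> in M. (\<lambda>n. R n \<omega>) \<longlonglongrightarrow> 0" by auto
  then have "(\<lambda>n. \<integral>\<omega>. R n \<omega> \<partial>M) \<longlonglongrightarrow> (\<integral>\<omega>. 0 \<partial>M)"
    by (intro integral_dominated_convergence[where w = "\<lambda>_. C"]) (auto simp: R_bound)
  then have R_lim: "(\<lambda>n. \<integral>\<omega>. R n \<omega> \<partial>M) \<longlonglongrightarrow> 0" by simp
  let ?Q = "\<lambda>\<omega>. (if 0 < ?X a \<omega> \<and> (\<forall>s\<in>{a..t}. 0 \<le> ?X s \<omega>) then g (?X t \<omega>) else 0)"
  \<comment> \<open>A path that is negative somewhere is negative at a point of every fine enough
    grid, so the sequence is eventually constant. As a pointwise limit, \<open>?Q\<close> is then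
    measurable.\<close>
  have P_lim: "(\<lambda>n. (if 0 < ?X a \<omega> \<and> P n \<omega> then g (?X t \<omega>) else 0)) \<longlonglongrightarrow> ?Q \<omega>"
    if \<omega>: "\<omega> \<in> space M" for \<omega>
  proof (rule tendsto_eventually)
    show "\<forall>\<^sub>F n in sequentially. (if 0 < ?X a \<omega> \<and> P n \<omega> then g (?X t \<omega>) else 0) = ?Q \<omega>"
    proof (cases "\<forall>s\<in>{a..t}. 0 \<le> ?X s \<omega>")
      case True
      then have "P n \<omega>" for n using grid_bounds[OF at(2)] by (auto simp: P_def)
      then show ?thesis using True by simp
    next
      case False
      then obtain s where s: "s \<in> {a..t}" "?X s \<omega> < 0" by (auto simp: not_le)
      have "continuous_on {a..t} (\<lambda>s. ?X s \<omega>)"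
        by (rule continuous_on_subset[OF X_continuous[OF \<omega>]]) (use at in auto)
      from nonneg_grid_limit[OF at(2) this s zero_less_one]
      show ?thesis by eventually_elim (use False in \<open>auto simp: P_def not_le[symmetric]\<close>)
    qed
  qed
  have Q_meas: "?Q \<in> borel_measurable M"
    by (rule borel_measurable_LIMSEQ_real[OF P_lim]) measurable
  have "(\<lambda>n. \<integral>\<omega>. (if 0 < ?X a \<omega> \<and> P n \<omega> then g (?X t \<omega>) else 0) \<partial>M) \<longlonglongrightarrow> (\<integral>\<omega>. ?Q \<omega> \<partial>M)"
    by (intro integral_dominated_convergence[where w = "\<lambda>_. C"] Q_meas AE_I2 P_lim) (auto simp: bound C)
  from tendsto_add[OF this R_lim] show ?thesis
    unfolding decomp[symmetric] by (simp add: LIMSEQ_const_iff)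
qed

end

subsection \<open>The reflection principle with drift\<close>

text \<open>Reflection principle for drift \<open>\<mu>\<close>: \<open>exp (- 2 * \<mu> * y)\<close> is the density of the
  mirrorected law of \<open>N(\<mu> s, s)\<close> relative to \<open>N(\<mu> s, s)\<close>.\<close>

definition mirror :: "real \<Rightarrow> real \<Rightarrow> real" where
  "mirror \<mu> y = (if 0 < y then 1 else if y < 0 then - exp (- 2 * \<mu> * y) else 0)"

text \<open>\<open>survival_bounded\<close> asks for a bounded function with bounded support. The
  cut-off is symmetric in order to keep the cancellation between \<open>y\<close> and
  \<open>- y\<close>.\<close>

definition mirror_trunc :: "real \<Rightarrow> real \<Rightarrow> real \<Rightarrow> real" where
  "mirror_trunc \<mu> K y = (if \<bar>y\<bar> \<le> K then mirror \<mu> y else 0)"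

lemma mirror_measurable [measurable]: "mirror \<mu> \<in> borel_measurable borel"
  unfolding mirror_def[abs_def] by measurable

lemma mirror_trunc_measurable [measurable]: "mirror_trunc \<mu> K \<in> borel_measurable borel"
  unfolding mirror_trunc_def[abs_def] by measurable

lemma mirror_bound: "\<bar>mirror \<mu> y\<bar> \<le> 1 + exp (- 2 * \<mu> * y)"
  by (auto simp: mirror_def)

lemma mirror_trunc_bound: "\<bar>mirror_trunc \<mu> K y\<bar> \<le> 1 + exp (2 * \<bar>\<mu>\<bar> * K)"
proof (cases "\<bar>y\<bar> \<le> K")
  case True
  have "- 2 * \<mu> * y \<le> \<bar>2 * \<mu>\<bar> * \<bar>y\<bar>" by (metis abs_ge_minus_self abs_mult mult_minus_left)
  also have "\<dots> \<le> \<bar>2 * \<mu>\<bar> * K" using True by (intro mult_left_mono) auto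
  finally show ?thesis using True mirror_bound[of \<mu> y]
    by (auto simp: mirror_trunc_def abs_mult intro: order_trans)
next
  case False
  then show ?thesis by (simp add: mirror_trunc_def)
qed

text \<open>Changing the sign of \<open>y\<close> multiplies the density by an exponential that the
  weight of \<open>mirror\<close> on the negative side cancels, so the integrand is odd.\<close>

lemma gauss_op_mirror_trunc:
  assumes "0 < s"
  shows "gauss_op (mirror_trunc \<mu> K) \<mu> s 0 = 0"
proof -
  let ?\<phi> = "normal_density (\<mu> * s) (sqrt s)"
  have *: "?\<phi> (- y) = exp (- 2 * \<mu> * y) * ?\<phi> y" for y
  proof -
    have "- ((- y - \<mu> * s)\<^sup>2) / (2 * s) = - 2 * \<mu> * y + - ((y - \<mu> * s)\<^sup>2) / (2 * s)"
      using assms by (simp add: field_simps) (simp add: power2_eq_square algebra_simps)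
    then show ?thesis using assms by (simp add: normal_density_def exp_add[symmetric])
  qed
  have "?\<phi> (- y) * mirror_trunc \<mu> K (- y) = - (?\<phi> y * mirror_trunc \<mu> K y)" for y
    by (auto simp: * mirror_trunc_def mirror_def exp_add[symmetric])
  then have "(\<integral>y. ?\<phi> y * mirror_trunc \<mu> K y \<partial>lborel) = - (\<integral>y. ?\<phi> y * mirror_trunc \<mu> K y \<partial>lborel)"
    by (subst lborel_integral_real_affine[where c = "-1" and t = 0]) auto
  then show ?thesis by (simp add: gauss_op_def)
qed

context brownian_motion
begin

lemma X_exp_integrable:
  assumes "0 < s"
  shows "integrable M (\<lambda>\<omega>. exp (l * X c \<mu> s \<omega>))"
proof -
  have "integrable lborel (\<lambda>y. normal_density (c + \<mu> * s) (sqrt s) y * exp (l * y))"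
    using assms by (subst normal_density_mult_exp) (auto intro!: integrable_mult_right integrable_normal_density)
  then show ?thesis
    using distributed_integrable[OF X_distributed[OF assms, of c \<mu>], of "\<lambda>y. exp (l * y)"] by simp
qed

lemma positive_on_iff:
  assumes "0 \<le> a" "a < t" "\<omega> \<in> space M"
  shows "(\<forall>s\<in>{a..t}. 0 < X c \<mu> s \<omega>) \<longleftrightarrow> 0 < X c \<mu> a \<omega> \<and> (\<forall>s\<in>{a..t}. X c \<mu> s \<omega> \<noteq> 0)"
proof safe
  assume pos: "0 < X c \<mu> a \<omega>" and nz: "\<forall>s\<in>{a..t}. X c \<mu> s \<omega> \<noteq> 0"
  fix s assume s: "s \<in> {a..t}"
  show "0 < X c \<mu> s \<omega>"
  proof (rule ccontr)
    assume "\<not> 0 < X c \<mu> s \<omega>"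
    moreover have "continuous_on {a..s} (\<lambda>s. X c \<mu> s \<omega>)"
      by (rule continuous_on_subset[OF X_continuous[OF assms(3)]]) (use assms in auto)
    ultimately obtain x where "a \<le> x" "x \<le> s" "X c \<mu> x \<omega> = 0"
      using IVT2'[of "\<lambda>s. X c \<mu> s \<omega>" s 0 a] pos s by auto
    then show False using nz s by auto
  qed
qed (use assms in force)+

lemma positive_on_sets:
  assumes "0 \<le> a" "a < t"
  shows "{\<omega>\<in>space M. \<forall>s\<in>{a..t}. 0 < X c \<mu> s \<omega>} \<in> sets M"
proof -
  have [measurable]: "X c \<mu> a \<in> borel_measurable M" using assms by (intro X_measurable)
  have "{\<omega>\<in>space M. \<forall>s\<in>{a..t}. 0 < X c \<mu> s \<omega>} =
      {\<omega>\<in>space M. 0 < X c \<mu> a \<omega>} \<inter> {\<omega>\<in>space M. \<forall>s\<in>{a..t}. X c \<mu> s \<omega> \<noteq> 0}"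
    using positive_on_iff[OF assms] by blast
  also have "\<dots> \<in> sets M"
    by (intro sets.Int nonvanishing_sets X_measurable X_continuous assms) measurable
  finally show ?thesis .
qed

text \<open>Raising the start by \<open>inverse (real (Suc n))\<close> writes nonnegativity as a
  countable intersection of strict positivity events, which are already measurable.\<close>

lemma nonneg_on_sets:
  assumes "0 \<le> a" "a < t"
  shows "{\<omega>\<in>space M. \<forall>s\<in>{a..t}. 0 \<le> X c \<mu> s \<omega>} \<in> sets M"
proof -
  have "0 \<le> X c \<mu> s \<omega> \<longleftrightarrow> (\<forall>n. 0 < X (c + inverse (real (Suc n))) \<mu> s \<omega>)" for s \<omega>
  proof
    assume "0 \<le> X c \<mu> s \<omega>"
    moreover have "X (c + inverse (real (Suc n))) \<mu> s \<omega> = X c \<mu> s \<omega> + inverse (real (Suc n))" for n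
      by (simp add: X_def)
    ultimately show "\<forall>n. 0 < X (c + inverse (real (Suc n))) \<mu> s \<omega>"
      by (simp add: add_nonneg_pos)
  next
    assume *: "\<forall>n. 0 < X (c + inverse (real (Suc n))) \<mu> s \<omega>"
    have "(\<lambda>n. X c \<mu> s \<omega> + inverse (real (Suc n))) \<longlonglongrightarrow> X c \<mu> s \<omega> + 0"
      by (intro tendsto_add tendsto_const LIMSEQ_inverse_real_of_nat)
    then show "0 \<le> X c \<mu> s \<omega>"
      by (intro LIMSEQ_le_const[of "\<lambda>n. X c \<mu> s \<omega> + inverse (real (Suc n))"])
         (use * in \<open>auto simp: X_def algebra_simps less_imp_le\<close>)
  qed
  then have "{\<omega>\<in>space M. \<forall>s\<in>{a..t}. 0 \<le> X c \<mu> s \<omega>} =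
      {\<omega>\<in>space M. \<forall>n. \<forall>s\<in>{a..t}. 0 < X (c + inverse (real (Suc n))) \<mu> s \<omega>}"
    by blast
  also have "\<dots> \<in> sets M"
    by (intro sets.sets_Collect_countable_All positive_on_sets assms)
  finally show ?thesis .
qed

text \<open>The cut-off and the shift of the start are removed together. The jumps of
  \<open>mirror\<close> and of the indicator do no harm, since almost surely the path vanishes
  neither at \<open>a\<close> nor at \<open>t\<close>.\<close>

lemma mirror_trunc_limit:
  fixes c :: "nat \<Rightarrow> real"
  assumes at: "0 < a" "a < t" and c: "c \<longlonglongrightarrow> 0" and c1: "\<And>n. \<bar>c n\<bar> \<le> 1"
  shows "(\<lambda>n. \<integral>\<omega>. (if 0 < X (c n) \<mu> a \<omega> then mirror_trunc \<mu> (real n) (X (c n) \<mu> t \<omega>) else 0) \<partial>M)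
    \<longlonglongrightarrow> (\<integral>\<omega>. (if 0 < X 0 \<mu> a \<omega> then mirror \<mu> (X 0 \<mu> t \<omega>) else 0) \<partial>M)"
proof (rule integral_dominated_convergence
    [where w = "\<lambda>\<omega>. 1 + exp (2 * \<bar>\<mu>\<bar>) * exp (- 2 * \<mu> * X 0 \<mu> t \<omega>)"])
  have [measurable]: "X c \<mu> a \<in> borel_measurable M" "X c \<mu> t \<in> borel_measurable M" for c
    using at by (auto intro!: X_measurable)
  show "(\<lambda>\<omega>. if 0 < X 0 \<mu> a \<omega> then mirror \<mu> (X 0 \<mu> t \<omega>) else 0) \<in> borel_measurable M"
    "(\<lambda>\<omega>. if 0 < X (c n) \<mu> a \<omega> then mirror_trunc \<mu> (real n) (X (c n) \<mu> t \<omega>) else 0) \<in> borel_measurable M" for n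
    by measurable
  show "integrable M (\<lambda>\<omega>. 1 + exp (2 * \<bar>\<mu>\<bar>) * exp (- 2 * \<mu> * X 0 \<mu> t \<omega>))"
    using at by (intro Bochner_Integration.integrable_add integrable_mult_right X_exp_integrable) auto
  have X: "X (c n) \<mu> s \<omega> = c n + X 0 \<mu> s \<omega>" for n s \<omega>
    by (simp add: X_def)
  show "AE \<omega> in M. norm (if 0 < X (c n) \<mu> a \<omega> then mirror_trunc \<mu> (real n) (X (c n) \<mu> t \<omega>) else 0)
      \<le> 1 + exp (2 * \<bar>\<mu>\<bar>) * exp (- 2 * \<mu> * X 0 \<mu> t \<omega>)" for n
  proof (rule AE_I2)
    fix \<omega>
    let ?y = "X (c n) \<mu> t \<omega>"
    \<comment> \<open>By \<open>c1\<close> the shift changes the exponential at most by the factor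
      \<open>exp (2 * \<bar>\<mu>\<bar>)\<close> of the dominating function.\<close>
    have "- \<mu> * c n \<le> \<bar>\<mu>\<bar> * 1"
      using mult_mono[of "\<bar>\<mu>\<bar>" "\<bar>\<mu>\<bar>" "\<bar>c n\<bar>" 1] c1[of n] abs_ge_minus_self[of "\<mu> * c n"]
      by (simp add: abs_mult)
    then have "exp (- 2 * \<mu> * ?y) \<le> exp (2 * \<bar>\<mu>\<bar>) * exp (- 2 * \<mu> * X 0 \<mu> t \<omega>)"
      by (simp add: X exp_add[symmetric] algebra_simps)
    then have "\<bar>mirror \<mu> ?y\<bar> \<le> 1 + exp (2 * \<bar>\<mu>\<bar>) * exp (- 2 * \<mu> * X 0 \<mu> t \<omega>)"
      using mirror_bound[of \<mu> ?y] by simp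
    then show "norm (if 0 < X (c n) \<mu> a \<omega> then mirror_trunc \<mu> (real n) ?y else 0)
      \<le> 1 + exp (2 * \<bar>\<mu>\<bar>) * exp (- 2 * \<mu> * X 0 \<mu> t \<omega>)"
      by (auto simp: mirror_trunc_def add_nonneg_nonneg)
  qed
  show "AE \<omega> in M. (\<lambda>n. if 0 < X (c n) \<mu> a \<omega> then mirror_trunc \<mu> (real n) (X (c n) \<mu> t \<omega>) else 0)
      \<longlonglongrightarrow> (if 0 < X 0 \<mu> a \<omega> then mirror \<mu> (X 0 \<mu> t \<omega>) else 0)"
    using X_AE_nonzero[OF at(1), of 0 \<mu>] X_AE_nonzero[OF less_trans[OF at], of 0 \<mu>]
  proof eventually_elim
    case (elim \<omega>)
    have lim: "(\<lambda>n. X (c n) \<mu> s \<omega>) \<longlonglongrightarrow> X 0 \<mu> s \<omega>" for s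
      unfolding X using tendsto_add[OF c tendsto_const, of "X 0 \<mu> s \<omega>"] by simp
    have yt: "X 0 \<mu> t \<omega> \<noteq> 0" using elim at by auto
    have ev_a: "\<forall>\<^sub>F n in sequentially. 0 < X (c n) \<mu> a \<omega> \<longleftrightarrow> 0 < X 0 \<mu> a \<omega>"
    proof (cases "0 < X 0 \<mu> a \<omega>")
      case True
      show ?thesis using order_tendstoD(1)[OF lim True] by eventually_elim (use True in auto)
    next
      case False
      then have "X 0 \<mu> a \<omega> < 0" using elim by auto
      from order_tendstoD(2)[OF lim this] show ?thesis by eventually_elim (use False in auto)
    qed
    have ev_t: "\<forall>\<^sub>F n in sequentially. (0 < X (c n) \<mu> t \<omega> \<longleftrightarrow> 0 < X 0 \<mu> t \<omega>) \<and>
        (X (c n) \<mu> t \<omega> < 0 \<longleftrightarrow> X 0 \<mu> t \<omega> < 0)"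
    proof (cases "0 < X 0 \<mu> t \<omega>")
      case True
      show ?thesis using order_tendstoD(1)[OF lim True] by eventually_elim (use True in auto)
    next
      case False
      then have neg: "X 0 \<mu> t \<omega> < 0" using yt by auto
      from order_tendstoD(2)[OF lim neg] show ?thesis by eventually_elim (use neg in auto)
    qed
    obtain N where N: "\<bar>X 0 \<mu> t \<omega>\<bar> + 1 \<le> real N" using real_arch_simple by blast
    have ev_K: "\<forall>\<^sub>F n in sequentially. \<bar>X (c n) \<mu> t \<omega>\<bar> \<le> real n"
      using eventually_ge_at_top[of N]
    proof eventually_elim
      case (elim n)
      then show ?case using c1[of n] N by (simp add: X)
    qed
    have "(\<lambda>n. if 0 < X 0 \<mu> a \<omega> then if 0 < X 0 \<mu> t \<omega> then 1 else - exp (- 2 * \<mu> * X (c n) \<mu> t \<omega>) else 0)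
      \<longlonglongrightarrow> (if 0 < X 0 \<mu> a \<omega> then mirror \<mu> (X 0 \<mu> t \<omega>) else 0)"
      using yt by (auto simp: mirror_def intro!: tendsto_intros lim)
    moreover have "\<forall>\<^sub>F n in sequentially.
        (if 0 < X 0 \<mu> a \<omega> then if 0 < X 0 \<mu> t \<omega> then 1 else - exp (- 2 * \<mu> * X (c n) \<mu> t \<omega>) else 0) =
        (if 0 < X (c n) \<mu> a \<omega> then mirror_trunc \<mu> (real n) (X (c n) \<mu> t \<omega>) else 0)"
      using ev_a ev_t ev_K
      by eventually_elim (use yt in \<open>auto simp: mirror_def mirror_trunc_def\<close>)
    ultimately show ?case by (rule Lim_transform_eventually)
  qed
qed

text \<open>A sandwich, since \<open>survival_bounded\<close> only sees paths that stay nonnegative.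
  Such a path started just below 0 lies strictly below the one started at 0, which gives one
  inequality; positive paths started at 0 are nonnegative, which gives the other.\<close>

lemma survival_probability:
  assumes at: "0 < a" "a < t"
  shows "measure M {\<omega>\<in>space M. \<forall>s\<in>{a..t}. 0 < X 0 \<mu> s \<omega>} =
    (\<integral>\<omega>. (if 0 < X 0 \<mu> a \<omega> then mirror \<mu> (X 0 \<mu> t \<omega>) else 0) \<partial>M)" (is "measure M ?E = ?Q")
proof (rule antisym)
  have [measurable]: "X c \<mu> a \<in> borel_measurable M" "X c \<mu> t \<in> borel_measurable M" for c
    using at by (auto intro!: X_measurable)
  have [measurable]: "?E \<in> sets M" by (rule positive_on_sets) (use at in auto)
  define G where "G c n \<omega> =
    (if 0 < X c \<mu> a \<omega> \<and> (\<forall>s\<in>{a..t}. 0 \<le> X c \<mu> s \<omega>) then mirror_trunc \<mu> (real n) (X c \<mu> t \<omega>) else 0)"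
    for c n \<omega>
  have bounded: "(\<integral>\<omega>. (if 0 < X c \<mu> a \<omega> then mirror_trunc \<mu> (real n) (X c \<mu> t \<omega>) else 0) \<partial>M) =
      (\<integral>\<omega>. G c n \<omega> \<partial>M)" for c n
    unfolding G_def
    by (rule survival_bounded[OF at _ mirror_trunc_bound[of \<mu> "real n"], where K = "real n"])
       (simp, simp add: mirror_trunc_def, rule gauss_op_mirror_trunc)
  \<comment> \<open>On the event in \<open>G\<close> the endpoint is nonnegative, so the negative
    branch of \<open>mirror\<close> is never reached.\<close>
  have G01: "G c n \<omega> \<in> {0..1}" for c n \<omega>
    using at by (auto simp: G_def mirror_trunc_def mirror_def not_le intro: bexI[of _ t])
  have G_int: "integrable M (G c n)" for c n
  proof (rule integrable_const_bound[of _ 1])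
    have [measurable]: "Measurable.pred M (\<lambda>\<omega>. \<forall>s\<in>{a..t}. 0 \<le> X c \<mu> s \<omega>)"
      using nonneg_on_sets[of a t c \<mu>] at by (simp add: pred_def)
    show "G c n \<in> borel_measurable M" unfolding G_def[abs_def] by measurable
  qed (use G01[of c n] in auto)
  show "?Q \<le> measure M ?E"
  proof (rule LIMSEQ_le_const2[OF mirror_trunc_limit[OF at, where c = "\<lambda>n. - inverse (real (Suc n))"]])
    show "(\<lambda>n. - inverse (real (Suc n))) \<longlonglongrightarrow> 0"
      using tendsto_minus[OF LIMSEQ_inverse_real_of_nat] by simp
    show "\<exists>N. \<forall>n\<ge>N. (\<integral>\<omega>. (if 0 < X (- inverse (real (Suc n))) \<mu> a \<omega>
        then mirror_trunc \<mu> (real n) (X (- inverse (real (Suc n))) \<mu> t \<omega>) else 0) \<partial>M) \<le> measure M ?E"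
    proof (intro exI allI impI)
      fix n :: nat
      let ?c = "- inverse (real (Suc n))"
      have "(\<integral>\<omega>. G ?c n \<omega> \<partial>M) \<le> (\<integral>\<omega>. indicator ?E \<omega> \<partial>M)"
      proof (rule integral_mono')
        show "integrable M (indicator ?E :: 'a \<Rightarrow> real)"
          by (rule integrable_const_bound[of _ 1]) auto
        fix \<omega> assume \<omega>: "\<omega> \<in> space M"
        have "\<omega> \<in> ?E" if "\<forall>s\<in>{a..t}. 0 \<le> X ?c \<mu> s \<omega>"
        proof -
          have "X ?c \<mu> s \<omega> < X 0 \<mu> s \<omega>" for s by (simp add: X_def)
          then show ?thesis using that \<omega> by (auto intro: le_less_trans)
        qed
        then show "G ?c n \<omega> \<le> indicator ?E \<omega>"
          using G01[of ?c n \<omega>] by (auto simp: G_def split: split_indicator)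
      qed simp
      then show "(\<integral>\<omega>. (if 0 < X ?c \<mu> a \<omega> then mirror_trunc \<mu> (real n) (X ?c \<mu> t \<omega>) else 0) \<partial>M) \<le> measure M ?E"
        unfolding bounded by simp
    qed
  qed (simp add: inverse_eq_divide)
  show "measure M ?E \<le> ?Q"
  proof -
    \<comment> \<open>The restriction to endpoints of size at most \<open>n\<close> makes
      \<open>?I n\<close> a lower bound for \<open>G 0 n\<close>, which is 0 beyond the
      cut-off.\<close>
    let ?I = "\<lambda>n \<omega>. if X 0 \<mu> t \<omega> \<le> real n then indicator ?E \<omega> else (0 :: real)"
    have "(\<lambda>n. \<integral>\<omega>. ?I n \<omega> \<partial>M) \<longlonglongrightarrow> (\<integral>\<omega>. indicator ?E \<omega> \<partial>M)"
    proof (rule integral_dominated_convergence[where w = "\<lambda>_. 1"])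
      show "AE \<omega> in M. (\<lambda>n. ?I n \<omega>) \<longlonglongrightarrow> indicator ?E \<omega>"
      proof (rule AE_I2)
        fix \<omega>
        obtain N where N: "X 0 \<mu> t \<omega> \<le> real N" using real_arch_simple by blast
        have "\<forall>\<^sub>F n in sequentially. ?I n \<omega> = indicator ?E \<omega>"
          using eventually_ge_at_top[of N] by eventually_elim (use N in auto)
        then show "(\<lambda>n. ?I n \<omega>) \<longlonglongrightarrow> indicator ?E \<omega>" by (rule tendsto_eventually)
      qed
    qed auto
    then have lim: "(\<lambda>n. \<integral>\<omega>. ?I n \<omega> \<partial>M) \<longlonglongrightarrow> measure M ?E" by simp
    have "(\<integral>\<omega>. ?I n \<omega> \<partial>M) \<le> (\<integral>\<omega>. (if 0 < X 0 \<mu> a \<omega> then mirror_trunc \<mu> (real n) (X 0 \<mu> t \<omega>) else 0) \<partial>M)" for n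
      unfolding bounded
    proof -
      show "(\<integral>\<omega>. ?I n \<omega> \<partial>M) \<le> (\<integral>\<omega>. G 0 n \<omega> \<partial>M)"
      proof (rule integral_mono'[OF G_int])
        fix \<omega>
        have "G 0 n \<omega> = 1" if "\<omega> \<in> ?E" "X 0 \<mu> t \<omega> \<le> real n"
        proof -
          have "0 < X 0 \<mu> a \<omega>" "0 < X 0 \<mu> t \<omega>" "\<forall>s\<in>{a..t}. 0 \<le> X 0 \<mu> s \<omega>"
            using that at by (auto intro: less_imp_le)
          then show ?thesis using that by (simp add: G_def mirror_trunc_def mirror_def)
        qed
        then show "?I n \<omega> \<le> G 0 n \<omega>" using G01[of 0 n \<omega>] by (auto split: split_indicator)
      qed (use G01[of 0 n] in auto)
    qed
    then show ?thesis
      by (intro LIMSEQ_le[OF lim mirror_trunc_limit[OF at tendsto_const]]) auto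
  qed
qed

end

subsection \<open>The law of the first zero after a fixed time\<close>

definition passage_density :: "real \<Rightarrow> real \<Rightarrow> real \<Rightarrow> real" where
  "passage_density \<mu> a w = exp (- (\<mu>\<^sup>2 * w / 2)) * (sqrt a / (pi * w * sqrt (w - a)))"

text \<open>This will be the probability that the path with drift \<open>\<mu>\<close> vanishes
  somewhere in [a, t], with \<open>passage_density\<close> as its derivative in \<open>t\<close>.
  The bracket of the main formula is \<open>1 - passage_cdf \<mu>2 w t\<close>, where
  \<open>w\<close> plays the part of \<open>a\<close>.\<close>

definition passage_cdf :: "real \<Rightarrow> real \<Rightarrow> real \<Rightarrow> real" where
  "passage_cdf \<mu> a t = 2 / pi * exp (- (\<mu>\<^sup>2 * a / 2)) *
     (LBINT \<theta>:{0..arccos (sqrt (a / t))}. exp (- (\<mu>\<^sup>2 * a / 2) * (tan \<theta>)\<^sup>2))"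

lemma LBINT_has_real_derivative:
  fixes h :: "real \<Rightarrow> real"
  assumes "continuous_on {u..v} h" "u < b" "b < v"
  shows "((\<lambda>b. LBINT x:{u..b}. h x) has_real_derivative h b) (at b)"
proof -
  have "((\<lambda>b. integral {u..b} h) has_real_derivative h b) (at b within {u..v})"
    by (rule integral_has_real_derivative) (use assms in auto)
  then have "((\<lambda>b. integral {u..b} h) has_real_derivative h b) (at b)"
    by (simp only: at_within_Icc_at[OF assms(2,3)])
  moreover have "\<forall>\<^sub>F x in nhds b. x \<in> {u<..<v}"
    by (rule eventually_nhds_in_open) (use assms in auto)
  then have "\<forall>\<^sub>F x in nhds b. integral {u..x} h = (LBINT x:{u..x}. h x)"
  proof eventually_elim
    case (elim x)
    show ?case
      by (rule set_borel_integral_eq_integral(2)[symmetric], rule borel_integrable_atLeastAtMost')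
         (rule continuous_on_subset[OF assms(1)], use elim in auto)
  qed
  ultimately show ?thesis by (subst DERIV_cong_ev[OF refl _ refl, symmetric])
qed

lemma LBINT_exp_tan_bounds:
  fixes c b :: real
  assumes "0 \<le> c" "0 \<le> b"
  shows "0 \<le> (LBINT \<theta>:{0..b}. exp (- c * (tan \<theta>)\<^sup>2))" "(LBINT \<theta>:{0..b}. exp (- c * (tan \<theta>)\<^sup>2)) \<le> b"
proof -
  have [measurable]: "(tan :: real \<Rightarrow> real) \<in> borel_measurable borel"
    unfolding tan_def[abs_def] by measurable
  have "set_integrable lborel {0..b} (\<lambda>\<theta>. 1 :: real)"
    by (rule borel_integrable_atLeastAtMost') simp
  moreover from this have "set_integrable lborel {0..b} (\<lambda>\<theta>. exp (- c * (tan \<theta>)\<^sup>2))"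
    by (rule set_integrable_bound) (use assms in \<open>auto simp: set_borel_measurable_def\<close>)
  ultimately have "(LBINT \<theta>:{0..b}. exp (- c * (tan \<theta>)\<^sup>2)) \<le> (LBINT \<theta>:{0..b}. 1)"
    by (intro set_integral_mono) (use assms in auto)
  also have "\<dots> = b"
    using assms by (simp add: set_lebesgue_integral_def)
  finally show "(LBINT \<theta>:{0..b}. exp (- c * (tan \<theta>)\<^sup>2)) \<le> b" .
  show "0 \<le> (LBINT \<theta>:{0..b}. exp (- c * (tan \<theta>)\<^sup>2))"
    unfolding set_lebesgue_integral_def by (intro integral_nonneg_AE AE_I2) auto
qed

lemma arccos_sqrt_bounds:
  assumes "0 < a" "a < t"
  shows "0 < arccos (sqrt (a / t))" "arccos (sqrt (a / t)) < pi / 2"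
proof -
  have "0 < sqrt (a / t)" "sqrt (a / t) < 1" "- 1 \<le> sqrt (a / t)"
    using assms by (auto intro: order_trans[of _ 0])
  then show "0 < arccos (sqrt (a / t))" "arccos (sqrt (a / t)) < pi / 2"
    using arccos_less_arccos[of "sqrt (a / t)" 1] arccos_less_arccos[of 0 "sqrt (a / t)"] by auto
qed

lemma arccos_sqrt_deriv:
  assumes "0 < a" "a < t"
  shows "((\<lambda>t. arccos (sqrt (a / t))) has_real_derivative sqrt a / (2 * t * sqrt (t - a))) (at t)"
proof -
  have u: "0 < a / t" "a / t < 1" using assms by auto
  have "((\<lambda>t. arccos (sqrt (a / t))) has_real_derivative
      inverse (- sqrt (1 - (sqrt (a / t))\<^sup>2)) * (inverse (sqrt (a / t)) / 2 * (- a / (t * t)))) (at t)"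
    by (intro DERIV_chain2[OF DERIV_arccos] DERIV_chain2[OF DERIV_real_sqrt])
       (use u assms in \<open>auto intro!: derivative_eq_intros simp: less_le_trans[OF _ real_sqrt_ge_zero]\<close>)
  moreover have "inverse (- sqrt (1 - (sqrt (a / t))\<^sup>2)) * (inverse (sqrt (a / t)) / 2 * (- a / (t * t))) =
      sqrt a / (2 * t * sqrt (t - a))"
  proof -
    have 1: "sqrt (1 - (sqrt (a / t))\<^sup>2) = sqrt (t - a) / sqrt t"
      using assms by (simp add: real_sqrt_divide[symmetric] field_simps)
    have 2: "inverse (- (r / q)) * (inverse (p / q) / 2 * (- (p * p) / ((q * q) * (q * q)))) =
        p / (2 * (q * q) * r)" if "0 < p" "0 < q" "0 < r" for p q r :: real
      using that by (simp add: field_simps)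
    show ?thesis
      unfolding 1 using 2[of "sqrt a" "sqrt t" "sqrt (t - a)"] assms by (simp add: real_sqrt_divide)
  qed
  ultimately show ?thesis by simp
qed

text \<open>At the upper limit \<open>(tan \<theta>)\<^sup>2\<close> equals
  \<open>(t - a) / a\<close>, so the two exponentials combine to
  \<open>exp (- (\<mu>\<^sup>2 * t / 2))\<close>; the remaining factor is the derivative of the
  limit.\<close>

lemma passage_cdf_deriv:
  assumes "0 < a" "a < t"
  shows "(passage_cdf \<mu> a has_real_derivative passage_density \<mu> a t) (at t)"
proof -
  let ?b = "arccos (sqrt (a / t))"
  let ?h = "\<lambda>\<theta>. exp (- (\<mu>\<^sup>2 * a / 2) * (tan \<theta>)\<^sup>2)"
  note b = arccos_sqrt_bounds[OF assms]
  \<comment> \<open>An end point below \<open>pi / 2\<close> keeps the integrand away from the pole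
    of \<open>tan\<close>.\<close>
  obtain v where v: "?b < v" "v < pi / 2" using b(2) dense by blast
  have "continuous_on {0..v} ?h"
    using v by (intro continuous_intros) (auto intro!: cos_gt_zero_pi less_imp_neq[symmetric])
  from LBINT_has_real_derivative[OF this b(1) v(1)]
  have I: "((\<lambda>b. LBINT x:{0..b}. ?h x) has_real_derivative ?h ?b) (at ?b)" .
  have tan: "(tan ?b)\<^sup>2 = (t - a) / a"
  proof -
    have u: "0 < sqrt (a / t)" "sqrt (a / t) < 1" using assms by auto
    have "sin ?b = sqrt (1 - (sqrt (a / t))\<^sup>2)" by (rule sin_arccos) (use u in \<open>auto intro: order_trans[of _ 0]\<close>)
    moreover have "cos ?b = sqrt (a / t)" by (rule cos_arccos) (use u in \<open>auto intro: order_trans[of _ 0]\<close>)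
    ultimately show ?thesis
      using assms by (simp add: tan_def power_divide real_sqrt_pow2 field_simps)
  qed
  have "(passage_cdf \<mu> a has_real_derivative
      2 / pi * exp (- (\<mu>\<^sup>2 * a / 2)) * (?h ?b * (sqrt a / (2 * t * sqrt (t - a))))) (at t)"
    unfolding passage_cdf_def[abs_def]
    by (intro DERIV_cmult
      DERIV_chain2[where f = "\<lambda>b. LBINT x:{0..b}. ?h x" and g = "\<lambda>t. arccos (sqrt (a / t))", OF I] arccos_sqrt_deriv assms)
  moreover have "exp (- (\<mu>\<^sup>2 * a / 2)) * ?h ?b = exp (- (\<mu>\<^sup>2 * t / 2))"
    unfolding tan exp_add[symmetric] using assms by (simp add: field_simps)
  moreover have "2 / pi * E * (h * (p / (2 * t * r))) = (E * h) * (p / (pi * t * r))" for E h p r :: real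
    by simp
  ultimately show ?thesis by (simp only: passage_density_def)
qed

lemma passage_cdf_bounds:
  assumes "0 < a" "a \<le> t"
  shows "0 \<le> passage_cdf \<mu> a t" "passage_cdf \<mu> a t \<le> 2 / pi * arccos (sqrt (a / t))"
proof -
  have b: "0 \<le> arccos (sqrt (a / t))"
    by (rule arccos_lbound) (use assms in \<open>auto intro: order_trans[of _ 0]\<close>)
  note I = LBINT_exp_tan_bounds[OF _ b, of "\<mu>\<^sup>2 * a / 2"]
  show "0 \<le> passage_cdf \<mu> a t"
    unfolding passage_cdf_def using I assms by (intro mult_nonneg_nonneg) auto
  have "2 / pi * exp (- (\<mu>\<^sup>2 * a / 2)) * (LBINT \<theta>:{0..arccos (sqrt (a / t))}. exp (- (\<mu>\<^sup>2 * a / 2) * (tan \<theta>)\<^sup>2))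
      \<le> 2 / pi * 1 * arccos (sqrt (a / t))"
    using I assms b by (intro mult_mono) auto
  then show "passage_cdf \<mu> a t \<le> 2 / pi * arccos (sqrt (a / t))"
    by (simp add: passage_cdf_def)
qed

lemma passage_cdf_start:
  assumes "0 < a"
  shows "passage_cdf \<mu> a a = 0"
  using passage_cdf_bounds[of a a \<mu>] assms by simp

lemma passage_cdf_tendsto_start:
  assumes "0 < a"
  shows "(passage_cdf \<mu> a \<longlongrightarrow> 0) (at_right a)"
proof (rule tendsto_sandwich)
  show "\<forall>\<^sub>F t in at_right a. 0 \<le> passage_cdf \<mu> a t"
    "\<forall>\<^sub>F t in at_right a. passage_cdf \<mu> a t \<le> 2 / pi * arccos (sqrt (a / t))"
    using passage_cdf_bounds[OF assms] by (auto intro!: eventually_at_right_less[THEN eventually_mono])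
  have "continuous_on {a..} (\<lambda>t. 2 / pi * arccos (sqrt (a / t)))"
    using assms by (intro continuous_intros) (auto intro: order_trans[of _ 0])
  then have "continuous (at a within {a..}) (\<lambda>t. 2 / pi * arccos (sqrt (a / t)))"
    by (rule continuous_on_eq_continuous_within[THEN iffD1, rule_format]) simp
  then have "((\<lambda>t. 2 / pi * arccos (sqrt (a / t))) \<longlongrightarrow> 2 / pi * arccos (sqrt (a / a))) (at a within {a..})"
    by (simp add: continuous_within)
  then have "((\<lambda>t. 2 / pi * arccos (sqrt (a / t))) \<longlongrightarrow> 2 / pi * arccos (sqrt (a / a))) (at_right a)"
    by (rule tendsto_within_subset) auto
  then show "((\<lambda>t. 2 / pi * arccos (sqrt (a / t))) \<longlongrightarrow> 0) (at_right a)"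
    using assms by simp
qed simp

text \<open>The density is unbounded at \<open>a\<close>, so the fundamental theorem is used in its
  form for nonnegative integrands with one-sided limits at the ends, which also yields
  integrability.\<close>

lemma passage_density_FTC:
  assumes "0 < a" "a < t"
  shows "set_integrable lborel {a<..<t} (passage_density \<mu> a)"
    "(LBINT w:{a<..<t}. passage_density \<mu> a w) = passage_cdf \<mu> a t"
proof -
  have cont: "isCont (passage_density \<mu> a) w" if "a < w" for w
    unfolding passage_density_def[abs_def] using that assms by (intro continuous_intros) auto
  have nn: "0 \<le> passage_density \<mu> a w" if "a < w" for w
    unfolding passage_density_def using that assms by auto
  have A: "((passage_cdf \<mu> a \<circ> real_of_ereal) \<longlongrightarrow> 0) (at_right (ereal a))"
    using passage_cdf_tendsto_start[OF assms(1)] by (simp add: ereal_tendsto_simps)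
  have "isCont (passage_cdf \<mu> a) t"
    by (rule DERIV_isCont[OF passage_cdf_deriv[OF assms]])
  then have B: "((passage_cdf \<mu> a \<circ> real_of_ereal) \<longlongrightarrow> passage_cdf \<mu> a t) (at_left (ereal t))"
    by (simp add: ereal_tendsto_simps isCont_def filterlim_at_split)
  note FTC = interval_integral_FTC_nonneg[OF _ _ _ _ A B, of "passage_density \<mu> a"]
  have e: "einterval (ereal a) (ereal t) = {a<..<t}" by (auto simp: einterval_def)
  show "set_integrable lborel {a<..<t} (passage_density \<mu> a)"
    using FTC(1) passage_cdf_deriv[OF assms(1)] cont nn assms by (simp add: e)
  show "(LBINT w:{a<..<t}. passage_density \<mu> a w) = passage_cdf \<mu> a t"
    using FTC(2) passage_cdf_deriv[OF assms(1)] cont nn assms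
    by (simp add: e interval_lebesgue_integral_def)
qed

lemma passage_density_nn_integral:
  assumes "0 < a" "a < t"
  shows "(\<integral>\<^sup>+ w. ennreal (passage_density \<mu> a w) * indicator {a<..<t} w \<partial>lborel) = ennreal (passage_cdf \<mu> a t)"
proof -
  have nn: "0 \<le> passage_density \<mu> a w" if "a < w" for w
    unfolding passage_density_def using that assms by auto
  have "(\<integral>\<^sup>+ w. ennreal (passage_density \<mu> a w) * indicator {a<..<t} w \<partial>lborel) =
      (\<integral>\<^sup>+ w. ennreal (indicator {a<..<t} w *\<^sub>R passage_density \<mu> a w) \<partial>lborel)"
    by (intro nn_integral_cong) (auto split: split_indicator)
  also have "\<dots> = ennreal (LBINT w:{a<..<t}. passage_density \<mu> a w)"
    unfolding set_lebesgue_integral_def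
    by (rule nn_integral_eq_integral)
       (use passage_density_FTC(1)[OF assms, of \<mu>] nn in \<open>auto simp: set_integrable_def split: split_indicator\<close>)
  finally show ?thesis by (simp add: passage_density_FTC(2)[OF assms])
qed

section \<open>The normal distribution function and first passage to 0\<close>

abbreviation Phi :: "real \<Rightarrow> real" where
  "Phi \<equiv> cdf std_normal_distribution"

lemma Phi_eq: "Phi z = (\<integral>y. std_normal_density y * indicator {..z} y \<partial>lborel)"
proof -
  have "(\<integral>y. std_normal_density y * indicator {..z} y \<partial>lborel) =
      enn2real (\<integral>\<^sup>+y. ennreal (std_normal_density y * indicator {..z} y) \<partial>lborel)"
    by (rule integral_eq_nn_integral) auto
  also have "(\<integral>\<^sup>+y. ennreal (std_normal_density y * indicator {..z} y) \<partial>lborel) =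
      (\<integral>\<^sup>+y. ennreal (std_normal_density y) * indicator {..z} y \<partial>lborel)"
    by (intro nn_integral_cong) (auto split: split_indicator)
  finally show ?thesis
    by (simp add: cdf_def measure_def emeasure_density)
qed

lemma Phi_deriv: "(Phi has_real_derivative std_normal_density z) (at z)"
proof -
  interpret real_distribution std_normal_distribution by (rule real_dist_normal_dist)
  have int: "set_integrable lborel A std_normal_density" if "A \<in> sets lborel" for A
    using integrable_mult_indicator[OF that, of std_normal_density]
    by (simp add: set_integrable_def)
  \<comment> \<open>The reference point \<open>z - 1\<close> trades the half-line for a compact
    interval, up to a constant.\<close>
  have "Phi x = Phi (z - 1) + (LBINT y:{z-1..x}. std_normal_density y)" if "z - 1 < x" for x
  proof -
    have "(LBINT y:{z-1..x}. std_normal_density y) = (LBINT y:{z-1<..x}. std_normal_density y)"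
    proof (rule set_integral_cong_set)
      show "AE y in lborel. (y \<in> {z-1<..x}) = (y \<in> {z-1..x})"
        using AE_lborel_singleton[of "z - 1"] by eventually_elim auto
    qed (auto simp: set_borel_measurable_def)
    also have "\<dots> = (LBINT y:{..x}. std_normal_density y) - (LBINT y:{..z-1}. std_normal_density y)"
    proof -
      have "{..x} = {..z-1} \<union> {z-1<..x}" using that by auto
      then have "(LBINT y:{..x}. std_normal_density y) =
          (LBINT y:{..z-1}. std_normal_density y) + (LBINT y:{z-1<..x}. std_normal_density y)"
        by (simp only:) (rule set_integral_Un, auto intro!: int)
      then show ?thesis by simp
    qed
    finally show ?thesis by (simp add: Phi_eq set_lebesgue_integral_def mult.commute)
  qed
  then have "\<forall>\<^sub>F x in nhds z. Phi x = Phi (z - 1) + (LBINT y:{z-1..x}. std_normal_density y)"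
    by (intro eventually_mono[OF eventually_nhds_in_open[of "{z-1<..}" z]]) auto
  moreover have "((\<lambda>x. Phi (z - 1) + (LBINT y:{z-1..x}. std_normal_density y))
      has_real_derivative 0 + std_normal_density z) (at z)"
    by (intro DERIV_add DERIV_const LBINT_has_real_derivative[of _ "z + 1"])
       (auto simp: normal_density_def intro!: continuous_intros)
  ultimately show ?thesis by (subst DERIV_cong_ev[OF refl _ refl]) auto
qed

lemma normal_density_integral_neg:
  assumes "0 < \<sigma>"
  shows "(\<integral>y. normal_density m \<sigma> y * indicator {..<0} y \<partial>lborel) = Phi (- m / \<sigma>)"
proof -
  have "(\<integral>y. normal_density m \<sigma> y * indicator {..<0} y \<partial>lborel) =
      (\<integral>y. normal_density m \<sigma> y * indicator {..0} y \<partial>lborel)"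
  proof (rule integral_cong_AE)
    show "AE y in lborel. normal_density m \<sigma> y * indicator {..<0} y = normal_density m \<sigma> y * indicator {..0} y"
      using AE_lborel_singleton[of "0 :: real"] by eventually_elim (auto split: split_indicator)
  qed auto
  also have "\<dots> = (\<integral>y. std_normal_density y * indicator {..- m / \<sigma>} y \<partial>lborel)"
    using assms
    by (subst lborel_integral_real_affine[where c = \<sigma> and t = m])
       (auto simp: normal_density_def real_sqrt_mult field_simps split: split_indicator
          intro!: Bochner_Integration.integral_cong)
  finally show ?thesis by (simp add: Phi_eq)
qed

text \<open>The Bachelier--Levy formula: for \<open>x > 0\<close>, the probability that Brownian motion with drift \<open>\<mu>\<close>
  started at \<open>x\<close> reaches \<open>0\<close> before time \<open>s\<close>.\<close>

definition hit_prob :: "real \<Rightarrow> real \<Rightarrow> real \<Rightarrow> real" where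
  "hit_prob \<mu> x s = Phi (- (x + \<mu> * s) / sqrt s) + exp (- 2 * \<mu> * x) * Phi ((\<mu> * s - x) / sqrt s)"

text \<open>The inverse Gaussian density of the first passage from \<open>x\<close> to 0 under drift
  \<open>\<mu>\<close>.\<close>

definition hit_density :: "real \<Rightarrow> real \<Rightarrow> real \<Rightarrow> real" where
  "hit_density \<mu> x s = x / (s * sqrt (2 * pi * s)) * exp (- (x + \<mu> * s)\<^sup>2 / (2 * s))"

lemma Phi_measurable [measurable]: "Phi \<in> borel_measurable borel"
  by (intro borel_measurable_continuous_onI continuous_at_imp_continuous_on ballI DERIV_isCont[OF Phi_deriv])

lemma Phi_nonneg: "0 \<le> Phi z"
  by (simp add: cdf_def)

lemma hit_prob_measurable [measurable]: "(\<lambda>x. hit_prob \<mu> x s) \<in> borel_measurable borel"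
  unfolding hit_prob_def by measurable

lemma hit_prob_nonneg: "0 \<le> hit_prob \<mu> x s"
  by (simp add: hit_prob_def Phi_nonneg)

text \<open>The positive half-line contributes 1 minus a normal tail. On the negative one the weight
  tilts the Gaussian of mean \<open>x + \<mu> * s\<close> into the one of mean
  \<open>x - \<mu> * s\<close>, which gives the second tail of \<open>hit_prob\<close>.\<close>

lemma gauss_op_mirror:
  assumes "0 < s"
  shows "gauss_op (mirror \<mu>) \<mu> s x = 1 - hit_prob \<mu> x s"
proof -
  let ?d = "normal_density (x + \<mu> * s) (sqrt s)"
  let ?e = "normal_density (x - \<mu> * s) (sqrt s)"
  have int: "integrable lborel (\<lambda>y. normal_density m (sqrt s) y * indicator {..<0} y)" for m
    using assms integrable_mult_indicator[of "{..<0}" lborel "normal_density m (sqrt s)"]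
    by (simp add: mult.commute)
  have refl: "?d y * exp (- 2 * \<mu> * y) = exp (- 2 * \<mu> * x) * ?e y" for y
    using normal_density_mult_exp[of "sqrt s" "x + \<mu> * s" y "- 2 * \<mu>"] assms
    by (simp add: algebra_simps power2_eq_square)
  have "gauss_op (mirror \<mu>) \<mu> s x = (\<integral>y. ?d y - ?d y * indicator {..<0} y
      - exp (- 2 * \<mu> * x) * (?e y * indicator {..<0} y) \<partial>lborel)"
    unfolding gauss_op_def
  proof (rule integral_cong_AE)
    show "AE y in lborel. ?d y * mirror \<mu> y = ?d y - ?d y * indicator {..<0} y
      - exp (- 2 * \<mu> * x) * (?e y * indicator {..<0} y)"
      using AE_lborel_singleton[of "0 :: real"]
    proof eventually_elim
      case (elim y)
      then show ?case using refl[of y] by (auto simp: mirror_def split: split_indicator)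
    qed
  qed auto
  also have "\<dots> = 1 - Phi (- (x + \<mu> * s) / sqrt s) - exp (- 2 * \<mu> * x) * Phi (- (x - \<mu> * s) / sqrt s)"
    using assms int
    by (subst Bochner_Integration.integral_diff Bochner_Integration.integral_diff;
        simp add: normal_density_integral_neg)
  finally show ?thesis by (simp add: hit_prob_def)
qed

text \<open>The factor \<open>exp (- 2 * \<mu> * x)\<close> makes the two normal densities equal,
  and the drift terms of the two inner derivatives cancel, leaving \<open>x\<close> in
  front.\<close>

lemma hit_prob_deriv:
  assumes "0 < s"
  shows "(hit_prob \<mu> x has_real_derivative hit_density \<mu> x s) (at s)"
proof -
  define q where "q = sqrt s"
  have q: "0 < q" "s = q * q" using assms by (auto simp: q_def)
  let ?u = "- (x + \<mu> * s) / sqrt s" and ?v = "(\<mu> * s - x) / sqrt s"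
  have sqrt: "(sqrt has_real_derivative inverse q / 2) (at s)"
    unfolding q_def using assms by (rule DERIV_real_sqrt)
  have "((\<lambda>s. - (x + \<mu> * s) / sqrt s) has_real_derivative
      (- \<mu> * q - - (x + \<mu> * s) * (inverse q / 2)) / (q * q)) (at s)"
    unfolding q_def
    by (rule DERIV_divide) (use assms sqrt in \<open>auto intro!: derivative_eq_intros simp: q_def\<close>)
  moreover have "(- \<mu> * q - - (x + \<mu> * s) * (inverse q / 2)) / (q * q) = (x - \<mu> * s) / (2 * s * q)"
    unfolding q(2) using q(1) by (simp add: field_simps)
  ultimately have du: "((\<lambda>s. - (x + \<mu> * s) / sqrt s) has_real_derivative (x - \<mu> * s) / (2 * s * q)) (at s)"
    by simp
  have "((\<lambda>s. (\<mu> * s - x) / sqrt s) has_real_derivative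
      (\<mu> * q - (\<mu> * s - x) * (inverse q / 2)) / (q * q)) (at s)"
    unfolding q_def
    by (rule DERIV_divide) (use assms sqrt in \<open>auto intro!: derivative_eq_intros simp: q_def\<close>)
  moreover have "(\<mu> * q - (\<mu> * s - x) * (inverse q / 2)) / (q * q) = (x + \<mu> * s) / (2 * s * q)"
    unfolding q(2) using q(1) by (simp add: field_simps)
  ultimately have dv: "((\<lambda>s. (\<mu> * s - x) / sqrt s) has_real_derivative (x + \<mu> * s) / (2 * s * q)) (at s)"
    by simp
  have D: "(hit_prob \<mu> x has_real_derivative
      std_normal_density ?u * ((x - \<mu> * s) / (2 * s * q)) +
      exp (- 2 * \<mu> * x) * (std_normal_density ?v * ((x + \<mu> * s) / (2 * s * q)))) (at s)"
    unfolding hit_prob_def[abs_def]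
    by (intro DERIV_add DERIV_cmult DERIV_chain2[where f = Phi, OF Phi_deriv] du dv)
  have u: "std_normal_density ?u = exp (- (x + \<mu> * s)\<^sup>2 / (2 * s)) / sqrt (2 * pi)"
  proof -
    have "(- x - \<mu> * s)\<^sup>2 = (x + \<mu> * s)\<^sup>2" by (simp add: power2_eq_square algebra_simps)
    then show ?thesis using assms by (simp add: normal_density_def power_divide mult.commute)
  qed
  have "exp (- 2 * \<mu> * x) * std_normal_density ?v = exp (- 2 * \<mu> * x + - (\<mu> * s - x)\<^sup>2 / (2 * s)) / sqrt (2 * pi)"
    unfolding exp_add using assms by (simp add: normal_density_def power_divide)
  also have "- 2 * \<mu> * x + - (\<mu> * s - x)\<^sup>2 / (2 * s) = - (x + \<mu> * s)\<^sup>2 / (2 * s)"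
    using assms by (simp add: field_simps) (simp add: power2_eq_square algebra_simps)
  finally have v: "exp (- 2 * \<mu> * x) * std_normal_density ?v = exp (- (x + \<mu> * s)\<^sup>2 / (2 * s)) / sqrt (2 * pi)" .
  have "E / c * ((x - \<mu> * s) / (2 * s * q)) + E / c * ((x + \<mu> * s) / (2 * s * q)) = x / (s * (c * q)) * E"
    if "0 < c" for E c
    using that assms q(1) by (simp add: field_simps)
  from this[of "sqrt (2 * pi)"] D show ?thesis
    unfolding mult.assoc[symmetric] u v
    by (simp add: hit_density_def real_sqrt_mult q_def mult.assoc)
qed

lemma hit_prob_tendsto_0:
  assumes "0 < x"
  shows "(hit_prob \<mu> x \<longlongrightarrow> 0) (at_right 0)"
proof -
  interpret real_distribution std_normal_distribution by (rule real_dist_normal_dist)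
  have "filterlim (\<lambda>s. - (x + \<mu> * s) / sqrt s) at_bot (at_right 0)"
    "filterlim (\<lambda>s. (\<mu> * s - x) / sqrt s) at_bot (at_right 0)"
    using assms by real_asymp+
  note this[THEN filterlim_compose[OF cdf_lim_at_bot]]
  from tendsto_add[OF this(1) tendsto_mult[OF tendsto_const this(2)]]
  show ?thesis unfolding hit_prob_def[abs_def] by simp
qed

lemma hit_density_nn_integral:
  assumes "0 < x" "0 < s"
  shows "(\<integral>\<^sup>+ r. ennreal (hit_density \<mu> x r) * indicator {0<..<s} r \<partial>lborel) = ennreal (hit_prob \<mu> x s)"
proof -
  have cont: "isCont (hit_density \<mu> x) r" if "0 < r" for r
    unfolding hit_density_def[abs_def] using that by (intro continuous_intros) auto
  have nn: "0 \<le> hit_density \<mu> x r" if "0 < r" for r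
    unfolding hit_density_def using that assms by auto
  have A: "((hit_prob \<mu> x \<circ> real_of_ereal) \<longlongrightarrow> 0) (at_right (ereal 0))"
    using hit_prob_tendsto_0[OF assms(1)] by (simp only: ereal_tendsto_simps)
  have "isCont (hit_prob \<mu> x) s"
    by (rule DERIV_isCont[OF hit_prob_deriv[OF assms(2)]])
  then have B: "((hit_prob \<mu> x \<circ> real_of_ereal) \<longlongrightarrow> hit_prob \<mu> x s) (at_left (ereal s))"
    by (simp add: ereal_tendsto_simps isCont_def filterlim_at_split)
  note FTC = interval_integral_FTC_nonneg[OF _ _ _ _ A B, of "hit_density \<mu> x"]
  have e: "einterval (ereal 0) (ereal s) = {0<..<s}" by (auto simp: einterval_def)
  have int: "set_integrable lborel {0<..<s} (hit_density \<mu> x)"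
    using FTC(1) hit_prob_deriv cont nn assms unfolding e by simp
  have val: "(LBINT r:{0<..<s}. hit_density \<mu> x r) = hit_prob \<mu> x s"
    using FTC(2) hit_prob_deriv cont nn assms unfolding interval_lebesgue_integral_def e by simp
  have "(\<integral>\<^sup>+ r. ennreal (hit_density \<mu> x r) * indicator {0<..<s} r \<partial>lborel) =
      (\<integral>\<^sup>+ r. ennreal (indicator {0<..<s} r *\<^sub>R hit_density \<mu> x r) \<partial>lborel)"
    by (intro nn_integral_cong) (auto split: split_indicator)
  also have "\<dots> = ennreal (LBINT r:{0<..<s}. hit_density \<mu> x r)"
    unfolding set_lebesgue_integral_def
    by (rule nn_integral_eq_integral)
       (use int nn in \<open>auto simp: set_integrable_def split: split_indicator\<close>)
  finally show ?thesis by (simp add: val)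
qed

text \<open>In the product of the two Gaussian exponentials the terms linear in \<open>x\<close>
  cancel. The drift survives only in \<open>exp (- (\<mu>\<^sup>2 * (a + r) / 2))\<close>, and the
  integral of \<open>x * exp (- (q * x\<^sup>2 / 2))\<close> over the half-line is
  \<open>1 / q\<close>.\<close>

lemma hit_density_gaussian_nn_integral:
  assumes "0 < a" "0 < r"
  shows "(\<integral>\<^sup>+ x. ennreal (normal_density (\<mu> * a) (sqrt a) x * hit_density \<mu> x r) * indicator {0<..} x \<partial>lborel) =
    ennreal (passage_density \<mu> a (a + r) / 2)"
proof -
  define q where "q = 1 / a + 1 / r"
  define C where "C = exp (- (\<mu>\<^sup>2 * (a + r) / 2)) / (sqrt (2 * pi * a) * (r * sqrt (2 * pi * r)))"
  have q: "0 < q" and C: "0 < C" using assms by (auto simp: q_def C_def intro!: divide_pos_pos mult_pos_pos add_pos_pos)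
  have prod: "normal_density (\<mu> * a) (sqrt a) x * hit_density \<mu> x r = C * (x * exp (- (q * x\<^sup>2 / 2)))" for x
  proof -
    have "- (x - \<mu> * a)\<^sup>2 / (2 * a) + - (x + \<mu> * r)\<^sup>2 / (2 * r) = - (\<mu>\<^sup>2 * (a + r) / 2) + - (q * x\<^sup>2 / 2)"
      using assms by (simp add: q_def field_simps) (simp add: power2_eq_square algebra_simps)
    then have "exp (- (x - \<mu> * a)\<^sup>2 / (2 * a)) * exp (- (x + \<mu> * r)\<^sup>2 / (2 * r)) =
        exp (- (\<mu>\<^sup>2 * (a + r) / 2)) * exp (- (q * x\<^sup>2 / 2))"
      by (simp only: exp_add[symmetric])
    moreover have "(1 / p * E) * (x / (r * p') * E') = (E * E') * (x / (p * (r * p')))" for p E p' E' :: real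
      by simp
    ultimately show ?thesis
      using assms by (simp add: normal_density_def hit_density_def C_def)
  qed
  let ?F = "\<lambda>x. - (C / q) * exp (- (q * x\<^sup>2 / 2))"
  have "(\<integral>\<^sup>+ x. ennreal (normal_density (\<mu> * a) (sqrt a) x * hit_density \<mu> x r) * indicator {0<..} x \<partial>lborel) =
      (\<integral>\<^sup>+ x. ennreal (C * (x * exp (- (q * x\<^sup>2 / 2)))) * indicator {0..} x \<partial>lborel)"
    unfolding prod by (intro nn_integral_cong) (auto split: split_indicator)
  also have "\<dots> = ennreal (0 - ?F 0)"
  proof (rule nn_integral_FTC_atLeast)
    show "(?F has_real_derivative C * (x * exp (- (q * x\<^sup>2 / 2)))) (at x)" for x
      using q by (auto intro!: derivative_eq_intros)
    show "(?F \<longlongrightarrow> 0) at_top" using q by real_asymp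
  qed (use C in auto)
  also have "0 - ?F 0 = passage_density \<mu> a (a + r) / 2"
  proof -
    have "E / (s2 * A * (r * (s2 * R))) / (1 / a + 1 / r) = E * (A / (pi * (a + r) * R)) / 2"
      if "A * A = a" "R * R = r" "s2 * s2 = 2 * pi" "0 < A" "0 < R" "0 < s2" for E A R s2
    proof -
      have "1 / a + 1 / r = (a + r) / (a * r)" using assms by (simp add: field_simps)
      then have "E / (s2 * A * (r * (s2 * R))) / (1 / a + 1 / r) = E * (a * r) / ((s2 * s2) * A * r * R * (a + r))"
        using assms by simp
      also have "\<dots> = E * ((A * A) * r) / ((2 * pi) * A * r * R * (a + r))"
        unfolding that(1,3) ..
      also have "\<dots> = E * (A / (pi * (a + r) * R)) / 2"
        using that(4,5) assms by simp
      finally show ?thesis .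
    qed
    note * = this
    have sqrt2pi: "sqrt (2 * pi) * sqrt (2 * pi) = 2 * pi" by simp
    from *[of "sqrt a" "sqrt r" "sqrt (2 * pi)" "exp (- (\<mu>\<^sup>2 * (a + r) / 2))",
        OF _ _ sqrt2pi] assms
    show ?thesis by (simp add: C_def q_def passage_density_def real_sqrt_mult)
  qed
  finally show ?thesis .
qed

text \<open>Write \<open>hit_prob\<close> as the time integral of \<open>hit_density\<close>,
  exchange the integrals and average over the position at time \<open>a\<close>. Positive positions
  alone give exactly half of \<open>passage_cdf\<close>, whatever the drift.\<close>

lemma hit_prob_gaussian_nn_integral:
  assumes "0 < a" "0 < s"
  shows "(\<integral>\<^sup>+ x. ennreal (normal_density (\<mu> * a) (sqrt a) x * (indicator {0<..} x * hit_prob \<mu> x s)) \<partial>lborel) =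
    ennreal (passage_cdf \<mu> a (a + s) / 2)"
proof -
  let ?d = "normal_density (\<mu> * a) (sqrt a)"
  have [measurable]: "(\<lambda>(x, r). hit_density \<mu> x r) \<in> borel_measurable (borel \<Otimes>\<^sub>M borel)"
    unfolding hit_density_def by measurable
  have [measurable]: "hit_density \<mu> x \<in> borel_measurable borel" for x
    unfolding hit_density_def by measurable
  have nn: "0 \<le> passage_density \<mu> a w" if "a < w" for w
    unfolding passage_density_def using that assms by auto
  have [measurable]: "passage_density \<mu> a \<in> borel_measurable borel"
    unfolding passage_density_def by measurable
  have "(\<integral>\<^sup>+ x. ennreal (?d x * (indicator {0<..} x * hit_prob \<mu> x s)) \<partial>lborel) =
      (\<integral>\<^sup>+ x. \<integral>\<^sup>+ r. ennreal (?d x * hit_density \<mu> x r) * indicator {0<..} x * indicator {0<..<s} r \<partial>lborel \<partial>lborel)"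
  proof (rule nn_integral_cong)
    fix x :: real
    show "ennreal (?d x * (indicator {0<..} x * hit_prob \<mu> x s)) =
      (\<integral>\<^sup>+ r. ennreal (?d x * hit_density \<mu> x r) * indicator {0<..} x * indicator {0<..<s} r \<partial>lborel)"
    proof (cases "0 < x")
      case True
      have "(\<integral>\<^sup>+ r. ennreal (?d x * hit_density \<mu> x r) * indicator {0<..} x * indicator {0<..<s} r \<partial>lborel) =
          (\<integral>\<^sup>+ r. ennreal (?d x) * (ennreal (hit_density \<mu> x r) * indicator {0<..<s} r) \<partial>lborel)"
        using True by (intro nn_integral_cong) (auto simp: ennreal_mult' split: split_indicator)
      also have "\<dots> = ennreal (?d x) * ennreal (hit_prob \<mu> x s)"
        by (subst nn_integral_cmult) (auto simp: hit_density_nn_integral[OF True assms(2)])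
      finally show ?thesis using True by (simp add: ennreal_mult')
    qed simp
  qed
  also have "\<dots> = (\<integral>\<^sup>+ r. \<integral>\<^sup>+ x. ennreal (?d x * hit_density \<mu> x r) * indicator {0<..} x * indicator {0<..<s} r \<partial>lborel \<partial>lborel)"
    by (rule lborel_pair.Fubini'[symmetric]) measurable
  also have "\<dots> = (\<integral>\<^sup>+ r. ennreal (passage_density \<mu> a (a + r) / 2) * indicator {0<..<s} r \<partial>lborel)"
  proof (rule nn_integral_cong)
    fix r :: real
    have "(\<integral>\<^sup>+ x. ennreal (?d x * hit_density \<mu> x r) * indicator {0<..} x * indicator {0<..<s} r \<partial>lborel) =
        (\<integral>\<^sup>+ x. ennreal (?d x * hit_density \<mu> x r) * indicator {0<..} x \<partial>lborel) * indicator {0<..<s} r"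
      by (rule nn_integral_multc) (auto simp: hit_density_def)
    then show "(\<integral>\<^sup>+ x. ennreal (?d x * hit_density \<mu> x r) * indicator {0<..} x * indicator {0<..<s} r \<partial>lborel) =
        ennreal (passage_density \<mu> a (a + r) / 2) * indicator {0<..<s} r"
      using hit_density_gaussian_nn_integral[OF assms(1), of r \<mu>] by (auto split: split_indicator)
  qed
  also have "\<dots> = (\<integral>\<^sup>+ w. ennreal (passage_density \<mu> a w / 2) * indicator {a<..<a + s} w \<partial>lborel)"
    by (subst nn_integral_real_affine[where c = 1 and t = a])
       (auto intro!: nn_integral_cong split: split_indicator)
  also have "\<dots> = (\<integral>\<^sup>+ w. ennreal (1 / 2) * (ennreal (passage_density \<mu> a w) * indicator {a<..<a + s} w) \<partial>lborel)"
  proof (rule nn_integral_cong)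
    fix w
    show "ennreal (passage_density \<mu> a w / 2) * indicator {a<..<a + s} w =
        ennreal (1 / 2) * (ennreal (passage_density \<mu> a w) * indicator {a<..<a + s} w)"
      using nn[of w] ennreal_mult'[of "1 / 2" "passage_density \<mu> a w"] by (simp split: split_indicator)
  qed
  also have "\<dots> = ennreal (1 / 2) * ennreal (passage_cdf \<mu> a (a + s))"
    by (subst nn_integral_cmult) (use assms in \<open>auto simp: passage_density_nn_integral\<close>)
  also have "\<dots> = ennreal (passage_cdf \<mu> a (a + s) / 2)"
    using ennreal_mult'[of "1 / 2" "passage_cdf \<mu> a (a + s)"] by simp
  finally show ?thesis .
qed

section \<open>From survival to the laws of the first and last zeros\<close>

lemma passage_cdf_uminus [simp]: "passage_cdf (- \<mu>) = passage_cdf \<mu>"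
  by (simp add: passage_cdf_def fun_eq_iff)

lemma passage_cdf_continuous:
  assumes "0 < a" "a < t"
  shows "isCont (passage_cdf \<mu> a) t"
  by (rule DERIV_isCont[OF passage_cdf_deriv[OF assms]])

text \<open>As the initial time tends to 0, the arc fills [0, pi/2] and the exponents vanish, so a
  zero up to time \<open>t\<close> becomes certain. The times \<open>t / real (Suc (Suc n))\<close>
  stay strictly between 0 and \<open>t\<close>.\<close>

lemma passage_cdf_tendsto_1:
  assumes "0 < t"
  shows "(\<lambda>n. passage_cdf \<mu> (t / real (Suc (Suc n))) t) \<longlonglongrightarrow> 1"
proof -
  define w where "w n = t / real (Suc (Suc n))" for n
  define b where "b n = arccos (sqrt (w n / t))" for n
  have w: "w \<longlonglongrightarrow> 0" unfolding w_def by real_asymp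
  have ratio: "w n / t = 1 / real (Suc (Suc n))" for n using assms by (simp add: w_def)
  have "(\<lambda>n. sqrt (w n / t)) \<longlonglongrightarrow> 0" unfolding ratio by real_asymp
  then have "(\<lambda>n. arccos (sqrt (w n / t))) \<longlonglongrightarrow> arccos 0"
    by (rule isCont_tendsto_compose[OF isCont_arccos, rotated 2]) auto
  then have b: "b \<longlonglongrightarrow> pi / 2" by (simp add: b_def[abs_def])
  have b_le: "b n \<le> pi / 2" for n
    unfolding b_def by (rule arccos_le_pi2) (auto simp: ratio)
  let ?h = "\<lambda>n \<theta>. exp (- (\<mu>\<^sup>2 * w n / 2) * (tan \<theta>)\<^sup>2)"
  have [measurable]: "(tan :: real \<Rightarrow> real) \<in> borel_measurable borel"
    unfolding tan_def[abs_def] by measurable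
  have "(\<lambda>n. \<integral>\<theta>. indicator {0..b n} \<theta> *\<^sub>R ?h n \<theta> \<partial>lborel) \<longlonglongrightarrow> (\<integral>\<theta>. indicator {0..pi/2} \<theta> \<partial>lborel)"
  proof (rule integral_dominated_convergence[where w = "indicator {0..pi/2}"])
    show "integrable lborel (indicator {0..pi/2} :: real \<Rightarrow> real)"
      by (rule integrable_real_indicator) auto
    show "AE \<theta> in lborel. norm (indicator {0..b n} \<theta> *\<^sub>R ?h n \<theta>) \<le> indicator {0..pi/2} \<theta>" for n
      using b_le[of n] assms by (intro AE_I2) (auto simp: w_def split: split_indicator)
    show "AE \<theta> in lborel. (\<lambda>n. indicator {0..b n} \<theta> *\<^sub>R ?h n \<theta>) \<longlonglongrightarrow> indicator {0..pi/2} \<theta>"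
      using AE_lborel_singleton[of "pi / 2"]
    proof eventually_elim
      case (elim \<theta>)
      show ?case
      proof (cases "0 \<le> \<theta> \<and> \<theta> < pi / 2")
        case True
        have "(\<lambda>n. ?h n \<theta>) \<longlonglongrightarrow> exp (- (\<mu>\<^sup>2 * 0 / 2) * (tan \<theta>)\<^sup>2)"
          by (intro tendsto_intros w) auto
        moreover have "\<forall>\<^sub>F n in sequentially. ?h n \<theta> = indicator {0..b n} \<theta> *\<^sub>R ?h n \<theta>"
          using order_tendstoD(1)[OF b, of \<theta>] True by (auto elim!: eventually_mono)
        ultimately show ?thesis using True by (auto intro: Lim_transform_eventually)
      next
        case False
        then have "indicator {0..b n} \<theta> = (0 :: real)" for n
          using b_le[of n] elim by (auto split: split_indicator)
        then show ?thesis using False elim by auto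
      qed
    qed
  qed auto
  then have "(\<lambda>n. LBINT \<theta>:{0..b n}. ?h n \<theta>) \<longlonglongrightarrow> pi / 2"
    by (simp add: set_lebesgue_integral_def)
  then have "(\<lambda>n. 2 / pi * exp (- (\<mu>\<^sup>2 * w n / 2)) * (LBINT \<theta>:{0..b n}. ?h n \<theta>)) \<longlonglongrightarrow>
      2 / pi * exp (- (\<mu>\<^sup>2 * 0 / 2)) * (pi / 2)"
    by (intro tendsto_intros w) auto
  then show ?thesis by (simp add: passage_cdf_def b_def w_def)
qed

text \<open>By the Markov property at \<open>a\<close> the survival integral becomes the mean of
  \<open>1 - hit_prob\<close> over the positive positions at time \<open>a\<close>, which the
  Gaussian average evaluates.\<close>

lemma (in brownian_motion) positive_probability:
  assumes at: "0 < a" "a < t"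
  shows "measure M {\<omega>\<in>space M. \<forall>s\<in>{a..t}. 0 < X 0 \<mu> s \<omega>} =
    measure M {\<omega>\<in>space M. 0 < X 0 \<mu> a \<omega>} - passage_cdf \<mu> a t / 2"
proof -
  let ?d = "normal_density (\<mu> * a) (sqrt a)"
  let ?g = "\<lambda>x. indicator {0<..} x * hit_prob \<mu> x (t - a)"
  have [measurable]: "X 0 \<mu> a \<in> borel_measurable M" "X 0 \<mu> t \<in> borel_measurable M"
    using at by (auto intro!: X_measurable)
  have dist: "distributed M lborel (X 0 \<mu> a) ?d"
    using X_distributed[OF at(1), of 0 \<mu>] by simp
  have dg: "integrable lborel (\<lambda>x. ?d x * ?g x)"
    by (rule integrableI_nn_integral_finite[where x = "passage_cdf \<mu> a t / 2"])
       (use hit_prob_gaussian_nn_integral[of a "t - a" \<mu>] passage_cdf_bounds[of a t \<mu>] at in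
         \<open>auto simp: hit_prob_nonneg\<close>)
  have dg_val: "(\<integral>x. ?d x * ?g x \<partial>lborel) = passage_cdf \<mu> a t / 2"
    by (subst integral_eq_nn_integral)
       (use hit_prob_gaussian_nn_integral[of a "t - a" \<mu>] passage_cdf_bounds[of a t \<mu>] at in
         \<open>auto simp: hit_prob_nonneg\<close>)
  have int: "integrable M (\<lambda>\<omega>. ?g (X 0 \<mu> a \<omega>))"
    using distributed_integrable[OF dist, of ?g] dg by simp
  have val: "(\<integral>\<omega>. ?g (X 0 \<mu> a \<omega>) \<partial>M) = passage_cdf \<mu> a t / 2"
    using distributed_integral[OF dist, of ?g] dg_val by simp
  have int_refl: "integrable M (\<lambda>\<omega>. mirror \<mu> (X 0 \<mu> t \<omega>))"
  proof (rule Bochner_Integration.integrable_bound)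
    show "integrable M (\<lambda>\<omega>. 1 + exp (- 2 * \<mu> * X 0 \<mu> t \<omega>))"
      using at by (intro Bochner_Integration.integrable_add X_exp_integrable) auto
    show "AE \<omega> in M. norm (mirror \<mu> (X 0 \<mu> t \<omega>)) \<le> norm (1 + exp (- 2 * \<mu> * X 0 \<mu> t \<omega>))"
      using mirror_bound by (intro AE_I2) (auto intro: order_trans[OF _ abs_ge_self])
  qed measurable
  define A where "A = {w \<in> space (PiM {..0::nat} (\<lambda>_. borel :: real measure)). 0 < w 0}"
  have A: "A \<in> sets (PiM {..0} (\<lambda>_. borel))"
    unfolding A_def by measurable
  have ind: "indicator A (\<lambda>i\<in>{..0}. X 0 \<mu> a \<omega>) * y = (if 0 < X 0 \<mu> a \<omega> then y else 0)" for \<omega> and y :: real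
    unfolding indicator_def by (simp add: A_def space_PiM)
  have "measure M {\<omega>\<in>space M. \<forall>s\<in>{a..t}. 0 < X 0 \<mu> s \<omega>} =
    (\<integral>\<omega>. (if 0 < X 0 \<mu> a \<omega> then gauss_op (mirror \<mu>) \<mu> (t - a) (X 0 \<mu> a \<omega>) else 0) \<partial>M)"
    unfolding survival_probability[OF at]
    using markov_property[where \<tau> = "\<lambda>_. a" and k = 0 and g = "mirror \<mu>", OF _ _ at(2) _ int_refl A] at(1)
    by (simp only: ind) simp
  also have "\<dots> = (\<integral>\<omega>. indicator {\<omega>\<in>space M. 0 < X 0 \<mu> a \<omega>} \<omega> - ?g (X 0 \<mu> a \<omega>) \<partial>M)"
    using at by (intro Bochner_Integration.integral_cong) (auto simp: gauss_op_mirror)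
  also have "\<dots> = measure M {\<omega>\<in>space M. 0 < X 0 \<mu> a \<omega>} - passage_cdf \<mu> a t / 2"
  proof (subst Bochner_Integration.integral_diff[OF _ int])
    show "integrable M (indicator {\<omega>\<in>space M. 0 < X 0 \<mu> a \<omega>} :: 'a \<Rightarrow> real)"
      by (rule integrable_const_bound[of _ 1]) auto
  qed (simp add: val)
  finally show ?thesis .
qed

lemma (in brownian_motion) brownian_motion_uminus: "brownian_motion M (\<lambda>s \<omega>. - B s \<omega>)"
proof
  have "distributed M lborel (\<lambda>\<omega>. - B t \<omega> - - B s \<omega>) (normal_density 0 (sqrt (t - s)))"
    if "0 \<le> s" "s < t" for s t
    using normal_density_affine[OF B_increment[OF that], of "- 1" 0] that by simp
  moreover have "indep_vars (\<lambda>_. borel) (\<lambda>i \<omega>. - B (\<tau> (Suc i)) \<omega> - - B (\<tau> i) \<omega>) {..<n}"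
    if "0 \<le> \<tau> 0" "\<forall>i<n. \<tau> i \<le> \<tau> (Suc i)" for n :: nat and \<tau>
    using indep_vars_compose2[OF B_indep[of \<tau> n], of "\<lambda>_ x. - x" "\<lambda>_. borel"] that by simp
  ultimately show "standard_brownian_motion M (\<lambda>s \<omega>. - B s \<omega>)"
    unfolding standard_brownian_motion_def
    using prob_space_axioms B_measurable B_0 B_continuous by (auto intro!: continuous_intros)
qed

context brownian_motion
begin

text \<open>A path without zeros on [a, t] keeps its sign. The negative case is the positive one for
  \<open>- B\<close> with drift \<open>- \<mu>\<close>, and \<open>passage_cdf\<close> depends only
  on the square of the drift, so two equal halves are subtracted.\<close>

lemma nonvanishing_probability:
  assumes at: "0 < a" "a < t"
  shows "measure M {\<omega>\<in>space M. \<forall>s\<in>{a..t}. X 0 \<mu> s \<omega> \<noteq> 0} = 1 - passage_cdf \<mu> a t"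
proof -
  interpret neg: brownian_motion M "\<lambda>s \<omega>. - B s \<omega>" by (rule brownian_motion_uminus)
  have neg_X: "neg.X 0 (- \<mu>) s \<omega> = - X 0 \<mu> s \<omega>" for s \<omega>
    by (simp add: X_def neg.X_def)
  have [measurable]: "X 0 \<mu> a \<in> borel_measurable M" using at by (auto intro!: X_measurable)
  let ?P = "{\<omega>\<in>space M. \<forall>s\<in>{a..t}. 0 < X 0 \<mu> s \<omega>}" and ?N = "{\<omega>\<in>space M. \<forall>s\<in>{a..t}. X 0 \<mu> s \<omega> < 0}"
  let ?p = "{\<omega>\<in>space M. 0 < X 0 \<mu> a \<omega>}" and ?n = "{\<omega>\<in>space M. X 0 \<mu> a \<omega> < 0}"
  have P: "?P \<in> sets M" and N: "?N \<in> sets M"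
    using positive_on_sets[of a t 0 \<mu>] neg.positive_on_sets[of a t 0 "- \<mu>"] at by (simp_all add: neg_X)
  have "{\<omega>\<in>space M. \<forall>s\<in>{a..t}. X 0 \<mu> s \<omega> \<noteq> 0} = ?P \<union> ?N"
  proof (intro equalityI subsetI)
    fix \<omega> assume *: "\<omega> \<in> {\<omega>\<in>space M. \<forall>s\<in>{a..t}. X 0 \<mu> s \<omega> \<noteq> 0}"
    then have "X 0 \<mu> a \<omega> \<noteq> 0" using at by auto
    then have "0 < X 0 \<mu> a \<omega> \<or> 0 < neg.X 0 (- \<mu>) a \<omega>" using at by (auto simp: neg_X)
    then show "\<omega> \<in> ?P \<union> ?N"
      using * positive_on_iff[of a t \<omega> 0 \<mu>] neg.positive_on_iff[of a t \<omega> 0 "- \<mu>"] at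
      by (auto simp: neg_X)
  qed (use at in force)
  moreover have "?P \<inter> ?N = {}" using at by force
  ultimately have "measure M {\<omega>\<in>space M. \<forall>s\<in>{a..t}. X 0 \<mu> s \<omega> \<noteq> 0} = measure M ?P + measure M ?N"
    by (simp add: finite_measure_Union P N)
  also have "\<dots> = (measure M ?p + measure M ?n) - passage_cdf \<mu> a t"
    using positive_probability[OF at, of \<mu>] neg.positive_probability[OF at, of "- \<mu>"]
    by (simp add: neg_X)
  also have "measure M ?p + measure M ?n = measure M (?p \<union> ?n)"
    by (intro finite_measure_Union[symmetric]) auto
  also have "\<dots> = 1"
  proof (subst prob_eq_1)
    show "AE \<omega> in M. \<omega> \<in> ?p \<union> ?n"
      using X_AE_nonzero[OF at(1), of 0 \<mu>] AE_space by eventually_elim auto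
  qed measurable
  finally show ?thesis .
qed

lemma first_zero_X_measurable [measurable]:
  "0 \<le> q \<Longrightarrow> first_zero (X c \<mu>) q t \<in> borel_measurable M"
  by (rule first_zero_measurable[OF X_measurable X_continuous])

lemma last_zero_X_measurable [measurable]:
  "0 < t \<Longrightarrow> last_zero (X 0 \<mu>) t \<in> borel_measurable M"
  by (rule last_zero_measurable[OF X_measurable X_continuous]) (auto simp: X_def B_0)

lemma first_zero_le_probability:
  assumes "0 < a" "a < t" "a \<le> w" "w < t"
  shows "measure M {\<omega>\<in>space M. first_zero (X 0 \<mu>) a t \<omega> \<le> w} = passage_cdf \<mu> a w"
proof -
  have [measurable]: "first_zero (X 0 \<mu>) a t \<in> borel_measurable M" "X 0 \<mu> a \<in> borel_measurable M"
    using assms by (auto intro!: X_measurable)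
  have "{\<omega>\<in>space M. w < first_zero (X 0 \<mu>) a t \<omega>} = {\<omega>\<in>space M. \<forall>s\<in>{a..w}. X 0 \<mu> s \<omega> \<noteq> 0}"
    by (intro Collect_cong conj_cong refl less_first_zero_iff X_continuous) (use assms in auto)
  also have "measure M \<dots> = 1 - passage_cdf \<mu> a w"
  proof (cases "a = w")
    case True
    have "measure M {\<omega>\<in>space M. X 0 \<mu> a \<omega> \<noteq> 0} = 1"
      by (subst prob_Collect_eq_1) (use X_AE_nonzero[OF assms(1)] in auto)
    then show ?thesis using True assms by (simp add: passage_cdf_start)
  next
    case False
    then show ?thesis using assms by (intro nonvanishing_probability) auto
  qed
  finally have "measure M {\<omega>\<in>space M. w < first_zero (X 0 \<mu>) a t \<omega>} = 1 - passage_cdf \<mu> a w" .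
  moreover have "{\<omega>\<in>space M. \<not> w < first_zero (X 0 \<mu>) a t \<omega>} = {\<omega>\<in>space M. first_zero (X 0 \<mu>) a t \<omega> \<le> w}"
    by auto
  ultimately show ?thesis
    using prob_neg[of "\<lambda>\<omega>. w < first_zero (X 0 \<mu>) a t \<omega>"] by simp
qed

lemma first_zero_cdf:
  assumes "0 < a" "a < t"
  shows "cdf (distr M borel (first_zero (X 0 \<mu>) a t)) w =
    measure M {\<omega>\<in>space M. first_zero (X 0 \<mu>) a t \<omega> \<le> w}"
  unfolding cdf_def using assms
  by (subst measure_distr) (auto intro!: arg_cong[where f = "measure M"])

text \<open>The law of \<open>first_zero\<close> has an atom at \<open>t\<close>, which the left
  limit of its distribution function leaves out.\<close>

lemma first_zero_less_probability:
  assumes "0 < a" "a < t"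
  shows "measure (distr M borel (first_zero (X 0 \<mu>) a t)) {..<t} = passage_cdf \<mu> a t"
proof -
  interpret D: real_distribution "distr M borel (first_zero (X 0 \<mu>) a t)"
    using assms by (intro real_distribution_distr) auto
  let ?F = "cdf (distr M borel (first_zero (X 0 \<mu>) a t))"
  have "(passage_cdf \<mu> a \<longlongrightarrow> passage_cdf \<mu> a t) (at_left t)"
    using passage_cdf_continuous[OF assms] by (simp add: isCont_def filterlim_at_split)
  moreover have "\<forall>\<^sub>F w in at_left t. passage_cdf \<mu> a w = ?F w"
    using eventually_at_left_real[OF assms(2)]
    by eventually_elim (use assms in \<open>simp add: first_zero_cdf first_zero_le_probability\<close>)
  ultimately have "(?F \<longlongrightarrow> passage_cdf \<mu> a t) (at_left t)"
    by (rule Lim_transform_eventually)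
  then show ?thesis
    using tendsto_unique[OF _ D.cdf_at_left] by auto
qed

text \<open>The indicator removes the atom at \<open>t\<close>. What remains is no longer a
  probability measure, so the comparison of distribution functions is made for finite Borel
  measures.\<close>

lemma first_zero_distr:
  assumes "0 < a" "a < t"
  shows "density (distr M borel (first_zero (X 0 \<mu>) a t)) (indicator {..<t}) =
    density lborel (\<lambda>w. ennreal (passage_density \<mu> a w) * indicator {a<..<t} w)" (is "?L = ?R")
proof (rule cdf_unique')
  let ?\<nu> = "distr M borel (first_zero (X 0 \<mu>) a t)"
  interpret D: real_distribution ?\<nu>
    using assms by (intro real_distribution_distr) auto
  have [measurable]: "passage_density \<mu> a \<in> borel_measurable borel"
    unfolding passage_density_def by measurable
  have L: "emeasure ?L A = emeasure ?\<nu> (A \<inter> {..<t})" if "A \<in> sets borel" for A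
    using that by (subst emeasure_density) (auto simp: nn_integral_indicator[symmetric] indicator_inter_arith mult.commute
        simp del: nn_integral_indicator)
  have R: "emeasure ?R {..w} = (if w \<le> a then 0 else ennreal (passage_cdf \<mu> a (min w t)))" for w
  proof -
    have "emeasure ?R {..w} = (\<integral>\<^sup>+ x. ennreal (passage_density \<mu> a x) * indicator {a<..<t} x * indicator {..w} x \<partial>lborel)"
      by (rule emeasure_density) auto
    also have "\<dots> = (\<integral>\<^sup>+ x. ennreal (passage_density \<mu> a x) * indicator {a<..<min w t} x \<partial>lborel)"
    proof (rule nn_integral_cong_AE)
      show "AE x in lborel. ennreal (passage_density \<mu> a x) * indicator {a<..<t} x * indicator {..w} x =
          ennreal (passage_density \<mu> a x) * indicator {a<..<min w t} x"
        using AE_lborel_singleton[of w] by eventually_elim (auto split: split_indicator)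
    qed
    also have "\<dots> = (if w \<le> a then 0 else ennreal (passage_cdf \<mu> a (min w t)))"
      using passage_density_nn_integral[of a "min w t" \<mu>] assms by auto
    finally show ?thesis .
  qed
  have R_UNIV: "emeasure ?R UNIV = ennreal (passage_cdf \<mu> a t)"
    using passage_density_nn_integral[OF assms, of \<mu>] by (subst emeasure_density) auto
  show "finite_borel_measure ?L"
  proof (intro finite_borel_measure.intro finite_borel_measure_axioms.intro finite_measureI)
    have "emeasure ?L UNIV = emeasure ?\<nu> {..<t}" by (subst L) simp_all
    then show "emeasure ?L (space ?L) \<noteq> \<infinity>" using D.emeasure_finite[of "{..<t}"] by (simp only: space_density space_distr space_borel) simp
    show "sets ?L = sets borel" by simp
  qed
  show "finite_borel_measure ?R"
  proof (intro finite_borel_measure.intro finite_borel_measure_axioms.intro finite_measureI)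
    show "emeasure ?R (space ?R) \<noteq> \<infinity>" using R_UNIV by (simp only: space_density space_lborel) simp
    show "sets ?R = sets borel" by simp
  qed
  show "cdf ?L = cdf ?R"
  proof
    fix w
    have meas_L: "measure ?L {..w} = measure ?\<nu> ({..w} \<inter> {..<t})"
      by (simp add: measure_def L)
    have meas_R: "measure ?R {..w} = (if w \<le> a then 0 else passage_cdf \<mu> a (min w t))"
      using passage_cdf_bounds(1)[of a "min w t" \<mu>] assms by (simp add: measure_def R)
    show "cdf ?L w = cdf ?R w"
    proof (cases "w < t")
      case True
      then have "{..w} \<inter> {..<t} = {..w}" by auto
      then have *: "cdf ?L w = measure M {\<omega>\<in>space M. first_zero (X 0 \<mu>) a t \<omega> \<le> w}"
        using first_zero_cdf[OF assms, of \<mu> w] by (simp add: cdf_def meas_L)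
      show ?thesis
      proof (cases "a \<le> w")
        case True
        then show ?thesis using * \<open>w < t\<close> assms
          by (auto simp: cdf_def meas_R first_zero_le_probability passage_cdf_start)
      next
        case False
        then have "w < first_zero (X 0 \<mu>) a t \<omega>" if "\<omega> \<in> space M" for \<omega>
          by (subst less_first_zero_iff) (use assms \<open>w < t\<close> X_continuous[OF that] in auto)
        then have empty: "{\<omega>\<in>space M. first_zero (X 0 \<mu>) a t \<omega> \<le> w} = {}"
          by force
        show ?thesis using False unfolding * empty by (simp add: cdf_def meas_R)
      qed
    next
      case False
      then have "{..w} \<inter> {..<t} = {..<t}" by auto
      then show ?thesis using False assms
        by (simp add: cdf_def meas_L meas_R first_zero_less_probability min_def)
    qed
  qed
qed

end

text \<open>A zero at \<open>w\<close> is allowed on the left but, if \<open>w < v\<close>, not on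
  the right; hence the assumption \<open>X w \<omega> \<noteq> 0\<close>, which holds almost surely
  for a fixed \<open>w > 0\<close>.\<close>

lemma last_zero_le_iff:
  fixes X :: "real \<Rightarrow> 'a \<Rightarrow> real"
  assumes "X 0 \<omega> = 0" "0 < v" "v \<le> t" "0 \<le> w" "X w \<omega> \<noteq> 0"
  shows "last_zero X v \<omega> \<le> w \<longleftrightarrow> v \<le> first_zero X w t \<omega>"
proof -
  let ?Z = "{s. 0 \<le> s \<and> s < v \<and> X s \<omega> = 0}"
  have ne: "?Z \<noteq> {}" using assms by auto
  have bdd: "bdd_above ?Z" by (rule bdd_aboveI[of _ v]) auto
  have "last_zero X v \<omega> \<le> w \<longleftrightarrow> (\<forall>s\<in>?Z. s \<le> w)"
    unfolding last_zero_def by (rule cSup_le_iff[OF ne bdd])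
  also have "\<dots> \<longleftrightarrow> (\<forall>s. w \<le> s \<and> s < v \<longrightarrow> X s \<omega> \<noteq> 0)"
  proof (intro iffI allI impI ballI)
    fix s assume *: "\<forall>s\<in>?Z. s \<le> w" "w \<le> s \<and> s < v"
    show "X s \<omega> \<noteq> 0"
    proof
      assume "X s \<omega> = 0"
      then have "s = w" using * assms(4) by (intro antisym) auto
      then show False using \<open>X s \<omega> = 0\<close> assms(5) by simp
    qed
  next
    fix s assume "\<forall>s. w \<le> s \<and> s < v \<longrightarrow> X s \<omega> \<noteq> 0" "s \<in> ?Z"
    then show "s \<le> w" by (cases "w \<le> s") auto
  qed
  finally show ?thesis using le_first_zero_iff[OF assms(3), of X w \<omega>] by simp
qed

text \<open>By continuity the path has no zero close to \<open>a\<close>, so the zeros below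
  \<open>a\<close> keep a positive distance from it and their supremum is still less than
  \<open>a\<close>.\<close>

lemma last_zero_less_iff_first_zero:
  fixes X :: "real \<Rightarrow> 'a \<Rightarrow> real"
  assumes "X 0 \<omega> = 0" "0 < v" "v \<le> t" "0 < a" "X a \<omega> \<noteq> 0"
    and cont: "continuous_on {0..} (\<lambda>s. X s \<omega>)"
  shows "last_zero X v \<omega> < a \<longleftrightarrow> v \<le> first_zero X a t \<omega>"
proof
  assume "last_zero X v \<omega> < a"
  then show "v \<le> first_zero X a t \<omega>"
    using last_zero_le_iff[of X \<omega> v t a] assms by auto
next
  assume *: "v \<le> first_zero X a t \<omega>"
  obtain d where d: "d > 0" "\<And>x. x \<in> {0..} \<Longrightarrow> dist x a < d \<Longrightarrow> dist (X x \<omega>) (X a \<omega>) < \<bar>X a \<omega>\<bar>"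
    using cont[unfolded continuous_on_iff, rule_format, of a "\<bar>X a \<omega>\<bar>"] assms by auto
  obtain q where q: "q \<in> \<rat>" "max 0 (a - d) < q" "q < a"
    using Rats_dense_in_real[of "max 0 (a - d)" a] assms d by auto
  have "X s \<omega> \<noteq> 0" if "q \<le> s" "s < v" for s
  proof (cases "a \<le> s")
    case True
    then show ?thesis using * that le_first_zero_iff[OF assms(3), of X a \<omega>] by auto
  next
    case False
    then show ?thesis using d(2)[of s] that q by (auto simp: dist_real_def)
  qed
  then have "v \<le> first_zero X q t \<omega>" using le_first_zero_iff[OF assms(3), of X q \<omega>] by auto
  then show "last_zero X v \<omega> < a"
    using last_zero_less_iff[of X \<omega> v t a] assms q by auto
qed

context brownian_motion
begin

lemma X_0: "\<omega> \<in> space M \<Longrightarrow> X 0 \<mu> 0 \<omega> = 0"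
  by (simp add: X_def B_0)

lemma first_zero_ge_probability:
  assumes "0 < a" "a < t"
  shows "measure M {\<omega>\<in>space M. t \<le> first_zero (X 0 \<mu>) a t \<omega>} = 1 - passage_cdf \<mu> a t"
proof -
  have [measurable]: "first_zero (X 0 \<mu>) a t \<in> borel_measurable M" using assms by simp
  have "measure M {\<omega>\<in>space M. first_zero (X 0 \<mu>) a t \<omega> < t} = passage_cdf \<mu> a t"
    using first_zero_less_probability[OF assms, of \<mu>]
    by (subst (asm) measure_distr) (auto simp: vimage_def Int_def conj_commute)
  then show ?thesis
    using prob_neg[of "\<lambda>\<omega>. first_zero (X 0 \<mu>) a t \<omega> < t"] by (simp add: not_less)
qed

lemma last_zero_le_probability:
  assumes "0 < w" "w < t"
  shows "measure M {\<omega>\<in>space M. last_zero (X 0 \<mu>) t \<omega> \<le> w} = 1 - passage_cdf \<mu> w t"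
proof -
  have [measurable]: "first_zero (X 0 \<mu>) w t \<in> borel_measurable M" "last_zero (X 0 \<mu>) t \<in> borel_measurable M"
    using assms by auto
  have "measure M {\<omega>\<in>space M. last_zero (X 0 \<mu>) t \<omega> \<le> w} =
      measure M {\<omega>\<in>space M. t \<le> first_zero (X 0 \<mu>) w t \<omega>}"
  proof (rule finite_measure_eq_AE)
    show "AE \<omega> in M. (\<omega> \<in> {\<omega>\<in>space M. last_zero (X 0 \<mu>) t \<omega> \<le> w}) =
        (\<omega> \<in> {\<omega>\<in>space M. t \<le> first_zero (X 0 \<mu>) w t \<omega>})"
      using X_AE_nonzero[OF assms(1), of 0 \<mu>] AE_space
      by eventually_elim (use last_zero_le_iff[of "X 0 \<mu>" _ t t w] X_0 assms in auto)
  qed measurable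
  then show ?thesis using first_zero_ge_probability[OF assms] by simp
qed

text \<open>At time 0 \<open>last_zero\<close> is the supremum of the empty set, an unspecified
  value, so the inner last zero must be positive almost surely. It is, because the probability of a
  zero between \<open>w\<close> and \<open>t\<close> tends to 1 as \<open>w\<close> tends to
  0.\<close>

lemma last_zero_AE_pos:
  assumes "0 < t"
  shows "AE \<omega> in M. 0 < last_zero (X 0 \<mu>) t \<omega>"
proof -
  have [measurable]: "last_zero (X 0 \<mu>) t \<in> borel_measurable M" using assms by simp
  let ?E = "{\<omega>\<in>space M. last_zero (X 0 \<mu>) t \<omega> \<le> 0}"
  have "(\<lambda>n. 1 - passage_cdf \<mu> (t / real (Suc (Suc n))) t) \<longlonglongrightarrow> 1 - 1"
    by (intro tendsto_diff tendsto_const passage_cdf_tendsto_1 assms)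
  moreover have "measure M ?E \<le> 1 - passage_cdf \<mu> (t / real (Suc (Suc n))) t" for n
  proof -
    have w: "0 < t / real (Suc (Suc n))" "t / real (Suc (Suc n)) < t"
      using assms by (auto simp: field_simps intro!: add_pos_nonneg)
    have "measure M ?E \<le> measure M {\<omega>\<in>space M. last_zero (X 0 \<mu>) t \<omega> \<le> t / real (Suc (Suc n))}"
      by (rule finite_measure_mono) (use w in auto)
    then show ?thesis using last_zero_le_probability[OF w] by simp
  qed
  ultimately have "measure M ?E \<le> 0"
    by (intro LIMSEQ_le_const[of _ "0 :: real"]) auto
  then have "measure M ?E = 0" using measure_nonneg[of M ?E] by linarith
  then have "AE \<omega> in M. \<not> last_zero (X 0 \<mu>) t \<omega> \<le> 0"
    by (subst (asm) prob_Collect_eq_0) auto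
  then show ?thesis by (simp add: not_le)
qed

end

subsection \<open>The iterated last zero\<close>

text \<open>First and last zeros are not measurable on the product space of all paths, where
  continuity is not an event. The functionals are therefore only required to be measurable for the
  sigma-algebra pulled back to \<open>space M\<close>, where every path is continuous. Its sets are
  preimages, so independence carries over.\<close>

lemma (in prob_space) indep_var_vimage_algebra:
  assumes ind: "indep_var S P T Q"
    and f: "f \<in> measurable (vimage_algebra (space M) P S) N"
    and g: "g \<in> measurable (vimage_algebra (space M) Q T) L"
  shows "indep_var N f L g"
proof -
  have sub: "f -` A \<inter> space M \<in> {P -` C \<inter> space M | C. C \<in> sets S}"
    if "A \<in> sets N" "f \<in> measurable (vimage_algebra (space M) P S) N" "random_variable S P" for A f P S N
  proof -
    have "f -` A \<inter> space M \<in> sets (vimage_algebra (space M) P S)"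
      using measurable_sets[OF that(2,1)] by simp
    also have "\<dots> = {P -` C \<inter> space M | C. C \<in> sets S}"
      by (rule sets_vimage_algebra2) (use that(3) in \<open>auto dest: measurable_space\<close>)
    finally show ?thesis .
  qed
  have rv: "random_variable S P" "random_variable T Q" using ind by (auto simp: indep_var_eq)
  have "random_variable N f"
  proof (rule measurableI)
    show "f x \<in> space N" if "x \<in> space M" for x using measurable_space[OF f] that by simp
    show "f -` A \<inter> space M \<in> events" if "A \<in> sets N" for A
      using sub[OF that f rv(1)] rv(1) by auto
  qed
  moreover have "random_variable L g"
  proof (rule measurableI)
    show "g x \<in> space L" if "x \<in> space M" for x using measurable_space[OF g] that by simp
    show "g -` A \<inter> space M \<in> events" if "A \<in> sets L" for A
      using sub[OF that g rv(2)] rv(2) by auto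
  qed
  moreover have "indep_set (sigma_sets (space M) {f -` A \<inter> space M |A. A \<in> sets N})
      (sigma_sets (space M) {g -` A \<inter> space M |A. A \<in> sets L})"
  proof -
    have s1: "sigma_sets (space M) {f -` A \<inter> space M |A. A \<in> sets N} \<subseteq> sigma_sets (space M) {P -` A \<inter> space M |A. A \<in> sets S}"
      proof (rule sigma_sets_mono, rule subsetI)
      fix E assume "E \<in> {f -` A \<inter> space M |A. A \<in> sets N}"
      then obtain A where "E = f -` A \<inter> space M" "A \<in> sets N" by blast
      then show "E \<in> sigma_sets (space M) {P -` A \<inter> space M |A. A \<in> sets S}"
        using sub[OF _ f rv(1)] by (intro sigma_sets.Basic) simp
    qed
    have s2: "sigma_sets (space M) {g -` A \<inter> space M |A. A \<in> sets L} \<subseteq> sigma_sets (space M) {Q -` A \<inter> space M |A. A \<in> sets T}"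
      proof (rule sigma_sets_mono, rule subsetI)
      fix E assume "E \<in> {g -` A \<inter> space M |A. A \<in> sets L}"
      then obtain A where "E = g -` A \<inter> space M" "A \<in> sets L" by blast
      then show "E \<in> sigma_sets (space M) {Q -` A \<inter> space M |A. A \<in> sets T}"
        using sub[OF _ g rv(2)] by (intro sigma_sets.Basic) simp
    qed
    have "indep_set (sigma_sets (space M) {P -` A \<inter> space M |A. A \<in> sets S})
        (sigma_sets (space M) {Q -` A \<inter> space M |A. A \<in> sets T})"
      using ind by (simp add: indep_var_eq)
    then show ?thesis
      unfolding indep_set_def
      by (rule indep_sets_mono_sets) (use s1 s2 in \<open>simp split: bool.split\<close>)
  qed
  ultimately show ?thesis by (simp add: indep_var_eq)
qed

lemma process_measurable_vimage:
  fixes Y :: "real \<Rightarrow> 'a \<Rightarrow> real"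
  assumes "0 \<le> s"
  shows "Y s \<in> borel_measurable
    (vimage_algebra (space M) (\<lambda>\<omega>. \<lambda>s\<in>{0..}. Y s \<omega>) (\<Pi>\<^sub>M s\<in>{0..}. borel))"
proof -
  let ?P = "\<lambda>\<omega>. \<lambda>s\<in>{0..}. Y s \<omega>"
  have "?P \<in> measurable (vimage_algebra (space M) ?P (\<Pi>\<^sub>M s\<in>{0..}. borel)) (\<Pi>\<^sub>M s\<in>{0..}. borel)"
    by (rule measurable_vimage_algebra1) (auto simp: space_PiM)
  from measurable_compose[OF this measurable_component_singleton[of s]]
  show ?thesis using assms by simp
qed

section \<open>The driftless case\<close>

lemma passage_cdf_driftless_arcsin:
  assumes "0 < v" "v \<le> w"
  shows "passage_cdf 0 v w = 1 - 2 / pi * arcsin (sqrt (v / w))"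
proof -
  have v: "- 1 \<le> sqrt (v / w)" "sqrt (v / w) \<le> 1" using assms by (auto intro: order_trans[of _ 0])
  then have "0 \<le> arccos (sqrt (v / w))" by (rule arccos_lbound)
  then have "passage_cdf 0 v w = 2 / pi * arccos (sqrt (v / w))"
    by (simp add: passage_cdf_def set_lebesgue_integral_def)
  then show ?thesis using v by (simp add: arcsin_arccos_eq field_simps)
qed

text \<open>Integration by parts of \<open>arcsin\<close> against \<open>arccos\<close>: the boundary terms cancel.\<close>

lemma arcsin_passage_integral:
  assumes at: "0 < a" "a < t"
  shows "(LBINT w:{a<..<t}. passage_density 0 a w * (1 - passage_cdf 0 w t)) =
    (LBINT w:{a<..<t}. 2 / pi * arcsin (sqrt (a / w)) * (1 / (pi * sqrt (w * (t - w)))))"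
proof -
  \<comment> \<open>\<open>u w\<close> is the probability that the last zero before \<open>w\<close>
    is less than \<open>a\<close>; \<open>G\<close> is the arcsine law of the last zero before
    \<open>t\<close>, with density \<open>g\<close>.\<close>
  define u where "u w = 2 / pi * arcsin (sqrt (a / w))" for w
  define G where "G w = 2 / pi * arcsin (sqrt (w / t))" for w
  define g where "g w = 1 / (pi * sqrt (w * (t - w)))" for w
  have u_eq: "u w = 1 - passage_cdf 0 a w" if "a \<le> w" for w
    using passage_cdf_driftless_arcsin[of a w] that at by (simp add: u_def)
  have G_eq: "G w = 1 - passage_cdf 0 w t" if "0 < w" "w \<le> t" for w
    using passage_cdf_driftless_arcsin[of w t] that by (simp add: G_def)
  have u': "(u has_real_derivative - passage_density 0 a w) (at w)" if "a < w" for w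
  proof -
    have "((\<lambda>w. 1 - passage_cdf 0 a w) has_real_derivative 0 - passage_density 0 a w) (at w)"
      by (intro DERIV_diff DERIV_const passage_cdf_deriv at that)
    moreover have "\<forall>\<^sub>F x in nhds w. u x = 1 - passage_cdf 0 a x"
      using eventually_nhds_in_open[of "{a<..}" w] that by (auto elim!: eventually_mono simp: u_eq)
    ultimately show ?thesis by (subst DERIV_cong_ev[OF refl _ refl]) auto
  qed
  have G': "(G has_real_derivative g w) (at w)" if w: "a < w" "w < t" for w
  proof -
    define p where "p = sqrt w"
    define r where "r = sqrt (t - w)"
    define q where "q = sqrt t"
    have pos: "0 < p" "0 < r" "0 < q" and sq: "p * p = w" "r * r = t - w" "q * q = t"
      using w at by (auto simp: p_def q_def r_def)
    have "((\<lambda>w. sqrt (w / t)) has_real_derivative inverse (sqrt (w / t)) / 2 * (1 / t)) (at w)"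
      by (rule DERIV_chain2[OF DERIV_real_sqrt]) (use w at in \<open>auto intro!: derivative_eq_intros\<close>)
    moreover have "- 1 < sqrt (w / t)" "sqrt (w / t) < 1"
      using w at by (auto intro: less_le_trans[of _ 0])
    ultimately have "(G has_real_derivative 2 / pi * (inverse (sqrt (1 - (sqrt (w / t))\<^sup>2)) *
        (inverse (sqrt (w / t)) / 2 * (1 / t)))) (at w)"
      unfolding G_def[abs_def] by (intro DERIV_cmult DERIV_chain2[where f = arcsin, OF DERIV_arcsin])
    moreover have "2 / pi * (inverse (sqrt (1 - (sqrt (w / t))\<^sup>2)) * (inverse (sqrt (w / t)) / 2 * (1 / t))) = g w"
    proof -
      have "1 - (sqrt (w / t))\<^sup>2 = (t - w) / t" using w at by (simp add: field_simps)
      then have 1: "sqrt (1 - (sqrt (w / t))\<^sup>2) = r / q" by (simp add: r_def q_def real_sqrt_divide)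
      have 2: "sqrt (w / t) = p / q" by (simp add: p_def q_def real_sqrt_divide)
      have 3: "g w = 1 / (pi * (p * r))" by (simp add: g_def p_def r_def real_sqrt_mult)
      show ?thesis unfolding 1 unfolding 2 3 unfolding sq(3)[symmetric] using pos by (simp add: field_simps)
    qed
    ultimately show ?thesis by simp
  qed
  have u01: "0 \<le> u w" "u w \<le> 1" if "a \<le> w" for w
  proof -
    have "0 \<le> sqrt (a / w)" "sqrt (a / w) \<le> 1" "- 1 \<le> sqrt (a / w)"
      using that at by (auto intro: order_trans[of _ 0])
    then have "0 \<le> arcsin (sqrt (a / w))" "arcsin (sqrt (a / w)) \<le> pi / 2"
      using arcsin_le_arcsin[of 0 "sqrt (a / w)"] arcsin_bounded[of "sqrt (a / w)"] by auto
    then show "0 \<le> u w" "u w \<le> 1" by (auto simp: u_def field_simps)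
  qed
  have G01: "0 \<le> G w" "G w \<le> 1" if "0 < w" "w \<le> t" for w
  proof -
    have "0 \<le> sqrt (w / t)" "sqrt (w / t) \<le> 1" "- 1 \<le> sqrt (w / t)"
      using that at by (auto intro: order_trans[of _ 0])
    then have "0 \<le> arcsin (sqrt (w / t))" "arcsin (sqrt (w / t)) \<le> pi / 2"
      using arcsin_le_arcsin[of 0 "sqrt (w / t)"] arcsin_bounded[of "sqrt (w / t)"] by auto
    then show "0 \<le> G w" "G w \<le> 1" by (auto simp: G_def field_simps)
  qed
  have e: "einterval (ereal a) (ereal t) = {a<..<t}" by (auto simp: einterval_def)
  have cont_u: "continuous_on {a..t} u"
    unfolding u_def[abs_def] using at by (intro continuous_intros) (auto intro: order_trans[of _ 0])
  have cont_G: "continuous_on {a..t} G"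
    unfolding G_def[abs_def] using at by (intro continuous_intros) (auto intro: order_trans[of _ 0])
  have lim: "((f \<circ> real_of_ereal) \<longlongrightarrow> f a) (at_right (ereal a))" "((f \<circ> real_of_ereal) \<longlongrightarrow> f t) (at_left (ereal t))"
    if "continuous_on {a..t} f" for f :: "real \<Rightarrow> real"
    using that at by (simp_all only: ereal_tendsto_simps continuous_on_Icc_at_rightD continuous_on_Icc_at_leftD)
  have cont_g: "isCont g w" if "a < w" "w < t" for w
    unfolding g_def[abs_def] using that at by (intro continuous_intros) auto
  have cont_d: "isCont (passage_density 0 a) w" if "a < w" for w
    unfolding passage_density_def[abs_def] using that at by (intro continuous_intros) auto
  have "set_integrable lborel (einterval (ereal a) (ereal t)) g"
  proof (rule interval_integral_FTC_nonneg(1)[OF _ _ _ _ lim(1)[OF cont_G] lim(2)[OF cont_G]])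
    show "AE x in lborel. ereal a < ereal x \<longrightarrow> ereal x < ereal t \<longrightarrow> 0 \<le> g x"
      using at by (intro AE_I2) (auto simp: g_def)
  qed (use G' cont_g at in auto)
  then have int_g: "set_integrable lborel {a<..<t} g" by (simp only: e)
  have int_ug: "set_integrable lborel {a<..<t} (\<lambda>w. u w * g w)"
  proof (rule set_integrable_bound[OF int_g])
    show "AE w in lborel. w \<in> {a<..<t} \<longrightarrow> norm (u w * g w) \<le> norm (g w)"
      using u01 by (intro AE_I2) (auto simp: abs_mult intro!: mult_left_le_one_le)
  qed (auto simp: set_borel_measurable_def intro!: borel_measurable_continuous_on_indicator
      continuous_at_imp_continuous_on continuous_intros cont_g cont_d DERIV_isCont[OF u'] DERIV_isCont[OF G'] simp del: real_scaleR_def)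
  have int_dG: "set_integrable lborel {a<..<t} (\<lambda>w. passage_density 0 a w * G w)"
  proof (rule set_integrable_bound[OF passage_density_FTC(1)[OF at]])
    show "AE w in lborel. w \<in> {a<..<t} \<longrightarrow> norm (passage_density 0 a w * G w) \<le> norm (passage_density 0 a w)"
      using G01 at by (intro AE_I2) (auto simp: abs_mult intro!: mult_left_le)
  qed (auto simp: set_borel_measurable_def intro!: borel_measurable_continuous_on_indicator
      continuous_at_imp_continuous_on continuous_intros cont_g cont_d DERIV_isCont[OF u'] DERIV_isCont[OF G'] simp del: real_scaleR_def)
  have "(LBINT w=ereal a..ereal t. u w * g w - passage_density 0 a w * G w) = u t * G t - u a * G a"
  proof (rule interval_integral_FTC_integrable)
    show "((\<lambda>w. u w * G w) has_vector_derivative u w * g w - passage_density 0 a w * G w) (at w)"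
      if "ereal a < ereal w" "ereal w < ereal t" for w
      using DERIV_mult[OF u'[of w] G'[of w]] that
      by (simp add: has_real_derivative_iff_has_vector_derivative[symmetric] algebra_simps)
    show "isCont (\<lambda>w. u w * g w - passage_density 0 a w * G w) w"
      if "ereal a < ereal w" "ereal w < ereal t" for w
      using that by (intro continuous_intros cont_g cont_d DERIV_isCont[OF u'] DERIV_isCont[OF G']) auto
    show "set_integrable lborel (einterval (ereal a) (ereal t)) (\<lambda>w. u w * g w - passage_density 0 a w * G w)"
      unfolding e by (intro set_integral_diff int_ug int_dG)
    show "(((\<lambda>w. u w * G w) \<circ> real_of_ereal) \<longlongrightarrow> u a * G a) (at_right (ereal a))"
      "(((\<lambda>w. u w * G w) \<circ> real_of_ereal) \<longlongrightarrow> u t * G t) (at_left (ereal t))"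
      using lim[OF continuous_on_mult[OF cont_u cont_G]] by simp_all
  qed (use at in auto)
  \<comment> \<open>\<open>u a\<close> and \<open>G t\<close> are 1, while \<open>u t\<close> and
    \<open>G a\<close> agree.\<close>
  also have "\<dots> = 0"
    using at by (simp add: u_def G_def)
  finally have "(LBINT w:{a<..<t}. u w * g w - passage_density 0 a w * G w) = 0"
    using at by (simp add: interval_lebesgue_integral_def e)
  then have "(LBINT w:{a<..<t}. u w * g w) = (LBINT w:{a<..<t}. passage_density 0 a w * G w)"
    using set_integral_diff(2)[OF int_ug int_dG] by simp
  also have "\<dots> = (LBINT w:{a<..<t}. passage_density 0 a w * (1 - passage_cdf 0 w t))"
    by (rule set_lebesgue_integral_cong) (use at in \<open>auto simp: G_eq\<close>)
  finally show ?thesis by (simp add: u_def g_def)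
qed

lemma LBINT_Icc_eq_Ioo:
  fixes f :: "real \<Rightarrow> real"
  shows "(LBINT w:{a..t}. f w) = (LBINT w:{a<..<t}. f w)"
  unfolding set_lebesgue_integral_def
  by (rule integral_discrete_difference[of "{a, t}"]) (auto split: split_indicator)

lemma iterated_last_zero:
  assumes bm: "standard_brownian_motion M B1" "standard_brownian_motion M B2"
    and indep: "indep_processes M (with_drift \<mu>1 B1) (with_drift \<mu>2 B2)"
    and at: "0 < a" "a < t"
  shows "measure M {\<omega> \<in> space M.
        last_zero (with_drift \<mu>1 B1) (last_zero (with_drift \<mu>2 B2) t \<omega>) \<omega> < a}
      = measure M {\<omega> \<in> space M. last_zero (with_drift \<mu>1 B1) t \<omega> < a}
        + (LBINT w:{a<..<t}. passage_density \<mu>1 a w * (1 - passage_cdf \<mu>2 w t))" (is "measure M ?E = measure M ?F + _")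
    "measure M {\<omega> \<in> space M. last_zero (with_drift \<mu>1 B1) t \<omega> < a} = 1 - passage_cdf \<mu>1 a t"
proof -
  interpret W1: brownian_motion M B1 by (unfold_locales) (rule bm)
  interpret W2: brownian_motion M B2 by (unfold_locales) (rule bm)
  define Y1 where "Y1 = with_drift \<mu>1 B1"
  define Y2 where "Y2 = with_drift \<mu>2 B2"
  have Y1_X: "Y1 = W1.X 0 \<mu>1" and Y2_X: "Y2 = W2.X 0 \<mu>2"
    by (simp_all add: Y1_def Y2_def with_drift_def W1.X_def W2.X_def fun_eq_iff)
  have cont1: "continuous_on {0..} (\<lambda>s. Y1 s \<omega>)" and cont2: "continuous_on {0..} (\<lambda>s. Y2 s \<omega>)"
    if "\<omega> \<in> space M" for \<omega>
    using that by (auto simp: Y1_X Y2_X W1.X_continuous W2.X_continuous)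
  have zero1: "Y1 0 \<omega> = 0" and zero2: "Y2 0 \<omega> = 0" if "\<omega> \<in> space M" for \<omega>
    using that by (auto simp: Y1_X Y2_X W1.X_0 W2.X_0)
  define D where "D = first_zero Y1 a t"
  define T where "T = last_zero Y2 t"
  have D_X: "D = first_zero (W1.X 0 \<mu>1) a t" and T_X: "T = last_zero (W2.X 0 \<mu>2) t"
    by (simp_all add: D_def T_def Y1_X Y2_X)
  have [measurable]: "D \<in> borel_measurable M" "T \<in> borel_measurable M"
    "last_zero Y1 t \<in> borel_measurable M"
    using at by (auto simp: D_X T_X Y1_X)
  have meas_q: "first_zero Y1 q t \<in> borel_measurable M" if "0 \<le> q" for q
    using that by (auto simp: Y1_X)
  have T_le: "T \<omega> \<le> t" if "\<omega> \<in> space M" for \<omega>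
    unfolding T_def using last_zero_bounds(2)[of Y2 \<omega> t] zero2[OF that] at by auto
  have ae_a: "AE \<omega> in M. Y1 a \<omega> \<noteq> 0" unfolding Y1_X by (rule W1.X_AE_nonzero) (rule at)
  have ae_T: "AE \<omega> in M. 0 < T \<omega>" unfolding T_X by (rule W2.last_zero_AE_pos) (use at in auto)
  have iff: "last_zero Y1 v \<omega> < a \<longleftrightarrow> v \<le> D \<omega>"
    if "\<omega> \<in> space M" "Y1 a \<omega> \<noteq> 0" "0 < v" "v \<le> t" for v \<omega>
    unfolding D_def
    by (rule last_zero_less_iff_first_zero) (use that at zero1 cont1 in auto)
  have E_meas: "{\<omega> \<in> space M. last_zero Y1 (T \<omega>) \<omega> < a} \<in> sets M"
  proof -
    \<comment> \<open>On \<open>T \<omega> \<le> 0\<close> the iterated zero is the supremum of the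
      empty set, the constant \<open>c\<close>. As \<open>M\<close> need not be complete, this null
      event has to be treated explicitly.\<close>
    define c where "c = Sup {s :: real. False}"
    have "{\<omega> \<in> space M. last_zero Y1 (T \<omega>) \<omega> < a} = {\<omega> \<in> space M. T \<omega> \<le> 0 \<and> c < a} \<union>
        {\<omega> \<in> space M. 0 < T \<omega> \<and> (\<exists>q\<in>{q\<in>\<rat>. 0 \<le> q \<and> q < a}. T \<omega> \<le> first_zero Y1 q t \<omega>)}" (is "?L = ?R")
    proof -
      have "last_zero Y1 (T \<omega>) \<omega> < a \<longleftrightarrow> (\<exists>q\<in>{q\<in>\<rat>. 0 \<le> q \<and> q < a}. T \<omega> \<le> first_zero Y1 q t \<omega>)"
        if "\<omega> \<in> space M" "0 < T \<omega>" for \<omega>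
        using last_zero_less_iff[of Y1 \<omega> "T \<omega>" t a] that zero1 T_le by auto
      moreover have "last_zero Y1 (T \<omega>) \<omega> = c" if "T \<omega> \<le> 0" for \<omega>
      proof -
        have *: "{s. 0 \<le> s \<and> s < T \<omega> \<and> Y1 s \<omega> = 0} = {s. False}" using that by auto
        show ?thesis unfolding last_zero_def c_def * ..
      qed
      ultimately show ?thesis by (auto simp: not_less[symmetric])
    qed
    also have "\<dots> \<in> sets M"
    proof (intro sets.Un sets.sets_Collect_conj sets.sets_Collect_countable_Ex')
      show "countable {q\<in>\<rat>. 0 \<le> q \<and> q < a}"
        by (rule countable_subset[of _ "\<rat>"]) (auto simp: countable_rat)
      fix q assume "q \<in> {q\<in>\<rat>. 0 \<le> q \<and> q < a}"
      then have [measurable]: "first_zero Y1 q t \<in> borel_measurable M" by (intro meas_q) auto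
      show "{\<omega> \<in> space M. T \<omega> \<le> first_zero Y1 q t \<omega>} \<in> sets M" by measurable
    qed measurable
    finally show ?thesis .
  qed
  have F_eq: "measure M {\<omega> \<in> space M. last_zero Y1 t \<omega> < a} = measure M {\<omega> \<in> space M. t \<le> D \<omega>}"
  proof (rule W1.finite_measure_eq_AE)
    show "AE \<omega> in M. (\<omega> \<in> {\<omega> \<in> space M. last_zero Y1 t \<omega> < a}) = (\<omega> \<in> {\<omega> \<in> space M. t \<le> D \<omega>})"
      using ae_a AE_space by eventually_elim (use iff[of _ t] at in auto)
  qed measurable
  then show F_val: "measure M ?F = 1 - passage_cdf \<mu>1 a t"
    using W1.first_zero_ge_probability[OF at, of \<mu>1] by (simp add: Y1_def D_X)
  \<comment> \<open>\<open>iff\<close> is a statement about single paths, so it applies with the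
    random time \<open>T \<omega>\<close> as \<open>v\<close>.\<close>
  have "measure M {\<omega> \<in> space M. last_zero Y1 (T \<omega>) \<omega> < a} = measure M {\<omega> \<in> space M. T \<omega> \<le> D \<omega>}"
  proof (rule W1.finite_measure_eq_AE[OF _ E_meas])
    show "AE \<omega> in M. (\<omega> \<in> {\<omega> \<in> space M. last_zero Y1 (T \<omega>) \<omega> < a}) = (\<omega> \<in> {\<omega> \<in> space M. T \<omega> \<le> D \<omega>})"
      using ae_a ae_T AE_space by eventually_elim (use iff T_le in auto)
  qed measurable
  \<comment> \<open>\<open>t \<le> D \<omega>\<close> means \<open>D \<omega> = t\<close>, and then
    \<open>T \<omega> \<le> D \<omega>\<close> is automatic; this part is the first summand of the
    formula.\<close>
  also have "{\<omega> \<in> space M. T \<omega> \<le> D \<omega>} = {\<omega> \<in> space M. t \<le> D \<omega>} \<union> {\<omega> \<in> space M. D \<omega> < t \<and> T \<omega> \<le> D \<omega>}"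
    using T_le by fastforce
  also have "measure M \<dots> = measure M {\<omega> \<in> space M. t \<le> D \<omega>} + measure M {\<omega> \<in> space M. D \<omega> < t \<and> T \<omega> \<le> D \<omega>}"
    by (rule W1.finite_measure_Union) auto
  also have "measure M {\<omega> \<in> space M. D \<omega> < t \<and> T \<omega> \<le> D \<omega>} =
      (LBINT w:{a<..<t}. passage_density \<mu>1 a w * (1 - passage_cdf \<mu>2 w t))"
  proof -
    define H where "H = cdf (distr M borel T)"
    interpret T: real_distribution "distr M borel T" by (rule W1.real_distribution_distr) simp
    have H: "H w = measure M {\<omega> \<in> space M. T \<omega> \<le> w}" for w
      unfolding H_def cdf_def by (subst measure_distr) (auto intro!: arg_cong[where f = "measure M"])
    have [measurable]: "H \<in> borel_measurable borel"
      unfolding H_def by (intro borel_measurable_mono monoI T.cdf_nondecreasing)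
    have [measurable]: "passage_density \<mu>1 a \<in> borel_measurable borel"
      unfolding passage_density_def by measurable
    have ind: "W1.indep_var borel D borel T"
    proof (rule W1.indep_var_vimage_algebra[OF indep[unfolded indep_processes_def]])
      show "D \<in> borel_measurable (vimage_algebra (space M) (\<lambda>\<omega>. \<lambda>s\<in>{0..}. with_drift \<mu>1 B1 s \<omega>) (\<Pi>\<^sub>M s\<in>{0..}. borel))"
        unfolding D_def Y1_def
        by (rule first_zero_measurable) (use at cont1 in \<open>auto simp: Y1_def intro: process_measurable_vimage\<close>)
      show "T \<in> borel_measurable (vimage_algebra (space M) (\<lambda>\<omega>. \<lambda>s\<in>{0..}. with_drift \<mu>2 B2 s \<omega>) (\<Pi>\<^sub>M s\<in>{0..}. borel))"
        unfolding T_def Y2_def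
        by (rule last_zero_measurable) (use at cont2 zero2 in \<open>auto simp: Y2_def intro: process_measurable_vimage\<close>)
    qed
    \<comment> \<open>The restriction to \<open>d < t\<close> leaves the absolutely continuous part
      of the law of \<open>D\<close>; freezing \<open>D\<close> turns the condition on
      \<open>T\<close> into the value \<open>H (D \<omega>)\<close>.\<close>
    define f :: "real \<times> real \<Rightarrow> real" where "f = (\<lambda>(d, z). indicator {..<t} d * indicator {..d} z)"
    have "f = (\<lambda>x. if fst x < t \<and> snd x \<le> fst x then 1 else 0)"
      by (auto simp: f_def split: split_indicator)
    then have f [measurable]: "f \<in> borel_measurable (borel \<Otimes>\<^sub>M borel)" by simp
    have "measure M {\<omega> \<in> space M. D \<omega> < t \<and> T \<omega> \<le> D \<omega>} =
        (\<integral>\<omega>. indicator {\<omega> \<in> space M. D \<omega> < t \<and> T \<omega> \<le> D \<omega>} \<omega> \<partial>M)" by simp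
    also have "\<dots> = (\<integral>\<omega>. f (D \<omega>, T \<omega>) \<partial>M)"
      by (rule Bochner_Integration.integral_cong) (auto simp: f_def split: split_indicator)
    also have "\<dots> = (\<integral>\<omega>. (\<integral>\<omega>'. f (D \<omega>, T \<omega>') \<partial>M) \<partial>M)"
    proof (rule W1.indep_var_lebesgue_integral[OF ind f], rule W1.integrable_const_bound[of _ 1])
      show "AE \<omega> in M. norm (f (D \<omega>, T \<omega>)) \<le> 1"
        by (intro AE_I2) (auto simp: f_def split: split_indicator)
    qed measurable
    also have "\<dots> = (\<integral>\<omega>. indicator {..<t} (D \<omega>) * H (D \<omega>) \<partial>M)"
    proof (rule Bochner_Integration.integral_cong[OF refl])
      fix \<omega>
      have "(\<integral>\<omega>'. indicator {..D \<omega>} (T \<omega>') \<partial>M) = (\<integral>\<omega>'. indicat_real {\<omega>' \<in> space M. T \<omega>' \<le> D \<omega>} \<omega>' \<partial>M)"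
        by (rule Bochner_Integration.integral_cong) (auto split: split_indicator)
      then show "(\<integral>\<omega>'. f (D \<omega>, T \<omega>') \<partial>M) = indicator {..<t} (D \<omega>) * H (D \<omega>)"
        by (simp add: f_def H)
    qed
    also have "\<dots> = (\<integral>d. indicator {..<t} d * H d \<partial>distr M borel D)"
      by (rule integral_distr[symmetric]) auto
    also have "\<dots> = (\<integral>d. H d \<partial>density (distr M borel D) (\<lambda>d. ennreal (indicator {..<t} d)))"
      by (subst integral_density) auto
    also have "density (distr M borel D) (\<lambda>d. ennreal (indicator {..<t} d)) =
        density lborel (\<lambda>w. ennreal (passage_density \<mu>1 a w * indicator {a<..<t} w))"
      using W1.first_zero_distr[OF at, of \<mu>1]
      by (simp add: D_X ennreal_indicator ennreal_mult'' )
    also have "(\<integral>d. H d \<partial>\<dots>) = (\<integral>w. passage_density \<mu>1 a w * indicator {a<..<t} w * H w \<partial>lborel)"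
      using at by (subst integral_density) (auto simp: passage_density_def split: split_indicator)
    also have "\<dots> = (LBINT w:{a<..<t}. passage_density \<mu>1 a w * (1 - passage_cdf \<mu>2 w t))"
      unfolding set_lebesgue_integral_def
    proof (rule Bochner_Integration.integral_cong[OF refl])
      fix w
      show "passage_density \<mu>1 a w * indicator {a<..<t} w * H w =
          indicator {a<..<t} w *\<^sub>R (passage_density \<mu>1 a w * (1 - passage_cdf \<mu>2 w t))"
        using W2.last_zero_le_probability[of w t \<mu>2] at by (simp add: H T_X split: split_indicator)
    qed
    finally show ?thesis .
  qed
  finally show "measure M ?E = measure M ?F + (LBINT w:{a<..<t}. passage_density \<mu>1 a w * (1 - passage_cdf \<mu>2 w t))"
    using F_eq by (simp add: Y1_def T_def Y2_def)
qed

theorem mainTheorem8: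
  fixes M :: "'a measure"
    and B1 B2 :: "real \<Rightarrow> 'a \<Rightarrow> real"
    and \<mu>1 \<mu>2 a t :: real
  assumes "prob_space M"
    and "standard_brownian_motion M B1"
    and "standard_brownian_motion M B2"
    and "indep_processes M (with_drift \<mu>1 B1) (with_drift \<mu>2 B2)"
    and "0 < a" and "a < t"
  shows
    "measure M {\<omega> \<in> space M.
        last_zero (with_drift \<mu>1 B1) (last_zero (with_drift \<mu>2 B2) t \<omega>) \<omega> < a}
      = measure M {\<omega> \<in> space M. last_zero (with_drift \<mu>1 B1) t \<omega> < a}
        + (LBINT w:{a..t}. exp (- (\<mu>1\<^sup>2 * w / 2)) * (sqrt a / (pi * w * sqrt (w - a))) *
             (1 - 2 / pi * exp (- (\<mu>2\<^sup>2 * w / 2)) *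
                (LBINT \<theta>:{0..arccos (sqrt (w / t))}. exp (- (\<mu>2\<^sup>2 * w / 2) * (tan \<theta>)\<^sup>2))))
     \<and> (\<mu>1 = 0 \<and> \<mu>2 = 0 \<longrightarrow>
        measure M {\<omega> \<in> space M.
          last_zero (with_drift \<mu>1 B1) (last_zero (with_drift \<mu>2 B2) t \<omega>) \<omega> < a}
        = 2 / pi * arcsin (sqrt (a / t))
          + (LBINT w:{a..t}. 2 / pi * arcsin (sqrt (a / w)) * (1 / (pi * sqrt (w * (t - w))))))"
proof (intro conjI impI)
  note main = iterated_last_zero[OF assms(2-6)]
  show "measure M {\<omega> \<in> space M.
        last_zero (with_drift \<mu>1 B1) (last_zero (with_drift \<mu>2 B2) t \<omega>) \<omega> < a}
      = measure M {\<omega> \<in> space M. last_zero (with_drift \<mu>1 B1) t \<omega> < a}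
        + (LBINT w:{a..t}. exp (- (\<mu>1\<^sup>2 * w / 2)) * (sqrt a / (pi * w * sqrt (w - a))) *
             (1 - 2 / pi * exp (- (\<mu>2\<^sup>2 * w / 2)) *
                (LBINT \<theta>:{0..arccos (sqrt (w / t))}. exp (- (\<mu>2\<^sup>2 * w / 2) * (tan \<theta>)\<^sup>2))))"
    unfolding LBINT_Icc_eq_Ioo[of a t] using main(1) unfolding passage_density_def passage_cdf_def .
  assume "\<mu>1 = 0 \<and> \<mu>2 = 0"
  then have \<mu>: "\<mu>1 = 0" "\<mu>2 = 0" by auto
  have "passage_cdf 0 a t = 1 - 2 / pi * arcsin (sqrt (a / t))"
    using passage_cdf_driftless_arcsin[of a t] assms by simp
  then show "measure M {\<omega> \<in> space M.
          last_zero (with_drift \<mu>1 B1) (last_zero (with_drift \<mu>2 B2) t \<omega>) \<omega> < a}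
        = 2 / pi * arcsin (sqrt (a / t))
          + (LBINT w:{a..t}. 2 / pi * arcsin (sqrt (a / w)) * (1 / (pi * sqrt (w * (t - w)))))"
    \<comment> \<open>The first summand is already the arcsine term; the integral takes its arcsine
      form through the integration by parts.\<close>
    unfolding \<mu> LBINT_Icc_eq_Ioo arcsin_passage_integral[OF assms(5,6), symmetric]
      main[unfolded \<mu>] by simp
qed

end
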